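(* Let $R(z,w)\in\mathbb{C}(z,w)$. There exist explicit constants $B_1$ and $B_2$, depending only on $\deg_w(R)$ and $\deg_z(R)$, such that: (1) If $\deg_w(R)\ge 2$, then there are at most $B_1$ rational functions $f\in\mathbb{C}(z)$ satisfying the difference equation $f(z+1)=R(z,f(z))$, and the set of such solutions is effectively computable. (2) If $\deg_w(R)\ge 3$, then there are at most $B_2$ rational functions $f\in\mathbb{C}(z)$ satisfying the differential equation $f'(z)=R(z,f(z))$, and the set of such solutions is effectively computable.
   Context: Write $d=\deg_w(R)$ and represent $R$ as $R(z,X/Y)=P(X,Y)/Q(X,Y)$, where $P,Q$ are homogeneous forms of degree $d$ in $X,Y$ with coefficients in $\mathbb{C}[z]$ and no common factor; $\deg_z(R)$ denotes the maximal degree in $z$ of these coefficients. *)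

theory Defs
  imports
    "HOL-Computational_Algebra.Computational_Algebra"
    "HOL-Computational_Algebra.Field_as_Ring"
    "HOL-Library.Nat_Bijection"
    "HOL-Library.Countable_Set"
begin

section \<open>Rational functions\<close>

type_synonym ratfun = "complex poly fract"

text \<open>
  Elements of \<open>\<complex>(z,w)\<close> are fractions of elements of \<open>\<complex>[z][w]\<close>: the
  outer polynomial variable is \<open>w\<close> and the inner one is \<open>z\<close>.
\<close>

type_synonym ratfun2 = "complex poly poly fract"

text \<open>
  \<open>quot_of_fract R = (p, q)\<close> is the representation of \<open>R\<close> in lowest terms over
  \<open>\<complex>[z][w]\<close>. The homogeneous forms of \<open>R(z,X/Y)\<close> are \<open>P(X,Y) = Y^d * p(X/Y)\<close> and
  \<open>Q(X,Y) = Y^d * q(X/Y)\<close> with \<open>d = max (degree p) (degree q)\<close>; they have the same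
  coefficients as \<open>p\<close> and \<open>q\<close>.
\<close>

definition num2 :: "ratfun2 \<Rightarrow> complex poly poly" where
  "num2 R = fst (quot_of_fract R)"

definition den2 :: "ratfun2 \<Rightarrow> complex poly poly" where
  "den2 R = snd (quot_of_fract R)"

definition deg_w :: "ratfun2 \<Rightarrow> nat" where
  "deg_w R = max (degree (num2 R)) (degree (den2 R))"

definition deg_z :: "ratfun2 \<Rightarrow> nat" where
  "deg_z R = Max (degree ` (set (coeffs (num2 R)) \<union> set (coeffs (den2 R))))"

lemma deg_w_deg_z_Fract:
  assumes "coprime p q" "q \<noteq> 0"
  shows "deg_w (Fract p q) = max (degree p) (degree q)"
    and "deg_z (Fract p q) = Max (degree ` (set (coeffs p) \<union> set (coeffs q)))"
proof -
  obtain v c where u: "is_unit (unit_factor q)" and uv: "unit_factor q * v = 1"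
    and c: "c \<noteq> 0" "v = [:[:c:]:]"
  proof -
    have u: "is_unit (unit_factor q)" using assms(2) by simp
    then obtain v where v: "1 = unit_factor q * v" by (rule dvdE)
    hence "is_unit v" by (metis dvd_triv_right)
    then obtain a where a: "v = [:a:]" "is_unit a" by (auto simp: is_unit_poly_iff)
    then obtain c where ac: "a = [:c:]" "c dvd 1" by (auto simp: is_unit_poly_iff)
    hence "c \<noteq> 0" by (metis dvd_0_left zero_neq_one)
    thus thesis using that[of v c] u v a ac by simp
  qed
  have div: "r div unit_factor q = smult [:c:] r" for r :: "complex poly poly"
  proof -
    have "r = unit_factor q * (v * r)" by (simp only: mult.assoc[symmetric] uv mult_1_left)
    hence "r div unit_factor q = v * r"
      using assms(2) by (metis nonzero_mult_div_cancel_left unit_factor_eq_0_iff)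
    thus ?thesis by (simp add: c(2))
  qed
  have q: "quot_of_fract (Fract p q) = (smult [:c:] p, smult [:c:] q)"
    using quot_of_fract_quot_to_fract[of "(p, q)"] assms
    by (simp add: quot_to_fract_def normalize_quot_def Let_def div div[of q, simplified])
  have "degree ` set (coeffs (smult [:c:] r)) = degree ` set (coeffs r)" for r :: "complex poly poly"
    using c(1) by (simp add: coeffs_smult image_image)
  thus "deg_w (Fract p q) = max (degree p) (degree q)"
    "deg_z (Fract p q) = Max (degree ` (set (coeffs p) \<union> set (coeffs q)))"
    using c(1) by (simp_all add: deg_w_def deg_z_def num2_def den2_def q image_Un)
qed

definition shift :: "ratfun \<Rightarrow> ratfun" where
  "shift f = Fract (pcompose (fst (quot_of_fract f)) [:1, 1:])
                   (pcompose (snd (quot_of_fract f)) [:1, 1:])"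

definition ratfun_deriv :: "ratfun \<Rightarrow> ratfun" where
  "ratfun_deriv f = (let a = fst (quot_of_fract f); b = snd (quot_of_fract f)
                     in Fract (pderiv a * b - a * pderiv b) (b ^ 2))"

lemma shift_Fract:
  assumes "b \<noteq> 0"
  shows "shift (Fract a b) = Fract (pcompose a [:1, 1:]) (pcompose b [:1, 1:])"
proof -
  obtain c d where cd: "quot_of_fract (Fract a b) = (c, d)" by (cases "quot_of_fract (Fract a b)")
  have d: "d \<noteq> 0" using snd_quot_of_fract_nonzero[of "Fract a b"] cd by simp
  have "Fract c d = Fract a b"
    using quot_to_fract_quot_of_fract[of "Fract a b"] cd by (simp add: quot_to_fract_def)
  hence "c * b = a * d" using assms d by (simp add: eq_fract)
  hence "pcompose c [:1, 1:] * pcompose b [:1, 1:] = pcompose a [:1, 1:] * pcompose d [:1, 1:]"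
    by (metis pcompose_mult)
  moreover have "pcompose b [:1, 1:] \<noteq> 0" "pcompose d [:1, 1:] \<noteq> 0"
    using assms d pcompose_eq_0 by fastforce+
  ultimately show ?thesis by (simp add: shift_def cd eq_fract)
qed

lemma ratfun_deriv_Fract:
  assumes "b \<noteq> 0"
  shows "ratfun_deriv (Fract a b) = Fract (pderiv a * b - a * pderiv b) (b ^ 2)"
proof -
  obtain c d where cd: "quot_of_fract (Fract a b) = (c, d)" by (cases "quot_of_fract (Fract a b)")
  have d: "d \<noteq> 0" using snd_quot_of_fract_nonzero[of "Fract a b"] cd by simp
  have "Fract c d = Fract a b"
    using quot_to_fract_quot_of_fract[of "Fract a b"] cd by (simp add: quot_to_fract_def)
  hence e: "c * b = a * d" using assms d by (simp add: eq_fract)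
  hence e': "c * pderiv b + b * pderiv c = a * pderiv d + d * pderiv a"
    by (metis pderiv_mult)
  have "(pderiv c * d - c * pderiv d) * b ^ 2 = (pderiv a * b - a * pderiv b) * d ^ 2"
    using e e' by algebra
  thus ?thesis using assms d by (simp add: ratfun_deriv_def cd eq_fract)
qed

text \<open>
  \<open>eq_subst g R f\<close> is \<open>g(z) = R(z,f(z))\<close> for \<open>g \<in> \<complex>(z)\<close>. If the denominator vanishes
  identically at \<open>w = f(z)\<close> then \<open>R(z,f(z))\<close> is \<open>\<infinity>\<close> (numerator and denominator being
  coprime), and the equation fails; the guard is needed because \<open>x / 0 = 0\<close> in the library.
\<close>

definition eq_subst :: "ratfun \<Rightarrow> ratfun2 \<Rightarrow> ratfun \<Rightarrow> bool" where
  "eq_subst g R f \<longleftrightarrow>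
     poly (fract_poly (den2 R)) f \<noteq> 0 \<and>
     g = poly (fract_poly (num2 R)) f / poly (fract_poly (den2 R)) f"

definition difference_solutions :: "ratfun2 \<Rightarrow> ratfun set" where
  "difference_solutions R = {f. eq_subst (shift f) R f}"

definition differential_solutions :: "ratfun2 \<Rightarrow> ratfun set" where
  "differential_solutions R = {f. eq_subst (ratfun_deriv f) R f}"


section \<open>Computability\<close>

text \<open>
  Kleene's general recursive functions relative to an oracle \<open>\<omega>\<close>, uniformly for all oracles
  in a class \<open>W\<close>. \<open>recursive_in W n F\<close> says that \<open>F \<omega>\<close> is an \<open>n\<close>-ary function (only
  its values on lists of length \<open>n\<close> matter) given by one and the same recursion scheme for
  every \<open>\<omega> \<in> W\<close>; minimization is applied only where the search always succeeds, so all
  functions are total.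
\<close>

inductive recursive_in ::
    "(nat \<Rightarrow> nat) set \<Rightarrow> nat \<Rightarrow> ((nat \<Rightarrow> nat) \<Rightarrow> nat list \<Rightarrow> nat) \<Rightarrow> bool"
  for W where
  zero: "recursive_in W n (\<lambda>\<omega> xs. 0)"
| succ: "recursive_in W 1 (\<lambda>\<omega> xs. Suc (xs ! 0))"
| proj: "i < n \<Longrightarrow> recursive_in W n (\<lambda>\<omega> xs. xs ! i)"
| oracle_call: "recursive_in W 1 (\<lambda>\<omega> xs. \<omega> (xs ! 0))"
| comp: "recursive_in W (length Fs) G \<Longrightarrow> (\<forall>F \<in> set Fs. recursive_in W n F) \<Longrightarrow>
    recursive_in W n (\<lambda>\<omega> xs. G \<omega> (map (\<lambda>F. F \<omega> xs) Fs))"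
| prim_rec: "recursive_in W n G \<Longrightarrow> recursive_in W (n + 2) H \<Longrightarrow>
    recursive_in W (n + 1)
      (\<lambda>\<omega> xs. rec_nat (G \<omega> (tl xs)) (\<lambda>k r. H \<omega> (k # r # tl xs)) (hd xs))"
| minimize: "recursive_in W (n + 1) G \<Longrightarrow>
    (\<forall>\<omega> \<in> W. \<forall>xs. length xs = n \<longrightarrow> (\<exists>y. G \<omega> (y # xs) = 0)) \<Longrightarrow>
    recursive_in W n (\<lambda>\<omega> xs. LEAST y. G \<omega> (y # xs) = 0)"

definition recursive2 :: "(nat \<Rightarrow> nat \<Rightarrow> nat) \<Rightarrow> bool" where
  "recursive2 f \<longleftrightarrow>
     (\<exists>F. recursive_in {\<lambda>_. 0} 2 F \<and> (\<forall>m n. F (\<lambda>_. 0) [m, n] = f m n))"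

text \<open>
  Complex numbers are given to an algorithm by names \<open>n :: nat\<close> with respect to a numbering
  \<open>\<nu>\<close> of a countable algebraically closed subfield of \<open>\<complex>\<close>; every finite set of complex
  numbers lies in such a subfield. A number may have several names.
\<close>

definition acf_numbering :: "(nat \<Rightarrow> complex) \<Rightarrow> bool" where
  "acf_numbering \<nu> \<longleftrightarrow>
     0 \<in> range \<nu> \<and> 1 \<in> range \<nu> \<and>
     (\<forall>x \<in> range \<nu>. \<forall>y \<in> range \<nu>. x + y \<in> range \<nu> \<and> x * y \<in> range \<nu>) \<and>
     (\<forall>x \<in> range \<nu>. - x \<in> range \<nu> \<and> inverse x \<in> range \<nu>) \<and>
     (\<forall>p x. p \<noteq> 0 \<longrightarrow> set (coeffs p) \<subseteq> range \<nu> \<longrightarrow> poly p x = 0 \<longrightarrow> x \<in> range \<nu>)"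

lemma acf_numbering_exists:
  assumes "finite A"
  obtains \<nu> where "acf_numbering \<nu>" "A \<subseteq> range \<nu>"
proof -
  define step :: "complex set \<Rightarrow> complex set" where
    "step X = X \<union> {0, 1} \<union> (\<lambda>(x, y). x + y) ` (X \<times> X) \<union> (\<lambda>(x, y). x * y) ` (X \<times> X)
       \<union> uminus ` X \<union> inverse ` X
       \<union> (\<Union>xs \<in> lists X. if Poly xs = 0 then {} else {x. poly (Poly xs) x = 0})" for X
  define K where "K n = (step ^^ n) A" for n
  have cstep: "countable (step X)" if "countable X" for X
  proof -
    have "countable (if Poly xs = 0 then {} else {x. poly (Poly xs) x = 0})" for xs :: "complex list"
      by (simp add: countable_finite poly_roots_finite)
    thus ?thesis unfolding step_def using that by (intro countable_Un countable_UN) auto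
  qed
  have cK: "countable (K n)" for n
    by (induction n) (simp_all add: K_def cstep countable_finite assms)
  have KS: "K (Suc n) = step (K n)" for n by (simp add: K_def)
  have sub: "K n \<subseteq> K (Suc n)" for n unfolding KS step_def by blast
  have mono: "K m \<subseteq> K n" if "m \<le> n" for m n
    using lift_Suc_mono_le[of K, OF sub that] .
  define U where "U = (\<Union>n. K n)"
  have step_U: "step (K n) \<subseteq> U" for n unfolding U_def KS[symmetric] by blast
  have fin: "\<exists>n. F \<subseteq> K n" if "finite F" "F \<subseteq> U" for F
    using that
  proof (induction F rule: finite_induct)
    case (insert x F)
    then obtain m n where "F \<subseteq> K n" "x \<in> K m" unfolding U_def by auto
    hence "insert x F \<subseteq> K (max m n)"
      using mono[of m "max m n"] mono[of n "max m n"] by auto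
    thus ?case ..
  qed simp
  have cU: "countable U" using cK by (auto simp: U_def)
  have "{0, 1} \<subseteq> U" using step_U[of 0] unfolding step_def by blast
  hence rU: "range (from_nat_into U) = U" using cU by (intro range_from_nat_into) auto
  have "acf_numbering (from_nat_into U)"
    unfolding acf_numbering_def rU
  proof (intro conjI ballI allI impI)
    show "0 \<in> U" "1 \<in> U" using \<open>{0, 1} \<subseteq> U\<close> by auto
  next
    fix x y assume "x \<in> U" "y \<in> U"
    then obtain n where n: "{x, y} \<subseteq> K n" using fin[of "{x, y}"] by auto
    show "x + y \<in> U" "x * y \<in> U" using step_U[of n] n unfolding step_def by auto
  next
    fix x assume "x \<in> U"
    then obtain n where n: "x \<in> K n" by (auto simp: U_def)
    show "- x \<in> U" "inverse x \<in> U" using step_U[of n] n unfolding step_def by auto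
  next
    fix p :: "complex poly" and x
    assume p: "p \<noteq> 0" "set (coeffs p) \<subseteq> U" "poly p x = 0"
    then obtain n where n: "set (coeffs p) \<subseteq> K n" using fin[of "set (coeffs p)"] by auto
    have "coeffs p \<in> lists (K n)" using n by auto
    moreover have "x \<in> (if Poly (coeffs p) = 0 then {} else {x. poly (Poly (coeffs p)) x = 0})"
      using p by simp
    ultimately have "x \<in> step (K n)" unfolding step_def by blast
    thus "x \<in> U" using step_U by blast
  qed
  moreover have "A \<subseteq> range (from_nat_into U)"
  proof -
    have "A = K 0" by (simp add: K_def)
    thus ?thesis unfolding rU by (auto simp: U_def)
  qed
  ultimately show thesis by (rule that)
qed

text \<open>
  The only access an algorithm has to the numbers behind the names is through the atomic
  diagram of the field, i.e. the ability to test \<open>x + y = u\<close> and \<open>x * y = u\<close>. (From these,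
  equality tests and names for sums, products, inverses etc. are obtained by search.)
\<close>

definition diagram :: "(nat \<Rightarrow> complex) \<Rightarrow> nat \<Rightarrow> nat" where
  "diagram \<nu> n = (case prod_decode n of (a, bc) \<Rightarrow> case prod_decode bc of (b, c) \<Rightarrow>
     (if \<nu> a + \<nu> b = \<nu> c then 1 else 0) + (if \<nu> a * \<nu> b = \<nu> c then 2 else 0))"

definition poly_of :: "(nat \<Rightarrow> complex) \<Rightarrow> nat \<Rightarrow> complex poly" where
  "poly_of \<nu> n = Poly (map \<nu> (list_decode n))"

definition poly2_of :: "(nat \<Rightarrow> complex) \<Rightarrow> nat \<Rightarrow> complex poly poly" where
  "poly2_of \<nu> n = Poly (map (poly_of \<nu>) (list_decode n))"

text \<open>
  Fractions are named by pairs of polynomials, not necessarily in lowest terms;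
  by the library convention \<open>Fract a 0 = 0\<close>, a pair with zero denominator is a name of \<open>0\<close>.
\<close>

definition ratfun_of :: "(nat \<Rightarrow> complex) \<Rightarrow> nat \<Rightarrow> ratfun" where
  "ratfun_of \<nu> n = (case prod_decode n of (a, b) \<Rightarrow> Fract (poly_of \<nu> a) (poly_of \<nu> b))"

definition ratfun2_of :: "(nat \<Rightarrow> complex) \<Rightarrow> nat \<Rightarrow> ratfun2" where
  "ratfun2_of \<nu> n = (case prod_decode n of (a, b) \<Rightarrow> Fract (poly2_of \<nu> a) (poly2_of \<nu> b))"

lemma poly_of_surj:
  assumes "set (coeffs p) \<subseteq> range \<nu>"
  obtains n where "poly_of \<nu> n = p"
proof -
  obtain ns where "map \<nu> ns = coeffs p"
    using assms by (metis ex_map_conv subset_eq rangeE)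
  hence "poly_of \<nu> (list_encode ns) = p" by (simp add: poly_of_def)
  thus thesis by (rule that)
qed

lemma poly2_of_surj:
  assumes "\<And>c. c \<in> set (coeffs p) \<Longrightarrow> set (coeffs c) \<subseteq> range \<nu>"
  obtains n where "poly2_of \<nu> n = p"
proof -
  have "\<forall>c \<in> set (coeffs p). \<exists>n. c = poly_of \<nu> n"
  proof
    fix c assume "c \<in> set (coeffs p)"
    then obtain n where "poly_of \<nu> n = c" using assms poly_of_surj by blast
    thus "\<exists>n. c = poly_of \<nu> n" by auto
  qed
  then obtain ns where "coeffs p = map (poly_of \<nu>) ns"
    unfolding ex_map_conv[symmetric] ..
  hence "poly2_of \<nu> (list_encode ns) = p" by (simp add: poly2_of_def flip: \<open>coeffs p = _\<close>)
  thus thesis by (rule that)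
qed

lemma ratfun2_has_name:
  obtains \<nu> n where "acf_numbering \<nu>" "ratfun2_of \<nu> n = R"
proof -
  obtain p q where R: "R = Fract p q" by (cases R)
  define A where "A = (\<Union>c \<in> set (coeffs p) \<union> set (coeffs q). set (coeffs c))"
  have "finite A" by (simp add: A_def)
  then obtain \<nu> where \<nu>: "acf_numbering \<nu>" "A \<subseteq> range \<nu>" by (rule acf_numbering_exists)
  obtain a where a: "poly2_of \<nu> a = p"
    by (rule poly2_of_surj[of p \<nu>]) (use \<nu>(2) in \<open>auto simp: A_def\<close>)
  obtain b where b: "poly2_of \<nu> b = q"
    by (rule poly2_of_surj[of q \<nu>]) (use \<nu>(2) in \<open>auto simp: A_def\<close>)
  have "ratfun2_of \<nu> (prod_encode (a, b)) = R" by (simp add: ratfun2_of_def a b R)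
  with \<nu>(1) show thesis by (rule that)
qed

text \<open>
  \<open>S R\<close> is effectively computable for the \<open>R\<close> satisfying \<open>D\<close>: a single algorithm turns any
  name of any such \<open>R\<close> (with respect to any numbering) into a finite list of names of
  exactly the elements of \<open>S R\<close>. In particular \<open>S R\<close> is finite and all its elements have
  coefficients in the numbered field. Without uniformity in \<open>R\<close> the notion would be void,
  every finite set having a computable list.
\<close>

definition effectively_computable ::
    "(ratfun2 \<Rightarrow> bool) \<Rightarrow> (ratfun2 \<Rightarrow> ratfun set) \<Rightarrow> bool" where
  "effectively_computable D S \<longleftrightarrow>
     (\<exists>F. recursive_in (diagram ` Collect acf_numbering) 1 F \<and>
       (\<forall>\<nu> n. acf_numbering \<nu> \<longrightarrow> D (ratfun2_of \<nu> n) \<longrightarrow>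
          ratfun_of \<nu> ` set (list_decode (F (diagram \<nu>) [n])) = S (ratfun2_of \<nu> n)))"

end

theory Submission
  imports Defs
begin

text \<open>
  If a solution \<open>f = a/b\<close> has degree \<open>n\<close>, a resultant estimate shows that \<open>R(z,f)\<close> has degree at least
  \<open>d n - C\<close>, whereas \<open>f(z+1)\<close> has degree \<open>n\<close> and \<open>f'\<close> degree at most \<open>2 n\<close>; so \<open>n\<close> is at most an explicit
  \<open>N\<close>. At a regular point \<open>z0\<close> the value \<open>c = f(z0)\<close> determines the values \<open>f(z0 + k)\<close>, respectively the
  Taylor coefficients of \<open>f\<close>, hence \<open>f\<close> itself: \<open>f = A/B\<close> for every nonzero solution \<open>(A, B)\<close> of a linear
  system with \<open>2 N + 1\<close> equations in \<open>2 N + 2\<close> unknowns and coefficients polynomial in \<open>c\<close>. Take \<open>(A, B)\<close>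
  polynomial in \<open>c\<close> and insert \<open>A/B\<close> into the equation. If the equation held identically in \<open>c\<close>, then
  comparing degrees in \<open>c\<close> would give \<open>d m \<le> m\<close>, respectively \<open>d m \<le> 2 m\<close>, where \<open>m\<close> is the degree of \<open>A/B\<close>
  in \<open>c\<close>; so \<open>m = 0\<close> and there is one candidate only. Otherwise \<open>c\<close> is a root of a nonzero polynomial of
  explicit degree.

  All data involved - a reduced representation of \<open>R\<close>, the family \<open>(A, B)\<close>, the roots \<open>c\<close>, the
  candidates belonging to them - lie in the numbered field: it is algebraically closed, and linear systems have
  solutions over their field of definition. Their defining properties are polynomial identities. Hence it is
  semidecidable that a list contains all solutions and nothing else, and such a list is found by
  search.
\<close>

section \<open>Closure properties of recursive functions\<close>

text \<open>Two obstacles shape the conditions on \<open>(A, B)\<close>. A value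
  \<open>c = f(z0)\<close> is a complex number that is not known to have a name, so every fact about
  it has to come from a polynomial identity in \<open>c\<close> that can be tested at integers. For
  this reason the orbit is kept in homogeneous coordinates and the derivation is multiplied by
  \<open>q\<close>: no division by an expression in \<open>c\<close> ever occurs. Moreover the
  polynomial family \<open>(A, B)\<close> may vanish at special \<open>c\<close>, where it says
  nothing. A linear combination of its values at a fixed point is therefore multiplied into the
  polynomial for \<open>c\<close>, and at each root the linear system is solved anew. The poles of
  \<open>f\<close> are unknown beforehand, so no single \<open>z0\<close> serves all solutions; a
  bounded range of starting points contains a regular one for each \<open>f\<close>. The resultant
  enters through Bezout combinations found by counting unknowns against equations, which yields
  bounds for degrees in \<open>z\<close> and coefficients in a given subfield at the same time. The
  same kind of count, with the power of \<open>c\<close> as a further index, produces the family and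
  the bound for its degree in \<open>c\<close>.\<close>

text \<open>
  \<open>recursive_in\<close> is a class of exact functions; \<open>rec_ext\<close> closes it under changes of values on
  lists of the wrong length and at oracles outside \<open>W\<close>.
\<close>

definition rec_ext :: "(nat \<Rightarrow> nat) set \<Rightarrow> nat \<Rightarrow> ((nat \<Rightarrow> nat) \<Rightarrow> nat list \<Rightarrow> nat) \<Rightarrow> bool" where
  "rec_ext W n F \<longleftrightarrow>
     (\<exists>F'. recursive_in W n F' \<and> (\<forall>\<omega>\<in>W. \<forall>xs. length xs = n \<longrightarrow> F' \<omega> xs = F \<omega> xs))"

lemma rec_extI: "recursive_in W n F \<Longrightarrow> rec_ext W n F"
  unfolding rec_ext_def by blast

lemma rec_extI':
  assumes "recursive_in W n F'"
    "\<And>\<omega> xs. \<omega> \<in> W \<Longrightarrow> length xs = n \<Longrightarrow> F' \<omega> xs = F \<omega> xs"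
  shows "rec_ext W n F"
  unfolding rec_ext_def by (rule exI[of _ F']) (simp add: assms)

lemma rec_extE:
  assumes "rec_ext W n F"
  obtains F' where "recursive_in W n F'"
    "\<And>\<omega> xs. \<omega> \<in> W \<Longrightarrow> length xs = n \<Longrightarrow> F' \<omega> xs = F \<omega> xs"
proof -
  from assms obtain F' where F': "recursive_in W n F' \<and>
      (\<forall>\<omega>\<in>W. \<forall>xs. length xs = n \<longrightarrow> F' \<omega> xs = F \<omega> xs)"
    unfolding rec_ext_def ..
  show thesis by (rule that[of F']) (simp_all add: F')
qed

lemma rec_ext_cong:
  assumes "rec_ext W n F" "\<And>\<omega> xs. \<omega> \<in> W \<Longrightarrow> length xs = n \<Longrightarrow> F \<omega> xs = G \<omega> xs"
  shows "rec_ext W n G"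
  by (rule rec_extE[OF assms(1)], erule rec_extI') (simp add: assms(2))

lemma rec_ext_comp:
  assumes "rec_ext W m G" "length Fs = m" "\<And>F. F \<in> set Fs \<Longrightarrow> rec_ext W n F"
  shows "rec_ext W n (\<lambda>\<omega> xs. G \<omega> (map (\<lambda>F. F \<omega> xs) Fs))"
proof -
  obtain G' where G': "recursive_in W m G'"
    "\<And>\<omega> xs. \<omega> \<in> W \<Longrightarrow> length xs = m \<Longrightarrow> G' \<omega> xs = G \<omega> xs"
    by (rule rec_extE[OF assms(1)]) (rule that)
  have "\<forall>F\<in>set Fs. \<exists>F'. recursive_in W n F' \<and> (\<forall>\<omega>\<in>W. \<forall>xs. length xs = n \<longrightarrow> F' \<omega> xs = F \<omega> xs)"
    using assms(3) unfolding rec_ext_def by simp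
  then obtain c where c: "\<forall>F\<in>set Fs. recursive_in W n (c F) \<and>
      (\<forall>\<omega>\<in>W. \<forall>xs. length xs = n \<longrightarrow> c F \<omega> xs = F \<omega> xs)"
    by (rule bchoice[THEN exE])
  have "recursive_in W n (\<lambda>\<omega> xs. G' \<omega> (map (\<lambda>F. F \<omega> xs) (map c Fs)))"
    using G'(1) c assms(2) by (intro recursive_in.comp) auto
  moreover have "map (\<lambda>F. F \<omega> xs) (map c Fs) = map (\<lambda>F. F \<omega> xs) Fs"
    if "\<omega> \<in> W" "length xs = n" for \<omega> xs
    using c that by simp
  ultimately show ?thesis
    by (elim rec_extI') (simp add: G'(2) assms(2) del: map_map)
qed

lemma rec_ext_comp1:
  assumes "rec_ext W 1 (\<lambda>\<omega> xs. f \<omega> (hd xs))" "rec_ext W n A"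
  shows "rec_ext W n (\<lambda>\<omega> xs. f \<omega> (A \<omega> xs))"
  using rec_ext_comp[OF assms(1), of "[A]" n] assms(2) by simp

lemma rec_ext_comp2:
  assumes "rec_ext W 2 (\<lambda>\<omega> xs. f \<omega> (xs ! 0) (xs ! 1))" "rec_ext W n A" "rec_ext W n B"
  shows "rec_ext W n (\<lambda>\<omega> xs. f \<omega> (A \<omega> xs) (B \<omega> xs))"
  using rec_ext_comp[OF assms(1), of "[A, B]" n] assms(2,3) by auto

lemma rec_ext_proj: "i < n \<Longrightarrow> rec_ext W n (\<lambda>\<omega> xs. xs ! i)"
  by (intro rec_extI recursive_in.proj)

lemma rec_ext_prim_rec:
  assumes "rec_ext W n G" "rec_ext W (n + 2) H"
    and "\<And>\<omega> xs. \<omega> \<in> W \<Longrightarrow> length xs = n \<Longrightarrow> F \<omega> (0 # xs) = G \<omega> xs"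
    and "\<And>\<omega> k xs. \<omega> \<in> W \<Longrightarrow> length xs = n \<Longrightarrow>
           F \<omega> (Suc k # xs) = H \<omega> (k # F \<omega> (k # xs) # xs)"
  shows "rec_ext W (Suc n) F"
proof -
  obtain G' where G': "recursive_in W n G'"
    "\<And>\<omega> xs. \<omega> \<in> W \<Longrightarrow> length xs = n \<Longrightarrow> G' \<omega> xs = G \<omega> xs"
    by (rule rec_extE[OF assms(1)]) (rule that)
  obtain H' where H': "recursive_in W (n + 2) H'"
    "\<And>\<omega> xs. \<omega> \<in> W \<Longrightarrow> length xs = n + 2 \<Longrightarrow> H' \<omega> xs = H \<omega> xs"
    by (rule rec_extE[OF assms(2)]) (rule that)
  have "rec_nat (G' \<omega> xs) (\<lambda>k r. H' \<omega> (k # r # xs)) k = F \<omega> (k # xs)"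
    if "\<omega> \<in> W" "length xs = n" for \<omega> xs k
    using that by (induction k) (simp_all add: G'(2) H'(2) assms(3,4))
  moreover have "recursive_in W (Suc n)
      (\<lambda>\<omega> xs. rec_nat (G' \<omega> (tl xs)) (\<lambda>k r. H' \<omega> (k # r # tl xs)) (hd xs))"
    using recursive_in.prim_rec[OF G'(1) H'(1)] by simp
  ultimately show ?thesis
    by (elim rec_extI') (auto simp: length_Suc_conv)
qed

lemma rec_ext_minimize:
  assumes "rec_ext W (Suc n) G"
    and "\<And>\<omega> xs. \<omega> \<in> W \<Longrightarrow> length xs = n \<Longrightarrow> \<exists>y. G \<omega> (y # xs) = 0"
  shows "rec_ext W n (\<lambda>\<omega> xs. LEAST y. G \<omega> (y # xs) = 0)"
proof -
  obtain G' where G': "recursive_in W (Suc n) G'"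
    "\<And>\<omega> xs. \<omega> \<in> W \<Longrightarrow> length xs = Suc n \<Longrightarrow> G' \<omega> xs = G \<omega> xs"
    by (rule rec_extE[OF assms(1)]) (rule that)
  have "recursive_in W n (\<lambda>\<omega> xs. LEAST y. G' \<omega> (y # xs) = 0)"
    using G' assms(2) by (intro recursive_in.minimize) auto
  thus ?thesis by (elim rec_extI') (simp add: G'(2))
qed

lemma rec_ext_zero: "rec_ext W n (\<lambda>\<omega> xs. 0)"
  by (intro rec_extI recursive_in.zero)

lemma rec_ext_Suc: "rec_ext W n A \<Longrightarrow> rec_ext W n (\<lambda>\<omega> xs. Suc (A \<omega> xs))"
proof (erule rec_ext_comp1[rotated])
  show "rec_ext W 1 (\<lambda>\<omega> xs. Suc (hd xs))"
    by (rule rec_ext_cong[OF rec_extI[OF recursive_in.succ]]) (auto simp: length_Suc_conv)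
qed

lemma rec_ext_add_aux: "rec_ext W 2 (\<lambda>\<omega> xs. xs ! 0 + xs ! 1)"
  using rec_ext_prim_rec[where n = 1 and F = "\<lambda>\<omega> xs. xs ! 0 + xs ! 1"
      and G = "\<lambda>\<omega> xs. xs ! 0" and H = "\<lambda>\<omega> xs. Suc (xs ! 1)" and W = W]
  by (simp add: rec_ext_proj rec_ext_Suc numeral_2_eq_2)

lemma rec_ext_pred_aux: "rec_ext W 1 (\<lambda>\<omega> xs. hd xs - 1)"
  using rec_ext_prim_rec[where n = 0 and F = "\<lambda>\<omega> xs. hd xs - 1"
      and G = "\<lambda>\<omega> xs. 0" and H = "\<lambda>\<omega> xs. xs ! 0" and W = W]
  by (simp add: rec_ext_proj rec_ext_zero numeral_2_eq_2)

lemma rec_ext_diff_aux: "rec_ext W 2 (\<lambda>\<omega> xs. xs ! 0 - xs ! 1)"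
proof -
  have "rec_ext W 2 (\<lambda>\<omega> xs. xs ! 1 - xs ! 0)"
    using rec_ext_prim_rec[where n = 1 and F = "\<lambda>\<omega> xs. xs ! 1 - xs ! 0"
        and G = "\<lambda>\<omega> xs. xs ! 0" and H = "\<lambda>\<omega> xs. xs ! 1 - 1" and W = W]
      rec_ext_comp1[OF rec_ext_pred_aux, of W 3 "\<lambda>\<omega> xs. xs ! 1"]
    by (simp add: rec_ext_proj numeral_2_eq_2 numeral_3_eq_3)
  from rec_ext_comp2[OF this, of 2 "\<lambda>\<omega> xs. xs ! 1" "\<lambda>\<omega> xs. xs ! 0"]
  show ?thesis by (simp add: rec_ext_proj)
qed

lemma rec_ext_mult_aux: "rec_ext W 2 (\<lambda>\<omega> xs. xs ! 0 * xs ! 1)"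
  using rec_ext_prim_rec[where n = 1 and F = "\<lambda>\<omega> xs. xs ! 0 * xs ! 1"
      and G = "\<lambda>\<omega> xs. 0" and H = "\<lambda>\<omega> xs. xs ! 1 + xs ! 2" and W = W]
    rec_ext_comp2[OF rec_ext_add_aux, of W 3 "\<lambda>\<omega> xs. xs ! 1" "\<lambda>\<omega> xs. xs ! 2"]
  by (simp add: rec_ext_proj rec_ext_zero numeral_2_eq_2 numeral_3_eq_3)

lemma rec_ext_triangle_aux: "rec_ext W 1 (\<lambda>\<omega> xs. triangle (hd xs))"
  using rec_ext_prim_rec[where n = 0 and F = "\<lambda>\<omega> xs. triangle (hd xs)"
      and G = "\<lambda>\<omega> xs. 0" and H = "\<lambda>\<omega> xs. xs ! 1 + Suc (xs ! 0)" and W = W]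
    rec_ext_comp2[OF rec_ext_add_aux, of W 2 "\<lambda>\<omega> xs. xs ! 1" "\<lambda>\<omega> xs. Suc (xs ! 0)"]
  by (simp add: rec_ext_proj rec_ext_zero rec_ext_Suc numeral_2_eq_2)

lemma rec_ext_prod_encode:
  assumes "rec_ext W n A" "rec_ext W n B"
  shows "rec_ext W n (\<lambda>\<omega> xs. prod_encode (A \<omega> xs, B \<omega> xs))"
proof -
  have "rec_ext W 2 (\<lambda>\<omega> xs. triangle (xs ! 0 + xs ! 1) + xs ! 0)"
    by (intro rec_ext_comp2[OF rec_ext_add_aux] rec_ext_comp1[OF rec_ext_triangle_aux] rec_ext_proj) auto
  from rec_ext_comp2[OF this assms] show ?thesis by (simp add: prod_encode_def)
qed

text \<open>
  \<open>cf\<close>, \<open>dp\<close>, \<open>sd\<close>: computable functions, decidable and semidecidable predicates of one argument,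
  uniformly in the oracle. Several arguments are packed by \<open>prod_encode\<close>; in the rules for binders
  (recursion, minimization, quantifiers) the bound variable becomes a further component of the
  argument, so that membership proofs are mere applications of introduction rules.
\<close>

definition cf :: "(nat \<Rightarrow> nat) set \<Rightarrow> ((nat \<Rightarrow> nat) \<Rightarrow> nat \<Rightarrow> nat) \<Rightarrow> bool" where
  "cf W F \<longleftrightarrow> rec_ext W 1 (\<lambda>\<omega> xs. F \<omega> (hd xs))"

abbreviation pfst :: "nat \<Rightarrow> nat" where "pfst x \<equiv> fst (prod_decode x)"
abbreviation psnd :: "nat \<Rightarrow> nat" where "psnd x \<equiv> snd (prod_decode x)"

lemma cf_cong: "cf W F \<Longrightarrow> (\<And>\<omega> x. \<omega> \<in> W \<Longrightarrow> F \<omega> x = G \<omega> x) \<Longrightarrow> cf W G"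
  unfolding cf_def by (erule rec_ext_cong) auto

lemma cf_comp: "cf W F \<Longrightarrow> cf W A \<Longrightarrow> cf W (\<lambda>\<omega> x. F \<omega> (A \<omega> x))"
  unfolding cf_def by (rule rec_ext_comp1)

lemma cf_id: "cf W (\<lambda>\<omega> x. x)"
  unfolding cf_def by (rule rec_ext_cong[OF rec_ext_proj[of 0 1]]) (auto simp: length_Suc_conv)

lemma cf_Suc: "cf W A \<Longrightarrow> cf W (\<lambda>\<omega> x. Suc (A \<omega> x))"
  unfolding cf_def by (rule rec_ext_Suc)

lemma cf_const: "cf W (\<lambda>\<omega> x. k)"
  by (induction k) (auto simp: cf_def rec_ext_zero intro: rec_ext_Suc)

lemma cf_add: "cf W A \<Longrightarrow> cf W B \<Longrightarrow> cf W (\<lambda>\<omega> x. A \<omega> x + B \<omega> x)"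
  unfolding cf_def by (rule rec_ext_comp2[OF rec_ext_add_aux])

lemma cf_diff: "cf W A \<Longrightarrow> cf W B \<Longrightarrow> cf W (\<lambda>\<omega> x. A \<omega> x - B \<omega> x)"
  unfolding cf_def by (rule rec_ext_comp2[OF rec_ext_diff_aux])

lemma cf_mult: "cf W A \<Longrightarrow> cf W B \<Longrightarrow> cf W (\<lambda>\<omega> x. A \<omega> x * B \<omega> x)"
  unfolding cf_def by (rule rec_ext_comp2[OF rec_ext_mult_aux])

lemma cf_triangle: "cf W A \<Longrightarrow> cf W (\<lambda>\<omega> x. triangle (A \<omega> x))"
  unfolding cf_def by (rule rec_ext_comp1[OF rec_ext_triangle_aux])

lemma cf_prod_encode: "cf W A \<Longrightarrow> cf W B \<Longrightarrow> cf W (\<lambda>\<omega> x. prod_encode (A \<omega> x, B \<omega> x))"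
  unfolding cf_def by (rule rec_ext_prod_encode)

lemma cf_oracle: "cf W A \<Longrightarrow> cf W (\<lambda>\<omega> x. \<omega> (A \<omega> x))"
proof -
  have "rec_ext W 1 (\<lambda>\<omega> xs. \<omega> (hd xs))"
    by (rule rec_ext_cong[OF rec_extI[OF recursive_in.oracle_call]]) (auto simp: length_Suc_conv)
  thus "cf W A \<Longrightarrow> ?thesis" unfolding cf_def by (rule rec_ext_comp1)
qed

lemma cf_pair_rec_ext: "cf W F \<Longrightarrow> rec_ext W n A \<Longrightarrow> rec_ext W n (\<lambda>\<omega> xs. F \<omega> (A \<omega> xs))"
  unfolding cf_def by (rule rec_ext_comp1)

lemma cf_minimize_aux:
  assumes "cf W P" "\<And>\<omega> x. \<omega> \<in> W \<Longrightarrow> \<exists>y. P \<omega> (prod_encode (x, y)) = 0"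
  shows "cf W (\<lambda>\<omega> x. LEAST y. P \<omega> (prod_encode (x, y)) = 0)"
proof -
  have "rec_ext W 1 (\<lambda>\<omega> xs. LEAST y. P \<omega> (prod_encode ((y # xs) ! 1, (y # xs) ! 0)) = 0)"
    by (rule rec_ext_minimize, rule cf_pair_rec_ext[OF assms(1)])
      (auto intro!: rec_ext_prod_encode rec_ext_proj simp: assms(2))
  thus ?thesis unfolding cf_def
    by (rule rec_ext_cong) (auto simp: length_Suc_conv)
qed

lemma triangle_mono: "m \<le> n \<Longrightarrow> triangle m \<le> triangle n"
  by (rule lift_Suc_mono_le[of triangle]) auto

text \<open>Inverts the Cantor pairing by minimization: for \<open>x = triangle (a + b) + a\<close>
  the diagonal \<open>a + b\<close> is the first \<open>s\<close> such that
  \<open>triangle (Suc s)\<close> exceeds \<open>x\<close>.\<close>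

lemma triangle_root:
  "(LEAST s. Suc x - triangle (Suc s) = 0) = pfst x + psnd x"
proof (rule Least_equality)
  obtain a b where ab: "prod_decode x = (a, b)" by (cases "prod_decode x")
  hence x: "x = triangle (a + b) + a" using prod_decode_inverse[of x] unfolding prod_encode_def by simp
  show "Suc x - triangle (Suc (pfst x + psnd x)) = 0" using ab x by simp
  fix s assume s: "Suc x - triangle (Suc s) = 0"
  show "pfst x + psnd x \<le> s"
  proof (rule ccontr)
    assume "\<not> ?thesis"
    hence "Suc s \<le> a + b" using ab by simp
    from triangle_mono[OF this] x s show False by simp
  qed
qed

lemma cf_psum: "cf W (\<lambda>\<omega> x. pfst x + psnd x)"
proof -
  have 0: "rec_ext W 1 (\<lambda>\<omega> xs. LEAST y. Suc ((y # xs) ! 1) - triangle (Suc ((y # xs) ! 0)) = 0)"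
  proof (rule rec_ext_minimize)
    show "rec_ext W (Suc 1) (\<lambda>\<omega> xs. Suc (xs ! 1) - triangle (Suc (xs ! 0)))"
      by (intro rec_ext_comp2[OF rec_ext_diff_aux] rec_ext_comp1[OF rec_ext_triangle_aux]
          rec_ext_Suc rec_ext_proj) auto
    show "\<exists>y. Suc ((y # xs) ! 1) - triangle (Suc ((y # xs) ! 0)) = 0" for xs :: "nat list"
      by (rule exI[of _ "xs ! 0"]) (simp add: triangle_def)
  qed
  show ?thesis unfolding cf_def triangle_root[symmetric]
    by (rule rec_ext_cong[OF 0]) (auto simp: length_Suc_conv)
qed

lemma cf_pfst: "cf W A \<Longrightarrow> cf W (\<lambda>\<omega> x. pfst (A \<omega> x))"
proof -
  have "cf W (\<lambda>\<omega> x. x - triangle (pfst x + psnd x))"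
    by (intro cf_diff cf_id cf_triangle cf_psum)
  moreover have "x - triangle (pfst x + psnd x) = pfst x" for x
    by (subst prod_decode_inverse[of x, symmetric], subst prod_encode_def) (simp add: case_prod_unfold)
  ultimately have "cf W (\<lambda>\<omega> x. pfst x)" by simp
  thus "cf W A \<Longrightarrow> ?thesis" by (rule cf_comp)
qed

lemma cf_psnd: "cf W A \<Longrightarrow> cf W (\<lambda>\<omega> x. psnd (A \<omega> x))"
proof -
  have "cf W (\<lambda>\<omega> x. (pfst x + psnd x) - pfst x)"
    by (intro cf_diff cf_pfst cf_id cf_psum)
  hence "cf W (\<lambda>\<omega> x. psnd x)" by simp
  thus "cf W A \<Longrightarrow> ?thesis" by (rule cf_comp)
qed

lemma cf_rec_nat:
  assumes "cf W A" "cf W G" "cf W (\<lambda>\<omega> x. H \<omega> (pfst x) (pfst (psnd x)) (psnd (psnd x)))"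
  shows "cf W (\<lambda>\<omega> x. rec_nat (G \<omega> x) (\<lambda>k r. H \<omega> x k r) (A \<omega> x))"
proof -
  let ?F = "\<lambda>\<omega> n x. rec_nat (G \<omega> x) (\<lambda>k r. H \<omega> x k r) n"
  \<comment> \<open>The recursion scheme puts counter and previous value in front of the parameter,
    whereas \<open>H\<close> takes the parameter first and the other two packed behind it.\<close>
  let ?z = "\<lambda>xs. prod_encode (xs ! 2, prod_encode (xs ! 0, xs ! 1))"
  have "rec_ext W (Suc 1) (\<lambda>\<omega> xs. ?F \<omega> (xs ! 0) (xs ! 1))"
  proof (rule rec_ext_prim_rec)
    show "rec_ext W 1 (\<lambda>\<omega> xs. G \<omega> (xs ! 0))"
      by (rule cf_pair_rec_ext[OF assms(2)]) (simp add: rec_ext_proj)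
    show "rec_ext W (1 + 2) (\<lambda>\<omega> xs. H \<omega> (pfst (?z xs)) (pfst (psnd (?z xs))) (psnd (psnd (?z xs))))"
      by (rule cf_pair_rec_ext[OF assms(3)]) (intro rec_ext_prod_encode rec_ext_proj; simp)
  qed auto
  hence "rec_ext W 2 (\<lambda>\<omega> xs. ?F \<omega> (xs ! 0) (xs ! 1))" by (simp add: numeral_2_eq_2)
  from rec_ext_comp2[OF this, of 1 "\<lambda>\<omega> xs. A \<omega> (hd xs)" "\<lambda>\<omega> xs. hd xs"]
  show ?thesis using assms(1) cf_id unfolding cf_def by simp
qed

lemma cf_power: "cf W A \<Longrightarrow> cf W B \<Longrightarrow> cf W (\<lambda>\<omega> x. A \<omega> x ^ B \<omega> x)"
proof -
  assume AB: "cf W A" "cf W B"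
  have e: "a ^ n = rec_nat 1 (\<lambda>k r. r * a) n" for a n :: nat
    by (induction n) (auto simp: mult.commute)
  show ?thesis unfolding e
    by (intro cf_rec_nat cf_mult cf_psnd cf_id cf_const AB cf_comp[OF AB(1) cf_pfst])
qed

section \<open>Decidable and semidecidable predicates\<close>

definition dp :: "(nat \<Rightarrow> nat) set \<Rightarrow> ((nat \<Rightarrow> nat) \<Rightarrow> nat \<Rightarrow> bool) \<Rightarrow> bool" where
  "dp W P \<longleftrightarrow> cf W (\<lambda>\<omega> x. if P \<omega> x then 0 else 1)"

lemma cf_if:
  assumes "dp W P" "cf W A" "cf W B"
  shows "cf W (\<lambda>\<omega> x. if P \<omega> x then A \<omega> x else B \<omega> x)"
  by (rule cf_cong[where F = "\<lambda>\<omega> x. (1 - (if P \<omega> x then 0 else 1)) * A \<omega> x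
      + (if P \<omega> x then 0 else 1) * B \<omega> x"])
    (intro cf_add cf_mult cf_diff cf_const assms assms(1)[unfolded dp_def], auto)

lemma dp_comp: "dp W P \<Longrightarrow> cf W A \<Longrightarrow> dp W (\<lambda>\<omega> x. P \<omega> (A \<omega> x))"
  unfolding dp_def by (rule cf_comp)

lemma dpI: "cf W F \<Longrightarrow> (\<And>\<omega> x. \<omega> \<in> W \<Longrightarrow> P \<omega> x \<longleftrightarrow> F \<omega> x = 0) \<Longrightarrow> dp W P"
proof -
  assume F: "cf W F" and e: "\<And>\<omega> x. \<omega> \<in> W \<Longrightarrow> P \<omega> x \<longleftrightarrow> F \<omega> x = 0"
  have "cf W (\<lambda>\<omega> x. 1 - (1 - F \<omega> x))" by (intro cf_diff cf_const F)
  thus ?thesis unfolding dp_def by (rule cf_cong) (use e in auto)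
qed

lemma dp_eq: "cf W A \<Longrightarrow> cf W B \<Longrightarrow> dp W (\<lambda>\<omega> x. A \<omega> x = B \<omega> x)"
  by (rule dpI[where F = "\<lambda>\<omega> x. (A \<omega> x - B \<omega> x) + (B \<omega> x - A \<omega> x)"])
    (intro cf_add cf_diff, auto)

lemma dp_le: "cf W A \<Longrightarrow> cf W B \<Longrightarrow> dp W (\<lambda>\<omega> x. A \<omega> x \<le> B \<omega> x)"
  by (rule dpI[where F = "\<lambda>\<omega> x. A \<omega> x - B \<omega> x"]) (intro cf_diff, auto)

lemma dp_not: "dp W P \<Longrightarrow> dp W (\<lambda>\<omega> x. \<not> P \<omega> x)"
  by (rule dpI[where F = "\<lambda>\<omega> x. 1 - (if P \<omega> x then 0 else 1)"])
    (intro cf_diff cf_const, auto simp: dp_def)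

lemma dp_conj: "dp W P \<Longrightarrow> dp W Q \<Longrightarrow> dp W (\<lambda>\<omega> x. P \<omega> x \<and> Q \<omega> x)"
  by (rule dpI[where F = "\<lambda>\<omega> x. (if P \<omega> x then 0 else 1) + (if Q \<omega> x then 0 else 1)"])
    (intro cf_add, auto simp: dp_def)

lemma dp_disj: "dp W P \<Longrightarrow> dp W Q \<Longrightarrow> dp W (\<lambda>\<omega> x. P \<omega> x \<or> Q \<omega> x)"
  using dp_not[OF dp_conj[OF dp_not dp_not]] by simp

lemma dp_all_less:
  assumes "dp W (\<lambda>\<omega> x. P \<omega> (pfst x) (psnd x))" "cf W B"
  shows "dp W (\<lambda>\<omega> x. \<forall>i < B \<omega> x. P \<omega> x i)"
proof (rule dpI)
  let ?c = "\<lambda>\<omega> x i. if P \<omega> x i then 0 else 1 :: nat"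
  show "cf W (\<lambda>\<omega> x. rec_nat 0 (\<lambda>k r. r + ?c \<omega> x k) (B \<omega> x))"
    using cf_comp[OF assms(1)[unfolded dp_def], of "\<lambda>\<omega> x. prod_encode (pfst x, pfst (psnd x))"]
    by (intro cf_rec_nat cf_add cf_psnd cf_id cf_const assms)
      (simp add: cf_prod_encode cf_pfst cf_psnd cf_id)
  have "rec_nat 0 (\<lambda>k r. r + ?c \<omega> x k) n = 0 \<longleftrightarrow> (\<forall>i<n. P \<omega> x i)" for \<omega> x n
    by (induction n) (auto simp: less_Suc_eq)
  thus "(\<forall>i<B \<omega> x. P \<omega> x i) \<longleftrightarrow> rec_nat 0 (\<lambda>k r. r + ?c \<omega> x k) (B \<omega> x) = 0" for \<omega> x by simp
qed

lemma dp_ex_less: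
  assumes "dp W (\<lambda>\<omega> x. P \<omega> (pfst x) (psnd x))" "cf W B"
  shows "dp W (\<lambda>\<omega> x. \<exists>i < B \<omega> x. P \<omega> x i)"
  using dp_not[OF dp_all_less[OF dp_not[OF assms(1)] assms(2)]] by simp

definition sd :: "(nat \<Rightarrow> nat) set \<Rightarrow> ((nat \<Rightarrow> nat) \<Rightarrow> nat \<Rightarrow> bool) \<Rightarrow> bool" where
  "sd W P \<longleftrightarrow> (\<exists>D. dp W D \<and> (\<forall>\<omega>\<in>W. \<forall>x. P \<omega> x \<longleftrightarrow> (\<exists>y. D \<omega> (prod_encode (x, y)))))"

lemma sdE:
  assumes "sd W P"
  obtains D where "dp W (\<lambda>\<omega> x. D \<omega> (pfst x) (psnd x))"
    "\<And>\<omega> x. \<omega> \<in> W \<Longrightarrow> P \<omega> x \<longleftrightarrow> (\<exists>y. D \<omega> x y)"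
proof -
  obtain D where D: "dp W D" "\<forall>\<omega>\<in>W. \<forall>x. P \<omega> x \<longleftrightarrow> (\<exists>y. D \<omega> (prod_encode (x, y)))"
    using assms unfolding sd_def by blast
  show thesis
    by (rule that[of "\<lambda>\<omega> x y. D \<omega> (prod_encode (x, y))"]) (use D in auto)
qed

lemma sdI:
  assumes "dp W (\<lambda>\<omega> x. D \<omega> (pfst x) (psnd x))"
    "\<And>\<omega> x. \<omega> \<in> W \<Longrightarrow> P \<omega> x \<longleftrightarrow> (\<exists>y. D \<omega> x y)"
  shows "sd W P"
  unfolding sd_def using assms by (intro exI[of _ "\<lambda>\<omega> x. D \<omega> (pfst x) (psnd x)"]) auto

lemma dp_app2:
  assumes "dp W (\<lambda>\<omega> x. D \<omega> (pfst x) (psnd x))" "cf W A" "cf W B"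
  shows "dp W (\<lambda>\<omega> x. D \<omega> (A \<omega> x) (B \<omega> x))"
  using dp_comp[OF assms(1) cf_prod_encode[OF assms(2,3)]] by simp

lemma sd_dp: "dp W P \<Longrightarrow> sd W P"
  by (rule sdI[where D = "\<lambda>\<omega> x y. P \<omega> x"]) (rule dp_comp[OF _ cf_pfst[OF cf_id]], auto)

lemma sd_comp: "sd W P \<Longrightarrow> cf W A \<Longrightarrow> sd W (\<lambda>\<omega> x. P \<omega> (A \<omega> x))"
proof (erule sdE)
  fix D assume D: "dp W (\<lambda>\<omega> x. D \<omega> (pfst x) (psnd x))"
    "\<And>\<omega> x. \<omega> \<in> W \<Longrightarrow> P \<omega> x \<longleftrightarrow> (\<exists>y. D \<omega> x y)" and A: "cf W A"
  show ?thesis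
    by (rule sdI[where D = "\<lambda>\<omega> x y. D \<omega> (A \<omega> x) y"])
      (intro dp_app2[OF D(1)] cf_comp[OF A] cf_pfst cf_psnd cf_id, simp add: D(2))
qed

lemma sd_conj: "sd W P \<Longrightarrow> sd W Q \<Longrightarrow> sd W (\<lambda>\<omega> x. P \<omega> x \<and> Q \<omega> x)"
proof (elim sdE)
  fix D E assume D: "dp W (\<lambda>\<omega> x. D \<omega> (pfst x) (psnd x))"
    "\<And>\<omega> x. \<omega> \<in> W \<Longrightarrow> P \<omega> x \<longleftrightarrow> (\<exists>y. D \<omega> x y)"
    and E: "dp W (\<lambda>\<omega> x. E \<omega> (pfst x) (psnd x))"
    "\<And>\<omega> x. \<omega> \<in> W \<Longrightarrow> Q \<omega> x \<longleftrightarrow> (\<exists>y. E \<omega> x y)"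
  show ?thesis
  proof (rule sdI[where D = "\<lambda>\<omega> x y. D \<omega> x (pfst y) \<and> E \<omega> x (psnd y)"])
    show "dp W (\<lambda>\<omega> x. D \<omega> (pfst x) (pfst (psnd x)) \<and> E \<omega> (pfst x) (psnd (psnd x)))"
      by (intro dp_conj dp_app2[OF D(1)] dp_app2[OF E(1)] cf_pfst cf_psnd cf_id)
    show "(P \<omega> x \<and> Q \<omega> x) = (\<exists>y. D \<omega> x (pfst y) \<and> E \<omega> x (psnd y))" if "\<omega> \<in> W" for \<omega> x
      unfolding D(2)[OF that] E(2)[OF that] by (metis fst_conv prod_encode_inverse snd_conv)
  qed
qed

lemma sd_disj: "sd W P \<Longrightarrow> sd W Q \<Longrightarrow> sd W (\<lambda>\<omega> x. P \<omega> x \<or> Q \<omega> x)"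
proof (elim sdE)
  fix D E assume D: "dp W (\<lambda>\<omega> x. D \<omega> (pfst x) (psnd x))"
    "\<And>\<omega> x. \<omega> \<in> W \<Longrightarrow> P \<omega> x \<longleftrightarrow> (\<exists>y. D \<omega> x y)"
    and E: "dp W (\<lambda>\<omega> x. E \<omega> (pfst x) (psnd x))"
    "\<And>\<omega> x. \<omega> \<in> W \<Longrightarrow> Q \<omega> x \<longleftrightarrow> (\<exists>y. E \<omega> x y)"
  show ?thesis
    by (rule sdI[where D = "\<lambda>\<omega> x y. D \<omega> x y \<or> E \<omega> x y"])
      (intro dp_disj D(1) E(1), use D(2) E(2) in auto)
qed

lemma sd_ex:
  assumes "sd W (\<lambda>\<omega> x. P \<omega> (pfst x) (psnd x))"
  shows "sd W (\<lambda>\<omega> x. \<exists>y. P \<omega> x y)"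
  using assms
proof (rule sdE)
  fix D assume D: "dp W (\<lambda>\<omega> x. D \<omega> (pfst x) (psnd x))"
    "\<And>\<omega> x. \<omega> \<in> W \<Longrightarrow> P \<omega> (pfst x) (psnd x) \<longleftrightarrow> (\<exists>y. D \<omega> x y)"
  show ?thesis
  proof (rule sdI[where D = "\<lambda>\<omega> x y. D \<omega> (prod_encode (x, pfst y)) (psnd y)"])
    show "dp W (\<lambda>\<omega> x. D \<omega> (prod_encode (pfst x, pfst (psnd x))) (psnd (psnd x)))"
      by (intro dp_app2[OF D(1)] cf_prod_encode cf_pfst cf_psnd cf_id)
    show "(\<exists>y. P \<omega> x y) = (\<exists>y. D \<omega> (prod_encode (x, pfst y)) (psnd y))" if "\<omega> \<in> W" for \<omega> x
      using D(2)[OF that, of "prod_encode (x, _)"] by (simp, metis fst_conv prod_encode_inverse snd_conv)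
  qed
qed

text \<open>Finitely many witnesses have a common bound, so one unbounded search for that bound
  replaces the separate searches, and what remains has bounded quantifiers only.\<close>

lemma sd_all_less:
  assumes "sd W (\<lambda>\<omega> x. P \<omega> (pfst x) (psnd x))" "cf W B"
  shows "sd W (\<lambda>\<omega> x. \<forall>i < B \<omega> x. P \<omega> x i)"
  using assms(1)
proof (rule sdE)
  fix D assume D: "dp W (\<lambda>\<omega> x. D \<omega> (pfst x) (psnd x))"
    "\<And>\<omega> x. \<omega> \<in> W \<Longrightarrow> P \<omega> (pfst x) (psnd x) \<longleftrightarrow> (\<exists>y. D \<omega> x y)"
  show ?thesis
  proof (rule sdI[where D = "\<lambda>\<omega> x y. \<forall>i < B \<omega> x. \<exists>j<y. D \<omega> (prod_encode (x, i)) j"])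
    show "dp W (\<lambda>\<omega> x. \<forall>i < B \<omega> (pfst x). \<exists>j<psnd x. D \<omega> (prod_encode (pfst x, i)) j)"
      by (intro dp_all_less dp_ex_less dp_app2[OF D(1)] cf_prod_encode cf_pfst cf_psnd cf_id
          cf_comp[OF assms(2)])
    fix \<omega> x assume w: "\<omega> \<in> W"
    show "(\<forall>i<B \<omega> x. P \<omega> x i) = (\<exists>y. \<forall>i<B \<omega> x. \<exists>j<y. D \<omega> (prod_encode (x, i)) j)"
    proof
      assume "\<forall>i<B \<omega> x. P \<omega> x i"
      hence "\<forall>i<B \<omega> x. \<exists>j. D \<omega> (prod_encode (x, i)) j"
        using D(2)[OF w, of "prod_encode (x, _)"] by simp
      then obtain f where f: "\<forall>i<B \<omega> x. D \<omega> (prod_encode (x, i)) (f i)" by metis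
      have "\<forall>i<B \<omega> x. f i < Suc (\<Sum>i<B \<omega> x. f i)"
        by (metis finite_lessThan lessThan_iff le_imp_less_Suc member_le_sum zero_le)
      thus "\<exists>y. \<forall>i<B \<omega> x. \<exists>j<y. D \<omega> (prod_encode (x, i)) j" using f by blast
    next
      assume "\<exists>y. \<forall>i<B \<omega> x. \<exists>j<y. D \<omega> (prod_encode (x, i)) j"
      thus "\<forall>i<B \<omega> x. P \<omega> x i" using D(2)[OF w, of "prod_encode (x, _)"] by auto
    qed
  qed
qed

lemma cf_minimize:
  assumes "dp W (\<lambda>\<omega> x. P \<omega> (pfst x) (psnd x))" "\<And>\<omega> x. \<omega> \<in> W \<Longrightarrow> \<exists>y. P \<omega> x y"
  shows "cf W (\<lambda>\<omega> x. LEAST y. P \<omega> x y)"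
proof -
  have "cf W (\<lambda>\<omega> x. LEAST y. (if P \<omega> x y then 0 else 1 :: nat) = 0)"
    using cf_minimize_aux[OF assms(1)[unfolded dp_def]] assms(2) by simp
  moreover have "((if P \<omega> x y then 0 else 1 :: nat) = 0) = P \<omega> x y" for \<omega> x y by simp
  ultimately show ?thesis by simp
qed

text \<open>The search runs over pairs of a value and a witness for it, a decidable matter, and only
  the value is returned. Solvability for every argument is what makes minimization
  legitimate.\<close>

lemma sd_uniformize:
  assumes "sd W (\<lambda>\<omega> x. P \<omega> (pfst x) (psnd x))" "\<And>\<omega> x. \<omega> \<in> W \<Longrightarrow> \<exists>y. P \<omega> x y"
  obtains F where "recursive_in W 1 F" "\<And>\<omega> x. \<omega> \<in> W \<Longrightarrow> P \<omega> x (F \<omega> [x])"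
  using assms(1)
proof (rule sdE)
  fix D assume D: "dp W (\<lambda>\<omega> x. D \<omega> (pfst x) (psnd x))"
    "\<And>\<omega> x. \<omega> \<in> W \<Longrightarrow> P \<omega> (pfst x) (psnd x) \<longleftrightarrow> (\<exists>y. D \<omega> x y)"
  let ?D = "\<lambda>\<omega> x y. D \<omega> (prod_encode (x, pfst y)) (psnd y)"
  have ex: "\<exists>y. ?D \<omega> x y" if w: "\<omega> \<in> W" for \<omega> x
  proof -
    obtain y where "P \<omega> x y" using assms(2)[OF w] by blast
    then obtain z where "D \<omega> (prod_encode (x, y)) z"
      using D(2)[OF w, of "prod_encode (x, y)"] by auto
    thus ?thesis by (metis fst_conv prod_encode_inverse snd_conv)
  qed
  have "cf W (\<lambda>\<omega> x. pfst (LEAST y. ?D \<omega> x y))"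
    by (intro cf_pfst cf_minimize dp_app2[OF D(1)] cf_prod_encode cf_psnd cf_id ex)
  then obtain F where F: "recursive_in W 1 F"
    "\<And>\<omega> xs. \<omega> \<in> W \<Longrightarrow> length xs = 1 \<Longrightarrow> F \<omega> xs = pfst (LEAST y. ?D \<omega> (hd xs) y)"
    unfolding cf_def by (erule rec_extE)
  have "P \<omega> x (F \<omega> [x])" if w: "\<omega> \<in> W" for \<omega> x
  proof -
    have "?D \<omega> x (LEAST y. ?D \<omega> x y)" using ex[OF w] by (rule LeastI_ex)
    thus ?thesis using D(2)[OF w, of "prod_encode (x, _)"] F(2)[OF w, of "[x]"] by auto
  qed
  with F(1) show thesis by (rule that)
qed

section \<open>Recursion over coded lists\<close>

lemma list_decode_unfold:
  "list_decode n = (if n = 0 then [] else pfst (n - 1) # list_decode (psnd (n - 1)))"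
  by (cases n) (simp_all add: case_prod_unfold)

lemma psnd_le: "psnd n \<le> n"
  by (metis le_prod_encode_2 prod.collapse prod_decode_inverse)

lemma pfst_le: "pfst n \<le> n"
  by (metis le_prod_encode_1 prod.collapse prod_decode_inverse)

text \<open>The state is the code of the remaining list paired with the accumulator. The empty list
  has code 0 and makes the state a fixed point, so iterating too often is harmless.\<close>

definition foldl_step :: "(nat \<Rightarrow> nat \<Rightarrow> nat) \<Rightarrow> nat \<Rightarrow> nat" where
  "foldl_step f z = (if pfst z = 0 then z
     else prod_encode (psnd (pfst z - 1), f (psnd z) (pfst (pfst z - 1))))"

lemma foldl_step_iterate:
  "pfst z \<le> n \<Longrightarrow> psnd ((foldl_step f ^^ n) z) = foldl f (psnd z) (list_decode (pfst z))"
proof (induction n arbitrary: z)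
  case (Suc n)
  show ?case
  proof (cases "pfst z = 0")
    case True
    hence "(foldl_step f ^^ k) z = z" for k by (induction k) (auto simp: foldl_step_def)
    note iter = this
    show ?thesis unfolding iter using True by simp
  next
    case False
    hence step: "foldl_step f z = prod_encode (psnd (pfst z - 1), f (psnd z) (pfst (pfst z - 1)))"
      by (simp add: foldl_step_def)
    have "psnd (pfst z - 1) \<le> n" using psnd_le[of "pfst z - 1"] Suc.prems by linarith
    hence "psnd ((foldl_step f ^^ n) (foldl_step f z)) =
        foldl f (f (psnd z) (pfst (pfst z - 1))) (list_decode (psnd (pfst z - 1)))"
      using Suc.IH[of "foldl_step f z"] by (simp add: step)
    thus ?thesis using False
      by (subst list_decode_unfold) (simp add: funpow_swap1)
  qed
qed simp

lemma rec_nat_funpow: "rec_nat z (\<lambda>_. S) n = (S ^^ n) z"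
  by (induction n) auto

lemma cf_foldl:
  assumes "cf W L" "cf W A" "cf W (\<lambda>\<omega> x. F \<omega> (pfst x) (pfst (psnd x)) (psnd (psnd x)))"
  shows "cf W (\<lambda>\<omega> x. foldl (F \<omega> x) (A \<omega> x) (list_decode (L \<omega> x)))"
proof -
  have F: "cf W (\<lambda>\<omega> x. F \<omega> (B \<omega> x) (C \<omega> x) (D \<omega> x))"
    if "cf W B" "cf W C" "cf W D" for B C D
    using cf_comp[OF assms(3) cf_prod_encode[OF that(1) cf_prod_encode[OF that(2,3)]]] by simp
  \<comment> \<open>The code of the list itself serves as the number of iterations: it is large
    enough because the code of a tail is smaller than that of the list.\<close>
  have "cf W (\<lambda>\<omega> x. rec_nat (prod_encode (L \<omega> x, A \<omega> x)) (\<lambda>k. foldl_step (F \<omega> x)) (L \<omega> x))"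
    unfolding foldl_step_def
    by (intro cf_rec_nat cf_if dp_eq F cf_prod_encode cf_pfst cf_psnd cf_id cf_const cf_diff assms)
  hence "cf W (\<lambda>\<omega> x. psnd (rec_nat (prod_encode (L \<omega> x, A \<omega> x)) (\<lambda>k. foldl_step (F \<omega> x)) (L \<omega> x)))"
    by (rule cf_psnd)
  thus ?thesis by (simp add: rec_nat_funpow foldl_step_iterate)
qed

lemma foldl_rev_encode:
  "foldl (\<lambda>s e. Suc (prod_encode (e, s))) (list_encode ys) xs = list_encode (rev xs @ ys)"
proof (induction xs arbitrary: ys)
  case (Cons x xs)
  show ?case using Cons.IH[of "x # ys"] by simp
qed simp

text \<open>A right fold is a left fold over the reversed list, and reversal is itself a left fold
  on codes.\<close>

lemma cf_foldr:
  assumes "cf W L" "cf W A" "cf W (\<lambda>\<omega> x. F \<omega> (pfst x) (pfst (psnd x)) (psnd (psnd x)))"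
  shows "cf W (\<lambda>\<omega> x. foldr (F \<omega> x) (list_decode (L \<omega> x)) (A \<omega> x))"
proof -
  have F: "cf W (\<lambda>\<omega> x. F \<omega> (B \<omega> x) (C \<omega> x) (D \<omega> x))"
    if "cf W B" "cf W C" "cf W D" for B C D
    using cf_comp[OF assms(3) cf_prod_encode[OF that(1) cf_prod_encode[OF that(2,3)]]] by simp
  have "cf W (\<lambda>\<omega> x. foldl (\<lambda>s e. Suc (prod_encode (e, s))) 0 (list_decode (L \<omega> x)))"
    by (intro cf_foldl assms cf_const cf_Suc cf_prod_encode cf_pfst cf_psnd cf_id)
  hence R: "cf W (\<lambda>\<omega> x. list_encode (rev (list_decode (L \<omega> x))))"
    using foldl_rev_encode[of "[]"] by simp
  have "cf W (\<lambda>\<omega> x. foldl (\<lambda>s e. F \<omega> x e s) (A \<omega> x)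
      (list_decode (list_encode (rev (list_decode (L \<omega> x))))))"
    by (intro cf_foldl R assms F cf_pfst cf_psnd cf_id)
  thus ?thesis by (simp add: foldr_conv_foldl)
qed

abbreviation clength :: "nat \<Rightarrow> nat" where "clength n \<equiv> length (list_decode n)"

lemma cf_clength: "cf W L \<Longrightarrow> cf W (\<lambda>\<omega> x. clength (L \<omega> x))"
proof -
  assume L: "cf W L"
  have "foldr (\<lambda>_. Suc) xs 0 = length xs" for xs :: "nat list"
    by (induction xs) auto
  moreover have "cf W (\<lambda>\<omega> x. foldr (\<lambda>_. Suc) (list_decode (L \<omega> x)) 0)"
    by (intro cf_foldr L cf_const cf_Suc cf_psnd cf_id)
  ultimately show ?thesis by simp
qed

definition cnth :: "nat \<Rightarrow> nat \<Rightarrow> nat" where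
  "cnth n i = pfst (rec_nat n (\<lambda>_ r. psnd (r - 1)) i - 1)"

lemma cnth_nth: "i < clength n \<Longrightarrow> cnth n i = list_decode n ! i"
proof -
  assume i: "i < clength n"
  have "list_decode (rec_nat n (\<lambda>_ r. psnd (r - 1)) k) = drop k (list_decode n)" for k
  proof (induction k)
    case (Suc k)
    \<comment> \<open>For \<open>r = 0\<close> truncated subtraction and
      \<open>prod_decode 0 = (0, 0)\<close> give the code 0 again, in accordance with
      \<open>tl [] = []\<close>.\<close>
    have "list_decode (psnd (r - 1)) = tl (list_decode r)" for r
      by (subst (2) list_decode_unfold) (auto simp: prod_decode_def prod_decode_aux.simps)
    thus ?case using Suc by (simp add: drop_Suc tl_drop)
  qed simp
  hence "list_decode n ! i = hd (list_decode (rec_nat n (\<lambda>_ r. psnd (r - 1)) i))"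
    "list_decode (rec_nat n (\<lambda>_ r. psnd (r - 1)) i) \<noteq> []"
    using i by (auto simp: hd_drop_conv_nth)
  thus ?thesis unfolding cnth_def by (subst (asm) (1 2) list_decode_unfold) (auto split: if_splits)
qed

lemma cf_cnth: "cf W A \<Longrightarrow> cf W B \<Longrightarrow> cf W (\<lambda>\<omega> x. cnth (A \<omega> x) (B \<omega> x))"
  unfolding cnth_def by (intro cf_pfst cf_diff cf_rec_nat cf_psnd cf_const cf_id)

lemma dp_mem:
  assumes "cf W A" "cf W L"
  shows "dp W (\<lambda>\<omega> x. A \<omega> x \<in> set (list_decode (L \<omega> x)))"
proof -
  have "dp W (\<lambda>\<omega> x. \<exists>i < clength (L \<omega> x). cnth (L \<omega> x) i = A \<omega> x)"
    by (intro dp_ex_less dp_eq cf_cnth cf_clength assms assms[THEN cf_comp] cf_pfst cf_psnd cf_id)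
  moreover have "(\<exists>i < clength n. cnth n i = a) \<longleftrightarrow> a \<in> set (list_decode n)" for n a
    using cnth_nth by (metis in_set_conv_nth)
  ultimately show ?thesis by simp
qed

lemma sd_all_mem:
  assumes "sd W (\<lambda>\<omega> x. P \<omega> (pfst x) (psnd x))" "cf W L"
  shows "sd W (\<lambda>\<omega> x. \<forall>e \<in> set (list_decode (L \<omega> x)). P \<omega> x e)"
proof -
  have P: "sd W (\<lambda>\<omega> x. P \<omega> (A \<omega> x) (B \<omega> x))" if "cf W A" "cf W B" for A B
    using sd_comp[OF assms(1) cf_prod_encode[OF that]] by simp
  have "sd W (\<lambda>\<omega> x. \<forall>i < clength (L \<omega> x). P \<omega> x (cnth (L \<omega> x) i))"
    by (intro sd_all_less P cf_cnth cf_clength assms(2) assms(2)[THEN cf_comp] cf_pfst cf_psnd cf_id)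
  moreover have "(\<forall>i < clength n. Q (cnth n i)) \<longleftrightarrow> (\<forall>e\<in>set (list_decode n). Q e)" for n Q
    using cnth_nth by (metis in_set_conv_nth)
  ultimately show ?thesis by simp
qed

section \<open>Linear systems over subfields of the complex numbers\<close>

definition csubfield :: "complex set \<Rightarrow> bool" where
  "csubfield K \<longleftrightarrow> 0 \<in> K \<and> 1 \<in> K \<and> (\<forall>x\<in>K. \<forall>y\<in>K. x + y \<in> K \<and> x * y \<in> K) \<and>
     (\<forall>x\<in>K. - x \<in> K \<and> inverse x \<in> K)"

context
  fixes K :: "complex set"
  assumes K: "csubfield K"
begin

lemma csubfield_0: "0 \<in> K" and csubfield_1: "1 \<in> K"
  using K by (auto simp: csubfield_def)

lemma csubfield_add: "x \<in> K \<Longrightarrow> y \<in> K \<Longrightarrow> x + y \<in> K"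
  and csubfield_mult: "x \<in> K \<Longrightarrow> y \<in> K \<Longrightarrow> x * y \<in> K"
  and csubfield_minus: "x \<in> K \<Longrightarrow> - x \<in> K"
  and csubfield_inverse: "x \<in> K \<Longrightarrow> inverse x \<in> K"
  using K by (auto simp: csubfield_def)

lemma csubfield_diff: "x \<in> K \<Longrightarrow> y \<in> K \<Longrightarrow> x - y \<in> K"
  using csubfield_add[of x "- y"] csubfield_minus by simp

lemma csubfield_divide: "x \<in> K \<Longrightarrow> y \<in> K \<Longrightarrow> x / y \<in> K"
  using csubfield_mult[of x "inverse y"] csubfield_inverse by (simp add: divide_inverse)

lemma csubfield_sum: "(\<And>i. i \<in> A \<Longrightarrow> f i \<in> K) \<Longrightarrow> sum f A \<in> K"
  by (induction A rule: infinite_finite_induct) (auto intro: csubfield_0 csubfield_add)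

lemma csubfield_power: "x \<in> K \<Longrightarrow> x ^ n \<in> K"
  by (induction n) (auto intro: csubfield_1 csubfield_mult)

lemma csubfield_of_nat: "of_nat n \<in> K"
  by (induction n) (auto intro: csubfield_0 csubfield_1 csubfield_add)

lemmas csubfield_intros = csubfield_0 csubfield_1 csubfield_add csubfield_mult csubfield_minus
  csubfield_diff csubfield_divide csubfield_sum csubfield_power csubfield_of_nat

text \<open>Gaussian elimination: a pivot removes one equation together with one unknown, so the
  surplus of unknowns persists. Only field operations on the entries occur, which keeps the solution
  in \<open>K\<close>.\<close>

lemma linear_system_nontrivial_solution:
  assumes "finite I" "finite J" "card I < card J" "\<And>i j. i \<in> I \<Longrightarrow> j \<in> J \<Longrightarrow> m i j \<in> K"
  shows "\<exists>x. (\<forall>j\<in>J. x j \<in> K) \<and> (\<exists>j\<in>J. x j \<noteq> 0) \<and> (\<forall>i\<in>I. (\<Sum>j\<in>J. m i j * x j) = 0)"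
  using assms
proof (induction I arbitrary: J m rule: finite_induct)
  case empty
  then obtain j where "j \<in> J" by (metis card.empty less_irrefl all_not_in_conv)
  thus ?case by (intro exI[of _ "\<lambda>_. 1"]) (auto intro: csubfield_1)
next
  case (insert i0 I)
  show ?case
  proof (cases "\<forall>j\<in>J. m i0 j = 0")
    case True
    have "\<exists>x. (\<forall>j\<in>J. x j \<in> K) \<and> (\<exists>j\<in>J. x j \<noteq> 0) \<and> (\<forall>i\<in>I. (\<Sum>j\<in>J. m i j * x j) = 0)"
      using insert.prems insert.hyps by (intro insert.IH) auto
    thus ?thesis using True by (auto simp: insert_iff)
  next
    case False
    then obtain j0 where j0: "j0 \<in> J" "m i0 j0 \<noteq> 0" by blast
    define m' where "m' i j = m i j - m i j0 * m i0 j / m i0 j0" for i j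
    have "\<exists>x. (\<forall>j\<in>J - {j0}. x j \<in> K) \<and> (\<exists>j\<in>J - {j0}. x j \<noteq> 0) \<and>
        (\<forall>i\<in>I. (\<Sum>j\<in>J - {j0}. m' i j * x j) = 0)"
      using insert.prems insert.hyps j0(1)
      by (intro insert.IH) (auto simp: m'_def intro!: csubfield_intros)
    then obtain x where x: "\<forall>j\<in>J - {j0}. x j \<in> K" "\<exists>j\<in>J - {j0}. x j \<noteq> 0"
      "\<And>i. i \<in> I \<Longrightarrow> (\<Sum>j\<in>J - {j0}. m' i j * x j) = 0" by blast
    define s where "s = (\<Sum>j\<in>J - {j0}. m i0 j * x j)"
    \<comment> \<open>The eliminated unknown is recovered from the pivot row
      \<open>i0\<close>.\<close>
    define y where "y = x(j0 := - s / m i0 j0)"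
    have split: "(\<Sum>j\<in>J. m i j * y j) = m i j0 * y j0 + (\<Sum>j\<in>J - {j0}. m i j * x j)" for i
    proof -
      have "(\<Sum>j\<in>J. m i j * y j) = m i j0 * y j0 + (\<Sum>j\<in>J - {j0}. m i j * y j)"
        using insert.prems(1) j0(1) by (simp add: sum.remove)
      also have "(\<Sum>j\<in>J - {j0}. m i j * y j) = (\<Sum>j\<in>J - {j0}. m i j * x j)"
        by (rule sum.cong) (auto simp: y_def)
      finally show ?thesis .
    qed
    have "(\<Sum>j\<in>J. m i j * y j) = 0" if "i \<in> I" for i
    proof -
      have "(\<Sum>j\<in>J - {j0}. m' i j * x j) = (\<Sum>j\<in>J - {j0}. m i j * x j) - m i j0 / m i0 j0 * s"
        unfolding m'_def s_def sum_distrib_left sum_subtractf[symmetric]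
        by (rule sum.cong) (auto simp: field_simps)
      with x(3)[OF that] show ?thesis unfolding split by (simp add: y_def)
    qed
    moreover have "(\<Sum>j\<in>J. m i0 j * y j) = 0"
      unfolding split using j0(2) by (simp add: y_def s_def)
    moreover have "s \<in> K" unfolding s_def
      using x(1) insert.prems(3) by (intro csubfield_sum csubfield_mult) auto
    hence "\<forall>j\<in>J. y j \<in> K"
      using x(1) j0 insert.prems(3) by (auto simp: y_def intro!: csubfield_intros)
    moreover have "\<exists>j\<in>J. y j \<noteq> 0" using x(2) by (auto simp: y_def)
    ultimately show ?thesis by (intro exI[of _ y]) auto
  qed
qed

end

section \<open>Degree bounds and Bezout identities over a subfield\<close>

definition poly_over :: "complex set \<Rightarrow> complex poly \<Rightarrow> bool" where
  "poly_over K p \<longleftrightarrow> (\<forall>i. coeff p i \<in> K)"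

definition poly2_over :: "complex set \<Rightarrow> complex poly poly \<Rightarrow> bool" where
  "poly2_over K p \<longleftrightarrow> (\<forall>i. poly_over K (coeff p i))"

definition zdeg_le :: "complex poly poly \<Rightarrow> nat \<Rightarrow> bool" where
  "zdeg_le p n \<longleftrightarrow> (\<forall>i. degree (coeff p i) \<le> n)"

lemma poly_over_mult: "csubfield K \<Longrightarrow> poly_over K p \<Longrightarrow> poly_over K q \<Longrightarrow> poly_over K (p * q)"
  unfolding poly_over_def coeff_mult by (auto intro!: csubfield_sum csubfield_mult)

lemma poly_over_sum: "csubfield K \<Longrightarrow> (\<And>i. i \<in> A \<Longrightarrow> poly_over K (f i)) \<Longrightarrow> poly_over K (sum f A)"
  unfolding poly_over_def coeff_sum by (auto intro!: csubfield_sum)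

lemma poly_over_add: "csubfield K \<Longrightarrow> poly_over K p \<Longrightarrow> poly_over K q \<Longrightarrow> poly_over K (p + q)"
  unfolding poly_over_def by (auto intro!: csubfield_add)

lemma poly_over_minus: "csubfield K \<Longrightarrow> poly_over K p \<Longrightarrow> poly_over K (- p)"
  unfolding poly_over_def by (auto intro!: csubfield_minus)

lemma poly_over_0: "csubfield K \<Longrightarrow> poly_over K 0"
  unfolding poly_over_def by (auto intro!: csubfield_0)

lemma poly_over_monom: "csubfield K \<Longrightarrow> c \<in> K \<Longrightarrow> poly_over K (monom c n)"
  unfolding poly_over_def by (auto simp: coeff_monom intro: csubfield_0)

lemma poly2_over_mult: "csubfield K \<Longrightarrow> poly2_over K p \<Longrightarrow> poly2_over K q \<Longrightarrow> poly2_over K (p * q)"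
  unfolding poly2_over_def coeff_mult by (auto intro!: poly_over_sum poly_over_mult)

lemma poly2_over_monom: "csubfield K \<Longrightarrow> poly_over K c \<Longrightarrow> poly2_over K (monom c n)"
  unfolding poly2_over_def by (auto simp: coeff_monom intro: poly_over_0)

lemma poly2_over_sum:
  "csubfield K \<Longrightarrow> (\<And>i. i \<in> A \<Longrightarrow> poly2_over K (f i)) \<Longrightarrow> poly2_over K (sum f A)"
  unfolding poly2_over_def coeff_sum by (auto intro!: poly_over_sum)

lemma poly2_over_add: "csubfield K \<Longrightarrow> poly2_over K p \<Longrightarrow> poly2_over K q \<Longrightarrow> poly2_over K (p + q)"
  unfolding poly2_over_def by (auto intro!: poly_over_add)

lemma zdeg_le_mult: "zdeg_le p m \<Longrightarrow> zdeg_le q n \<Longrightarrow> zdeg_le (p * q) (m + n)"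
  unfolding zdeg_le_def coeff_mult
  by (intro allI degree_sum_le order_trans[OF degree_mult_le] add_mono) auto

lemma zdeg_le_monom: "degree c \<le> m \<Longrightarrow> zdeg_le (monom c n) m"
  unfolding zdeg_le_def by (auto simp: coeff_monom)

lemma zdeg_le_sum: "(\<And>i. i \<in> A \<Longrightarrow> zdeg_le (f i) n) \<Longrightarrow> zdeg_le (sum f A) n"
  unfolding zdeg_le_def coeff_sum by (cases "finite A") (auto intro!: degree_sum_le)

lemma zdeg_le_add: "zdeg_le p n \<Longrightarrow> zdeg_le q n \<Longrightarrow> zdeg_le (p + q) n"
  unfolding zdeg_le_def by (auto intro!: degree_add_le)

lemma zdeg_le_mono: "zdeg_le p m \<Longrightarrow> m \<le> n \<Longrightarrow> zdeg_le p n"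
  unfolding zdeg_le_def using order_trans by blast

lemma zdeg_le_exists: "\<exists>m. zdeg_le r m"
proof -
  have "degree (coeff r i) \<le> (\<Sum>j\<le>degree r. degree (coeff r j))" for i
    by (cases "i \<le> degree r") (auto simp: coeff_eq_0 intro!: member_le_sum)
  thus ?thesis unfolding zdeg_le_def by blast
qed

lemma zdeg_le_exists2: "\<exists>m. zdeg_le p m \<and> zdeg_le q m"
  using zdeg_le_exists[of p] zdeg_le_exists[of q] zdeg_le_mono max.cobounded1 max.cobounded2 by metis

text \<open>The coefficients of \<open>u\<close> and \<open>v\<close> are the unknowns; the
  equations require all powers of \<open>w\<close> except the \<open>k\<close>-th to vanish in
  \<open>u * p + v * q\<close>. Nothing excludes \<open>r = 0\<close> here; that takes
  coprimality.\<close>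

lemma sylvester_combination:
  assumes K: "csubfield K" and p: "poly2_over K p" and q: "poly2_over K q"
    and deg: "degree p \<le> d" "degree q \<le> d" and zdeg: "zdeg_le p \<delta>" "zdeg_le q \<delta>"
    and k: "k < 2 * d"
  obtains u v r where "poly2_over K u" "poly2_over K v" "degree u < d" "degree v < d"
    "zdeg_le u (2 * d * \<delta>)" "zdeg_le v (2 * d * \<delta>)" "u \<noteq> 0 \<or> v \<noteq> 0"
    "u * p + v * q = monom r k" "degree r \<le> (2 * d + 1) * \<delta>"
proof -
  \<comment> \<open>There are \<open>2 * d * (e + 1)\<close> unknowns and
    \<open>(2 * d - 1) * (e + \<delta> + 1)\<close> equations. The unknowns prevail as soon as
    \<open>(2 * d - 1) * \<delta> < e + 1\<close>.\<close>
  define e where "e = 2 * d * \<delta>"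
  define J where "J = (UNIV :: bool set) \<times> {..<d} \<times> {..e}"
  define I where "I = ({..<2 * d} - {k}) \<times> {..e + \<delta>}"
  define P where "P b = (if b then p else q)" for b
  define G where "G = (\<lambda>(b, i, l). monom (monom 1 l) i * P b :: complex poly poly)"
  have "card I = (2 * d - 1) * (e + \<delta> + 1)" using k by (simp add: I_def card_cartesian_product)
  also have "\<dots> < 2 * d * (e + 1)"
  proof -
    obtain d' where d': "d = Suc d'" using k by (cases d) auto
    show ?thesis by (simp add: d' e_def algebra_simps)
  qed
  also have "\<dots> = card J" by (simp add: J_def card_cartesian_product)
  finally have card: "card I < card J" .
  have PK: "poly2_over K (P b)" for b using p q by (simp add: P_def)
  have "poly2_over K (G j)" for j
    unfolding G_def
    by (auto split: prod.split intro!: poly2_over_mult poly2_over_monom poly_over_monom K PK csubfield_1)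
  hence "coeff (coeff (G j) (fst i)) (snd i) \<in> K" for i j
    by (simp add: poly2_over_def poly_over_def)
  with card obtain x where x: "\<forall>j\<in>J. x j \<in> K" "\<exists>j\<in>J. x j \<noteq> 0"
    "\<forall>i\<in>I. (\<Sum>j\<in>J. coeff (coeff (G j) (fst i)) (snd i) * x j) = 0"
    using linear_system_nontrivial_solution[OF K, of I J "\<lambda>i j. coeff (coeff (G j) (fst i)) (snd i)"]
    by (auto simp: I_def J_def)
  define U where "U b = (\<Sum>(i, l)\<in>{..<d} \<times> {..e}. monom (monom (x (b, i, l)) l) i)" for b
  have xK: "x (b, i, l) \<in> K" if "i < d" "l \<le> e" for b i l using x(1) that by (auto simp: J_def)
  have UK: "poly2_over K (U b)" for b
    unfolding U_def by (auto intro!: poly2_over_sum poly2_over_monom poly_over_monom K xK)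
  have Uz: "zdeg_le (U b) e" for b
    unfolding U_def by (auto intro!: zdeg_le_sum zdeg_le_monom order_trans[OF degree_monom_le])
  have Ud: "degree (U b) < d" for b
  proof -
    have "degree (U b) \<le> d - 1" unfolding U_def
      by (intro degree_sum_le) (auto intro!: order_trans[OF degree_monom_le])
    thus ?thesis using k by auto
  qed
  have Uc: "coeff (coeff (U b) i) l = x (b, i, l)" if "i < d" "l \<le> e" for b i l
  proof -
    have "coeff (coeff (U b) i) l = (\<Sum>z\<in>{..<d} \<times> {..e}. if z = (i, l) then x (b, z) else 0)"
      unfolding U_def coeff_sum by (rule sum.cong) (auto simp: coeff_monom split: if_splits)
    thus ?thesis using that by simp
  qed
  define T where "T = U True * p + U False * q"
  have T: "T = (\<Sum>j\<in>J. smult [:x j:] (G j))"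
  proof -
    have "T = (\<Sum>b\<in>UNIV. U b * P b)" by (simp add: T_def P_def UNIV_bool)
    also have "\<dots> = (\<Sum>b\<in>UNIV. \<Sum>z\<in>{..<d} \<times> {..e}. smult [:x (b, z):] (G (b, z)))"
      unfolding U_def sum_distrib_right
      by (intro sum.cong refl) (auto simp: G_def smult_monom simp flip: mult_smult_left)
    also have "\<dots> = (\<Sum>j\<in>J. smult [:x j:] (G j))"
      unfolding J_def by (subst sum.cartesian_product) (simp add: case_prod_unfold)
    finally show ?thesis .
  qed
  have T0: "coeff (coeff T i) t = 0" if "(i, t) \<in> I" for i t
    using x(3) that unfolding T coeff_sum by (force simp: mult.commute)
  have "zdeg_le T (e + \<delta>)"
    unfolding T_def using Uz zdeg by (intro zdeg_le_add zdeg_le_mult)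
  hence Tz: "degree (coeff T i) \<le> e + \<delta>" for i by (simp add: zdeg_le_def)
  have "degree (U b * P b) < 2 * d" for b
    using degree_mult_le[of "U b" "P b"] Ud[of b] deg by (auto simp: P_def split: if_splits)
  from this[of True] this[of False] have Td: "degree T < 2 * d"
    unfolding T_def P_def by (simp add: degree_add_less)
  have "coeff T i = 0" if "i \<noteq> k" for i
  proof (cases "i < 2 * d")
    case True
    have "coeff (coeff T i) t = 0" for t
      using T0[of i t] True that Tz[of i] by (cases "t \<le> e + \<delta>") (auto simp: I_def coeff_eq_0)
    thus ?thesis by (simp add: poly_eq_iff)
  qed (use Td in \<open>simp add: coeff_eq_0\<close>)
  hence "T = monom (coeff T k) k" by (simp add: poly_eq_iff coeff_monom)
  moreover have "U True \<noteq> 0 \<or> U False \<noteq> 0"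
  proof -
    obtain b i l where "i < d" "l \<le> e" "x (b, i, l) \<noteq> 0" using x(2) by (auto simp: J_def)
    hence "U b \<noteq> 0" using Uc[of i l b] by auto
    thus ?thesis by (cases b) auto
  qed
  ultimately show thesis
    using that[of "U True" "U False" "coeff T k"] UK Ud Uz Tz[of k] unfolding T_def e_def
    by (simp add: algebra_simps)
qed

text \<open>Coprimality over the field of rational functions in \<open>z\<close>, with denominators
  cleared. In contrast to coprimality over the polynomial ring it tolerates common factors free of
  \<open>w\<close>, which the representation of \<open>R\<close> over the numbered field may
  retain.\<close>

definition rcoprime :: "complex poly poly \<Rightarrow> complex poly poly \<Rightarrow> bool" where
  "rcoprime p q \<longleftrightarrow> (\<exists>u v r. r \<noteq> 0 \<and> u * p + v * q = [:r:])"

text \<open>The Bezout identity turns the proportion into divisibility of \<open>[:r:] * x\<close>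
  by \<open>p\<close> and of \<open>[:r:] * y\<close> by \<open>q\<close>; the factor
  \<open>[:r:]\<close> does not affect degrees in \<open>w\<close>.\<close>

lemma rcoprime_degree_le:
  assumes "rcoprime p q" "p * y = x * q" "x \<noteq> 0 \<or> y \<noteq> 0"
  shows "degree p \<le> degree x" "degree q \<le> degree y"
proof -
  obtain u v r where r: "r \<noteq> 0" "u * p + v * q = [:r:]" using assms(1) by (auto simp: rcoprime_def)
  have "[:r:] * x = p * (u * x + v * y)" "[:r:] * y = q * (u * x + v * y)"
    using assms(2) unfolding r(2)[symmetric] by (simp_all add: algebra_simps)
  moreover from this have "u * x + v * y \<noteq> 0" using assms(3) r(1) by auto
  ultimately have "degree p \<le> degree ([:r:] * x) \<or> p = 0" "degree q \<le> degree ([:r:] * y) \<or> q = 0"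
    by (metis degree_mult_eq le_add1)+
  thus "degree p \<le> degree x" "degree q \<le> degree y" using r(1) by auto
qed

lemma rcoprime_combination:
  assumes "rcoprime p q" "d = max (degree p) (degree q)" "zdeg_le p \<delta>" "zdeg_le q \<delta>" "k < 2 * d"
  obtains u v r where "degree u < d" "degree v < d" "zdeg_le u (2 * d * \<delta>)" "zdeg_le v (2 * d * \<delta>)"
    "u * p + v * q = monom r k" "r \<noteq> 0" "degree r \<le> (2 * d + 1) * \<delta>"
proof -
  have "csubfield UNIV" by (simp add: csubfield_def)
  from sylvester_combination[OF this, of p q d \<delta> k] assms obtain u v r where uv:
    "degree u < d" "degree v < d" "zdeg_le u (2 * d * \<delta>)" "zdeg_le v (2 * d * \<delta>)"
    "u \<noteq> 0 \<or> v \<noteq> 0" "u * p + v * q = monom r k" "degree r \<le> (2 * d + 1) * \<delta>"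
    by (auto simp: poly2_over_def poly_over_def)
  \<comment> \<open>With \<open>r = 0\<close> the nonzero pair \<open>(- v, u)\<close> would be
    proportional to \<open>(p, q)\<close> but of smaller degree.\<close>
  have "r \<noteq> 0"
  proof
    assume "r = 0"
    hence "p * u = - v * q" using uv(6) by (simp add: algebra_simps eq_neg_iff_add_eq_0)
    from rcoprime_degree_le[OF assms(1) this] uv(1,2,5) assms(2) show False by auto
  qed
  with uv show thesis by (intro that)
qed

section \<open>The height inequality\<close>

definition rhom :: "('b::comm_ring_1 \<Rightarrow> 'a::comm_ring_1) \<Rightarrow> bool" where
  "rhom \<iota> \<longleftrightarrow> \<iota> 0 = 0 \<and> (\<forall>x y. \<iota> (x + y) = \<iota> x + \<iota> y) \<and> (\<forall>x y. \<iota> (x * y) = \<iota> x * \<iota> y)"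

lemma rhom_id: "rhom (\<lambda>x. x)" and rhom_const: "rhom (\<lambda>x. [:x:])"
  by (simp_all add: rhom_def)

text \<open>
  The homogeneous form \<open>b^n * p(a/b)\<close> of degree \<open>n\<close>. The map \<open>\<iota>\<close> embeds the coefficients
  (identity, constants, or evaluation at a point).
\<close>

definition hpoly :: "('b::comm_ring_1 \<Rightarrow> 'a::comm_ring_1) \<Rightarrow> nat \<Rightarrow> 'b poly \<Rightarrow> 'a \<Rightarrow> 'a \<Rightarrow> 'a" where
  "hpoly \<iota> n p a b = (\<Sum>i\<le>n. \<iota> (coeff p i) * a ^ i * b ^ (n - i))"

lemma hpoly_0: "hpoly \<iota> 0 p a b = \<iota> (coeff p 0)"
  by (simp add: hpoly_def)

lemma hpoly_Suc_pCons:
  "hpoly \<iota> (Suc n) (pCons c p) a b = \<iota> c * b ^ Suc n + a * hpoly \<iota> n p a b"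
  unfolding hpoly_def by (subst sum.atMost_Suc_shift) (simp add: sum_distrib_left mult_ac)

lemma hpoly_scale: "hpoly \<iota> n p (c * a) (c * b) = c ^ n * hpoly \<iota> n p a b"
  unfolding hpoly_def sum_distrib_left
proof (rule sum.cong)
  fix i assume "i \<in> {..n}"
  hence "c ^ n = c ^ i * c ^ (n - i)" by (simp flip: power_add)
  thus "\<iota> (coeff p i) * (c * a) ^ i * (c * b) ^ (n - i) =
      c ^ n * (\<iota> (coeff p i) * a ^ i * b ^ (n - i))"
    by (simp add: power_mult_distrib mult_ac)
qed simp

context
  fixes \<iota> :: "'b::comm_ring_1 \<Rightarrow> 'a::comm_ring_1"
  assumes \<iota>: "rhom \<iota>"
begin

lemma rhom_simps: "\<iota> 0 = 0" "\<iota> (x + y) = \<iota> x + \<iota> y" "\<iota> (x * y) = \<iota> x * \<iota> y"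
  using \<iota> by (auto simp: rhom_def)

lemma hpoly_add: "hpoly \<iota> n (p + q) a b = hpoly \<iota> n p a b + hpoly \<iota> n q a b"
  by (simp add: hpoly_def rhom_simps algebra_simps sum.distrib)

lemma hpoly_smult: "hpoly \<iota> n (smult c p) a b = \<iota> c * hpoly \<iota> n p a b"
  by (simp add: hpoly_def rhom_simps sum_distrib_left mult_ac)

lemma hpoly_extend: "degree p \<le> n \<Longrightarrow> hpoly \<iota> (n + k) p a b = b ^ k * hpoly \<iota> n p a b"
proof (induction k)
  case (Suc k)
  have "hpoly \<iota> (Suc m) p a b = b * hpoly \<iota> m p a b" if "degree p \<le> m" for m
    using that unfolding hpoly_def
    by (simp add: coeff_eq_0 rhom_simps sum_distrib_left Suc_diff_le mult_ac)
  from this[of "n + k"] Suc show ?case by (simp add: mult_ac)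
qed simp

lemma hpoly_mult:
  "degree p \<le> m \<Longrightarrow> degree q \<le> n \<Longrightarrow> hpoly \<iota> (m + n) (p * q) a b = hpoly \<iota> m p a b * hpoly \<iota> n q a b"
proof (induction m arbitrary: p)
  case 0
  then obtain c where "p = [:c:]" by (metis degree_eq_zeroE le_zero_eq)
  thus ?case by (simp add: hpoly_smult hpoly_0)
next
  case (Suc m)
  obtain c p' where p: "p = pCons c p'" by (cases p)
  have p': "degree p' \<le> m" using Suc.prems(1) by (auto simp: p split: if_splits)
  have "hpoly \<iota> (Suc m + n) (p * q) a b =
      \<iota> c * hpoly \<iota> (n + Suc m) q a b + hpoly \<iota> (Suc (m + n)) (pCons 0 (p' * q)) a b"
    by (simp add: p hpoly_add hpoly_smult add.commute)
  also have "\<dots> = \<iota> c * (b ^ Suc m * hpoly \<iota> n q a b) + a * (hpoly \<iota> m p' a b * hpoly \<iota> n q a b)"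
    by (simp only: hpoly_extend[OF Suc.prems(2)] hpoly_Suc_pCons Suc.IH[OF p' Suc.prems(2)] rhom_simps) simp
  also have "\<dots> = hpoly \<iota> (Suc m) p a b * hpoly \<iota> n q a b"
    by (simp add: p hpoly_Suc_pCons algebra_simps)
  finally show ?case .
qed

lemma hpoly_monom: "k \<le> n \<Longrightarrow> hpoly \<iota> n (monom r k) a b = \<iota> r * a ^ k * b ^ (n - k)"
proof -
  assume k: "k \<le> n"
  have "hpoly \<iota> n (monom r k) a b = (\<Sum>i\<le>n. if i = k then \<iota> r * a ^ k * b ^ (n - k) else 0)"
    unfolding hpoly_def by (rule sum.cong) (auto simp: coeff_monom rhom_simps)
  thus ?thesis using k by simp
qed

end

lemma degree_power_le_mult: "degree a \<le> m \<Longrightarrow> degree (a ^ i) \<le> i * m"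
  by (subst mult.commute) (rule order_trans[OF degree_power_le mult_le_mono1])

lemma degree_hpoly_le:
  fixes \<iota> :: "'b::comm_ring_1 \<Rightarrow> 'a::idom poly"
  assumes "\<And>i. degree (\<iota> (coeff p i)) \<le> e" "degree a \<le> m" "degree b \<le> m"
  shows "degree (hpoly \<iota> n p a b) \<le> e + n * m"
  unfolding hpoly_def
proof (rule degree_sum_le)
  fix i assume "i \<in> {..n}"
  hence i: "i \<le> n" by simp
  have "degree (\<iota> (coeff p i) * a ^ i * b ^ (n - i)) \<le> e + i * m + (n - i) * m"
    by (intro order_trans[OF degree_mult_le] add_mono assms degree_power_le_mult)
  also have "\<dots> = e + n * m" using i by (metis add.assoc add_mult_distrib le_add_diff_inverse)
  finally show "degree (\<iota> (coeff p i) * a ^ i * b ^ (n - i)) \<le> e + n * m" .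
qed simp

text \<open>
  A common factor of the two forms at coprime \<open>a, b\<close> divides \<open>r1 * r2\<close>, and the two combinations
  bound the larger of their degrees from below. With \<open>\<iota> = id\<close> this bounds degrees in \<open>z\<close>; with
  \<open>\<iota>\<close> the embedding of \<open>\<complex>[z]\<close> into \<open>\<complex>[z][c]\<close> it controls degrees in a parameter \<open>c\<close>.
\<close>

lemma height_inequality:
  fixes \<iota> :: "complex poly \<Rightarrow> 'a::{factorial_ring_gcd, semiring_gcd_mult_normalize} poly"
  assumes \<iota>: "rhom \<iota>" and ab: "coprime a b"
    and d: "degree p \<le> d" "degree q \<le> d" "d > 0"
    and uv: "degree u1 < d" "degree v1 < d" "degree u2 < d" "degree v2 < d"
    and comb: "u1 * p + v1 * q = monom r1 0" "u2 * p + v2 * q = monom r2 (2 * d - 1)"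
    and r: "\<iota> r1 \<noteq> 0" "\<iota> r2 \<noteq> 0" "degree (\<iota> r1) \<le> \<rho>" "degree (\<iota> r2) \<le> \<rho>"
    and e: "\<And>i. degree (\<iota> (coeff u1 i)) \<le> e" "\<And>i. degree (\<iota> (coeff v1 i)) \<le> e"
      "\<And>i. degree (\<iota> (coeff u2 i)) \<le> e" "\<And>i. degree (\<iota> (coeff v2 i)) \<le> e"
    and \<alpha>\<beta>: "hpoly \<iota> d q a b * \<alpha> = hpoly \<iota> d p a b * \<beta>" "\<alpha> \<noteq> 0 \<or> \<beta> \<noteq> 0"
      "degree \<alpha> \<le> m'" "degree \<beta> \<le> m'"
    and m: "m = max (degree a) (degree b)"
  shows "d * m \<le> e + 2 * \<rho> + m'"
proof -
  define P Q where "P = hpoly \<iota> d p a b" and "Q = hpoly \<iota> d q a b"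
  \<comment> \<open>The products of the forms of degree \<open>d - 1\<close> with those of degree
    \<open>d\<close> are forms of degree \<open>N\<close>; hence \<open>b ^ N\<close> and
    \<open>a ^ N\<close> stem from the monomials of lowest and highest degree.\<close>
  define N where "N = 2 * d - 1"
  have N: "N = (d - 1) + d" using d(3) by (simp add: N_def)
  have comb_h: "hpoly \<iota> (d - 1) u a b * P + hpoly \<iota> (d - 1) v a b * Q = hpoly \<iota> N (u * p + v * q) a b"
    if "degree u < d" "degree v < d" for u v
    unfolding N P_def Q_def using that d
    by (subst hpoly_add[OF \<iota>], subst (1 2) hpoly_mult[OF \<iota>]) auto
  have 1: "hpoly \<iota> (d - 1) u1 a b * P + hpoly \<iota> (d - 1) v1 a b * Q = \<iota> r1 * b ^ N"
    using comb_h[OF uv(1,2)] by (simp add: comb hpoly_monom[OF \<iota>])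
  have 2: "hpoly \<iota> (d - 1) u2 a b * P + hpoly \<iota> (d - 1) v2 a b * Q = \<iota> r2 * a ^ N"
    using comb_h[OF uv(3,4)] by (simp add: comb N_def hpoly_monom[OF \<iota>])
  define g where "g = gcd P Q"
  have gP: "g dvd P" and gQ: "g dvd Q" by (simp_all add: g_def)
  define c where "c = \<iota> r1 * \<iota> r2"
  have c0: "c \<noteq> 0" using r by (simp add: c_def)
  have "g dvd \<iota> r1 * b ^ N" "g dvd \<iota> r2 * a ^ N"
    using gP gQ by (simp_all flip: 1 2)
  hence "g dvd \<iota> r2 * (\<iota> r1 * b ^ N)" "g dvd \<iota> r1 * (\<iota> r2 * a ^ N)" by (simp_all add: dvd_mult)
  \<comment> \<open>Both multiples are brought to the common factor \<open>c\<close>; coprimality of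
    \<open>a\<close> and \<open>b\<close> then leaves \<open>c\<close> alone as a bound for the
    cancellation.\<close>
  hence "g dvd gcd (c * a ^ N) (c * b ^ N)"
    by (simp add: c_def mult_ac)
  also have "gcd (c * a ^ N) (c * b ^ N) = normalize c"
    using ab by (simp add: gcd_mult_left)
  finally have gc: "g dvd c" by simp
  hence g0: "g \<noteq> 0" using c0 by auto
  have "degree g \<le> degree c" using gc c0 by (rule dvd_imp_degree_le)
  also have "\<dots> \<le> 2 * \<rho>" using r degree_mult_le[of "\<iota> r1" "\<iota> r2"] by (simp add: c_def)
  finally have dg: "degree g \<le> 2 * \<rho>" .
  obtain x y where xy: "P = g * x" "Q = g * y" using gP gQ by (auto elim!: dvdE)
  have cop: "coprime x y"
  proof -
    have "P \<noteq> 0 \<or> Q \<noteq> 0" using g0 by (auto simp: g_def)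
    hence "coprime (P div g) (Q div g)" unfolding g_def by (rule div_gcd_coprime)
    thus ?thesis using g0 xy by simp
  qed
  have "y * \<alpha> = x * \<beta>" using \<alpha>\<beta>(1) g0 by (simp add: xy mult_ac flip: P_def Q_def)
  hence dvds: "x dvd \<alpha>" "y dvd \<beta>"
    using cop by (metis coprime_commute coprime_dvd_mult_right_iff dvd_triv_left)+
  have "degree x \<le> m'"
  proof (cases "\<alpha> = 0")
    case True
    thus ?thesis using \<open>y * \<alpha> = x * \<beta>\<close> \<alpha>\<beta>(2) by auto
  qed (use dvds \<alpha>\<beta> dvd_imp_degree_le in \<open>meson order_trans\<close>)
  hence dP: "degree P \<le> 2 * \<rho> + m'"
    using degree_mult_le[of g x] dg by (simp add: xy)
  have "degree y \<le> m'"
  proof (cases "\<beta> = 0")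
    case True
    thus ?thesis using \<open>y * \<alpha> = x * \<beta>\<close> \<alpha>\<beta>(2) by auto
  qed (use dvds \<alpha>\<beta> dvd_imp_degree_le in \<open>meson order_trans\<close>)
  hence dQ: "degree Q \<le> 2 * \<rho> + m'"
    using degree_mult_le[of g y] dg by (simp add: xy)
  define X where "X = e + (d - 1) * m + (2 * \<rho> + m')"
  have bound: "degree (hpoly \<iota> (d - 1) u a b * P + hpoly \<iota> (d - 1) v a b * Q) \<le> X"
    if "\<And>i. degree (\<iota> (coeff u i)) \<le> e" "\<And>i. degree (\<iota> (coeff v i)) \<le> e" for u v
    unfolding X_def
    by (intro degree_add_le order_trans[OF degree_mult_le] add_mono degree_hpoly_le that dP dQ)
      (simp_all add: m)
  have key: "N * degree x \<le> X" if "degree (s * x ^ N) \<le> X" "s \<noteq> 0" for s x :: "'a poly"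
    using that by (cases "x = 0") (auto simp: degree_mult_eq degree_power_eq)
  have "N * degree b \<le> X" using bound[OF e(1,2)] r(1) by (intro key) (simp_all add: 1 del: One_nat_def)
  moreover have "N * degree a \<le> X" using bound[OF e(3,4)] r(2) by (intro key) (simp_all add: 2 del: One_nat_def)
  ultimately have "N * m \<le> X" by (simp add: m max_def)
  \<comment> \<open>The summand \<open>(d - 1) * m\<close> in \<open>X\<close> cancels against the
    same part of \<open>N * m\<close>, which leaves \<open>d * m\<close>.\<close>
  thus ?thesis unfolding N X_def using d(3) by (cases d) (auto simp: algebra_simps)
qed

text \<open>
  The flag \<open>ode\<close> selects the equation: \<open>stepn/stepd\<close> are numerator and denominator of
  \<open>f(z+1)\<close> or of \<open>f'\<close> for \<open>f = a/b\<close>.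
\<close>

definition stepn :: "bool \<Rightarrow> complex poly \<Rightarrow> complex poly \<Rightarrow> complex poly" where
  "stepn ode a b = (if ode then pderiv a * b - a * pderiv b else pcompose a [:1, 1:])"

definition stepd :: "bool \<Rightarrow> complex poly \<Rightarrow> complex poly" where
  "stepd ode b = (if ode then b ^ 2 else pcompose b [:1, 1:])"

definition defect :: "bool \<Rightarrow> nat \<Rightarrow> complex poly poly \<Rightarrow> complex poly poly \<Rightarrow>
    complex poly \<Rightarrow> complex poly \<Rightarrow> complex poly" where
  "defect ode g p q a b =
     stepn ode a b * hpoly (\<lambda>x. x) g q a b - stepd ode b * hpoly (\<lambda>x. x) g p a b"

definition edeg :: "bool \<Rightarrow> nat" where "edeg ode = (if ode then 2 else 1)"

lemma stepd_nonzero: "b \<noteq> 0 \<Longrightarrow> stepd ode b \<noteq> 0"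
  by (auto simp: stepd_def pcompose_eq_0)

lemma degree_step_le:
  assumes "degree a \<le> m" "degree b \<le> m"
  shows "degree (stepn ode a b) \<le> edeg ode * m" "degree (stepd ode b) \<le> edeg ode * m"
proof -
  have "degree (pderiv a * b) \<le> 2 * m" "degree (a * pderiv b) \<le> 2 * m"
    using assms degree_mult_le[of "pderiv a" b] degree_mult_le[of a "pderiv b"]
    by (auto simp: degree_pderiv)
  thus "degree (stepn ode a b) \<le> edeg ode * m"
    using assms by (auto simp: stepn_def edeg_def degree_pcompose intro!: degree_diff_le)
  show "degree (stepd ode b) \<le> edeg ode * m"
    using assms degree_power_le[of b 2] by (auto simp: stepd_def edeg_def degree_pcompose)
qed

lemma pderiv_eval: "poly (map_poly pderiv A) [:c:] = pderiv (poly A [:c:])"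
  by (induction A) (auto simp: map_poly_pCons pderiv_add pderiv_smult)

lemma pcompose_eval:
  "poly (map_poly (\<lambda>a. pcompose a s) A) [:c:] = pcompose (poly A [:c:]) s" for c :: complex
  by (induction A) (auto simp: map_poly_pCons pcompose_add pcompose_smult)

lemma hpoly_eval:
  "poly (hpoly (\<lambda>x. [:x:]) n p A B) x = hpoly (\<lambda>x. x) n p (poly A x) (poly B x)"
  by (simp add: hpoly_def poly_sum poly_power mult.assoc)

lemma map_poly_pderiv_mult:
  "map_poly pderiv (A * B) = map_poly pderiv A * B + A * map_poly pderiv B"
  for A B :: "complex poly poly"
proof (rule poly_eqI)
  fix n
  have pd: "pderiv (sum f S) = (\<Sum>i\<in>S. pderiv (f i))" for f :: "nat \<Rightarrow> complex poly" and S
    by (induction S rule: infinite_finite_induct) (auto simp: pderiv_add)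
  have pm: "pderiv (a * b) = pderiv a * b + a * pderiv b" for a b :: "complex poly"
    by (simp add: pderiv_mult algebra_simps)
  show "coeff (map_poly pderiv (A * B)) n = coeff (map_poly pderiv A * B + A * map_poly pderiv B) n"
    by (simp add: coeff_map_poly coeff_mult pd pm sum.distrib)
qed

lemma map_poly_pcompose_mult:
  "map_poly (\<lambda>a. pcompose a s) (A * B) = map_poly (\<lambda>a. pcompose a s) A * map_poly (\<lambda>a. pcompose a s) B"
  for A B :: "complex poly poly"
  by (rule poly_eqI) (simp add: coeff_map_poly coeff_mult pcompose_sum pcompose_mult)

context
  fixes ode :: bool and p q :: "complex poly poly" and d g :: nat
  assumes rcop: "rcoprime p q" and d: "d = max (degree p) (degree q)"
    and de: "edeg ode < d" and dg: "d \<le> g"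
begin

text \<open>The algorithm reads the homogenization degree \<open>g\<close> off the length of a code,
  so it may exceed \<open>d\<close>; the surplus is only a power of \<open>b\<close>.\<close>

lemma hpoly_ge:
  assumes "rhom \<iota>"
  shows "hpoly \<iota> g p a b = b ^ (g - d) * hpoly \<iota> d p a b"
    "hpoly \<iota> g q a b = b ^ (g - d) * hpoly \<iota> d q a b"
  using hpoly_extend[OF assms, of p d "g - d" a b] hpoly_extend[OF assms, of q d "g - d" a b] d dg
  by simp_all

text \<open>Substitution into \<open>R\<close> multiplies the degree by \<open>d\<close> up to a
  constant, while the left-hand side multiplies it by at most \<open>edeg ode < d\<close>. The
  constant is \<open>2 * d * \<delta>\<close> from the multipliers plus twice
  \<open>(2 * d + 1) * \<delta>\<close> from \<open>r1\<close> and \<open>r2\<close>.\<close>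

lemma solution_degree_le:
  assumes z: "zdeg_le p \<delta>" "zdeg_le q \<delta>" and ab: "coprime a b" and b: "b \<noteq> 0"
    and sol: "defect ode g p q a b = 0"
  shows "max (degree a) (degree b) \<le> (6 * d + 2) * \<delta>"
proof -
  define m where "m = max (degree a) (degree b)"
  have d0: "d > 0" using de by simp
  obtain u1 v1 r1 where c1: "degree u1 < d" "degree v1 < d" "zdeg_le u1 (2 * d * \<delta>)"
    "zdeg_le v1 (2 * d * \<delta>)" "u1 * p + v1 * q = monom r1 0" "r1 \<noteq> 0" "degree r1 \<le> (2 * d + 1) * \<delta>"
    by (rule rcoprime_combination[OF rcop d z, of 0], use d0 in simp, rule that)
  obtain u2 v2 r2 where c2: "degree u2 < d" "degree v2 < d" "zdeg_le u2 (2 * d * \<delta>)"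
    "zdeg_le v2 (2 * d * \<delta>)" "u2 * p + v2 * q = monom r2 (2 * d - 1)" "r2 \<noteq> 0"
    "degree r2 \<le> (2 * d + 1) * \<delta>"
    by (rule rcoprime_combination[OF rcop d z, of "2 * d - 1"], use d0 in simp, rule that)
  have "defect ode g p q a b = b ^ (g - d) *
      (stepn ode a b * hpoly (\<lambda>x. x) d q a b - stepd ode b * hpoly (\<lambda>x. x) d p a b)"
    unfolding defect_def hpoly_ge[OF rhom_id] by (simp add: algebra_simps)
  hence "hpoly (\<lambda>x. x) d q a b * stepn ode a b = hpoly (\<lambda>x. x) d p a b * stepd ode b"
    using sol b by (simp add: mult_ac)
  moreover have "degree (stepn ode a b) \<le> edeg ode * m" "degree (stepd ode b) \<le> edeg ode * m"
    using degree_step_le[of a m b ode] by (auto simp: m_def)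
  ultimately have "d * m \<le> 2 * d * \<delta> + 2 * ((2 * d + 1) * \<delta>) + edeg ode * m"
    using c1 c2 stepd_nonzero[OF b, of ode] d0 d
    by (intro height_inequality[OF rhom_id ab, where p = p and d = d and q = q and ?u1.0 = u1 and ?v1.0 = v1 and ?u2.0 = u2 and ?v2.0 = v2 and ?r1.0 = r1 and ?r2.0 = r2 and \<alpha> = "stepn ode a b" and \<beta> = "stepd ode b"])
      (auto simp: m_def zdeg_le_def)
  hence "(d - edeg ode) * m \<le> (6 * d + 2) * \<delta>"
    by (simp add: diff_mult_distrib algebra_simps)
  moreover have "1 * m \<le> (d - edeg ode) * m" using de by (intro mult_le_mono1) simp
  ultimately show ?thesis by (simp add: m_def)
qed

text \<open>
  If \<open>A/B\<close> has degree \<open>m\<close> in the parameter, then the right-hand side of the equation has degree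
  \<open>d * m\<close> in it and the left-hand side at most \<open>edeg ode * m\<close>.
\<close>

lemma family_constant:
  assumes sol: "\<And>c. defect ode g p q (poly A [:c:]) (poly B [:c:]) = 0"
  shows "poly A [:c:] * poly B [:c':] = poly B [:c:] * poly A [:c':]"
proof (cases "B = 0")
  case False
  let ?S = "map_poly (\<lambda>a. pcompose a [:1, 1 :: complex:])"
  \<comment> \<open>Lifts of \<open>stepn\<close> and \<open>stepd\<close> to families: derivative
    and shift act on the coefficients in \<open>z\<close>, the parameter being fixed.\<close>
  define th1 where "th1 A B = (if ode then map_poly pderiv A * B - A * map_poly pderiv B else ?S A)" for A B
  define th2 where "th2 B = (if ode then B ^ 2 else ?S B)" for B
  let ?h = "hpoly (\<lambda>x. [:x:])"
  \<comment> \<open>The height inequality applies to coprime pairs only, so a common factor of the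
    family has to be removed first.\<close>
  define G where "G = gcd A B"
  have G0: "G \<noteq> 0" using False by (simp add: G_def)
  obtain A1 B1 where AB: "A = G * A1" "B = G * B1" by (metis G_def dvdE gcd_dvd1 gcd_dvd2)
  have cop: "coprime A1 B1"
  proof -
    have "coprime (A div G) (B div G)" using False unfolding G_def by (intro div_gcd_coprime) simp
    thus ?thesis using G0 AB by simp
  qed
  have B1: "B1 \<noteq> 0" using False AB by auto
  define EE where "EE = th1 A B * ?h g q A B - th2 B * ?h g p A B"
  have "poly EE [:c:] = 0" for c
    using sol[of c]
    by (simp add: EE_def th1_def th2_def pderiv_eval pcompose_eval hpoly_eval defect_def stepn_def
        stepd_def power2_eq_square split: if_splits)
  hence "range (\<lambda>c. [:c:]) \<subseteq> {x. poly EE x = 0}" by auto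
  moreover have "infinite (range (\<lambda>c::complex. [:c:]))"
    using infinite_UNIV_char_0[where 'a = complex] by (subst finite_image_iff) (auto intro: injI)
  ultimately have EE: "EE = 0" using poly_roots_finite finite_subset by blast
  \<comment> \<open>The factor that both lifts acquire when the pair is multiplied by
    \<open>G\<close>; in the quotient rule the terms with the derivative of \<open>G\<close>
    cancel.\<close>
  define H where "H = (if ode then G ^ 2 else ?S G)"
  have S0: "?S C \<noteq> 0" if "C \<noteq> 0" for C
  proof -
    from that obtain i where "coeff C i \<noteq> 0" by (auto simp: poly_eq_iff)
    hence "coeff (?S C) i \<noteq> 0" by (auto simp: coeff_map_poly pcompose_eq_0)
    thus ?thesis by auto
  qed
  have H0: "H \<noteq> 0" using G0 S0 by (simp add: H_def)
  have th: "th1 A B = H * th1 A1 B1" "th2 B = H * th2 B1"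
    by (auto simp: th1_def th2_def H_def AB map_poly_pderiv_mult map_poly_pcompose_mult
        algebra_simps power2_eq_square)
  have "EE = H * G ^ g * B1 ^ (g - d) * (th1 A1 B1 * ?h d q A1 B1 - th2 B1 * ?h d p A1 B1)"
    unfolding EE_def th unfolding AB hpoly_scale unfolding hpoly_ge[OF rhom_const]
    by (simp add: algebra_simps)
  hence eq: "?h d q A1 B1 * th1 A1 B1 = ?h d p A1 B1 * th2 B1"
    using EE H0 G0 B1 by (simp add: mult_ac)
  define m where "m = max (degree A1) (degree B1)"
  have d0: "d > 0" using de by simp
  obtain \<delta> where z: "zdeg_le p \<delta>" "zdeg_le q \<delta>" using zdeg_le_exists2 by blast
  obtain u1 v1 r1 where c1: "degree u1 < d" "degree v1 < d" "u1 * p + v1 * q = monom r1 0" "r1 \<noteq> 0"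
    by (rule rcoprime_combination[OF rcop d z, of 0], use d0 in simp, rule that)
  obtain u2 v2 r2 where c2: "degree u2 < d" "degree v2 < d" "u2 * p + v2 * q = monom r2 (2 * d - 1)" "r2 \<noteq> 0"
    by (rule rcoprime_combination[OF rcop d z, of "2 * d - 1"], use d0 in simp, rule that)
  have th2_0: "th2 B1 \<noteq> 0" using B1 S0 by (auto simp: th2_def)
  have dth: "degree (th1 A1 B1) \<le> edeg ode * m" "degree (th2 B1) \<le> edeg ode * m"
  proof -
    have m: "degree A1 \<le> m" "degree B1 \<le> m" by (simp_all add: m_def)
    have D: "degree (map_poly f C) \<le> m" if "degree C \<le> m" for f and C :: "complex poly poly"
      using map_poly_degree_leq[of f C] that by linarith
    show "degree (th1 A1 B1) \<le> edeg ode * m"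
      using m D[OF m(1)] D[OF m(2)] degree_mult_le[of "map_poly pderiv A1" B1]
        degree_mult_le[of A1 "map_poly pderiv B1"] D[OF m(1), of pderiv] D[OF m(2), of pderiv]
      by (auto simp: th1_def edeg_def intro!: degree_diff_le)
    show "degree (th2 B1) \<le> edeg ode * m"
      using m D[OF m(2)] degree_power_le[of B1 2] by (auto simp: th2_def edeg_def)
  qed
  \<comment> \<open>Elements of the coefficient ring are constants with respect to the parameter, so
    the error terms \<open>e\<close> and \<open>\<rho>\<close> are 0 and the inequality becomes
    homogeneous in \<open>m\<close>.\<close>
  have "d * m \<le> 0 + 2 * 0 + edeg ode * m"
    using c1 c2 d0 d eq th2_0 dth
    by (intro height_inequality[OF rhom_const cop, where p = p and d = d and q = q and ?u1.0 = u1 and ?v1.0 = v1 and ?u2.0 = u2 and ?v2.0 = v2 and ?r1.0 = r1 and ?r2.0 = r2 and \<alpha> = "th1 A1 B1" and \<beta> = "th2 B1"]) (auto simp: m_def)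
  hence "m = 0" using de by (metis add_0 mult_0_right mult_le_cancel2 not_gr_zero not_le)
  hence "degree A1 = 0" "degree B1 = 0" by (simp_all add: m_def)
  then obtain a1 b1 where "A1 = [:a1:]" "B1 = [:b1:]" by (metis degree_eq_zeroE)
  thus ?thesis by (simp add: AB)
qed simp

end

section \<open>Linear conditions on solutions with a given value\<close>

text \<open>Functions instead of polynomials, because rows, heads and defects are given by their
  values; all that matters is a bound for the degree in the parameter, hence the number of integers
  at which an identity must be tested.\<close>

definition pf :: "nat \<Rightarrow> (complex \<Rightarrow> complex) \<Rightarrow> bool" where
  "pf n f \<longleftrightarrow> (\<exists>P. degree P \<le> n \<and> (\<forall>x. f x = poly P x))"

lemma pf_const: "pf n (\<lambda>x. c)" and pf_id: "n \<ge> 1 \<Longrightarrow> pf n (\<lambda>x. x)"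
  unfolding pf_def by (rule exI[of _ "[:c:]"], simp) (rule exI[of _ "[:0, 1:]"], simp)

lemma pf_mono: "pf m f \<Longrightarrow> m \<le> n \<Longrightarrow> pf n f"
  unfolding pf_def using order_trans by blast

lemma pf_add: "pf n f \<Longrightarrow> pf n h \<Longrightarrow> pf n (\<lambda>x. f x + h x)"
  unfolding pf_def by (metis degree_add_le poly_add)

lemma pf_diff: "pf n f \<Longrightarrow> pf n h \<Longrightarrow> pf n (\<lambda>x. f x - h x)"
  unfolding pf_def by (metis degree_diff_le poly_diff)

lemma pf_mult: "pf m f \<Longrightarrow> pf n h \<Longrightarrow> pf (m + n) (\<lambda>x. f x * h x)"
  unfolding pf_def by (metis add_mono degree_mult_le order_trans poly_mult)

lemma pf_power: "pf m f \<Longrightarrow> pf (n * m) (\<lambda>x. f x ^ n)"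
  by (induction n) (auto intro: pf_const pf_mult)

lemma pf_sum: "(\<And>i. i \<in> A \<Longrightarrow> pf n (f i)) \<Longrightarrow> pf n (\<lambda>x. \<Sum>i\<in>A. f i x)"
  by (induction A rule: infinite_finite_induct) (auto intro: pf_const pf_add)

lemma pf_hpoly:
  assumes "pf m f" "pf m h"
  shows "pf (n * m) (\<lambda>x. hpoly \<iota> n p (f x) (h x))"
  unfolding hpoly_def
proof (rule pf_sum)
  fix i assume "i \<in> {..n}"
  hence "0 + i * m + (n - i) * m = n * m" by (simp flip: add_mult_distrib)
  thus "pf (n * m) (\<lambda>x. \<iota> (coeff p i) * f x ^ i * h x ^ (n - i))"
    using pf_mult[OF pf_mult[OF pf_const[of 0] pf_power[OF assms(1), of i]] pf_power[OF assms(2), of "n - i"]]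
    by metis
qed

definition ev2 :: "complex poly poly \<Rightarrow> complex \<Rightarrow> complex \<Rightarrow> complex" where
  "ev2 p z x = poly (poly p [:x:]) z"

lemma ev2_simps [simp]: "ev2 (p + q) z x = ev2 p z x + ev2 q z x"
  "ev2 (p * q) z x = ev2 p z x * ev2 q z x" "ev2 0 z x = 0" "ev2 (- p) z x = - ev2 p z x"
  "ev2 (pCons r p) z x = poly r z + x * ev2 p z x"
  by (simp_all add: ev2_def)

lemma ev2_altdef: "degree p \<le> n \<Longrightarrow> ev2 p z x = (\<Sum>i\<le>n. poly (coeff p i) z * x ^ i)"
proof (induction p arbitrary: n)
  case (pCons r p)
  show ?case
  proof (cases n)
    case (Suc n')
    have "degree p \<le> n'" using pCons.prems Suc by (auto split: if_splits)
    thus ?thesis using pCons.IH[of n'] unfolding Suc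
      by (subst sum.atMost_Suc_shift) (simp add: sum_distrib_left mult_ac)
  qed (use pCons.prems in \<open>auto split: if_splits\<close>)
qed simp

lemma pf_ev2:
  assumes "degree p \<le> n"
  shows "pf n (ev2 p z)"
proof -
  have "ev2 p z x = poly (map_poly (\<lambda>r. poly r z) p) x" for x
    by (induction p) (simp_all add: map_poly_pCons)
  thus ?thesis unfolding pf_def
    using assms map_poly_degree_leq order_trans by blast
qed

lemma poly_eq_0_nat:
  assumes "degree f \<le> n" "\<And>k. k \<le> n \<Longrightarrow> poly f (of_nat (z0 + k)) = (0 :: complex)"
  shows "f = 0"
proof (rule ccontr)
  assume f: "f \<noteq> 0"
  have "(\<lambda>k. of_nat (z0 + k)) ` {..n} \<subseteq> {x. poly f x = 0}" using assms(2) by auto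
  hence "card ((\<lambda>k. of_nat (z0 + k) :: complex) ` {..n}) \<le> card {x. poly f x = 0}"
    by (intro card_mono poly_roots_finite f)
  also have "\<dots> \<le> n" using card_poly_roots_bound[OF f] assms(1) by linarith
  finally show False by (subst (asm) card_image) (auto intro: inj_onI)
qed

lemma pf_eq_0:
  assumes "pf n f" "\<And>k. k \<le> n \<Longrightarrow> f (of_nat (z0 + k)) = 0"
  shows "f x = 0"
proof -
  obtain P where P: "degree P \<le> n" "\<And>x. f x = poly P x" using assms(1) by (auto simp: pf_def)
  have "P = 0" using P assms(2) by (intro poly_eq_0_nat[of P n z0]) auto
  thus ?thesis using P by simp
qed

lemma hpoly_eval_poly:
  "poly (hpoly (\<lambda>x. x) n p a b) z = hpoly (\<lambda>r. poly r z) n p (poly a z) (poly b z)"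
  by (simp add: hpoly_def poly_sum poly_power)

lemma hpoly_ev2: "degree p \<le> n \<Longrightarrow> hpoly (\<lambda>r. poly r z) n p x 1 = ev2 p z x"
  by (simp add: hpoly_def ev2_altdef)

text \<open>
  The candidates \<open>A/B\<close> for a solution \<open>f\<close> with \<open>f(z0) = c\<close> are cut out by linear conditions
  \<open>row k\<close>. For the difference equation, \<open>orbit k\<close> are the homogeneous coordinates of \<open>f(z0 + k)\<close>, and
  \<open>row k\<close> says that \<open>A/B\<close> takes the same value. For the differential equation, \<open>vfield\<close> is \<open>q\<close> times
  the derivation along solutions, and \<open>row k\<close> says that \<open>(q d/dz)^k (A - f B)\<close> vanishes at \<open>z0\<close>.
\<close>

primrec orbit :: "complex poly poly \<Rightarrow> complex poly poly \<Rightarrow> nat \<Rightarrow> nat \<Rightarrow> complex \<Rightarrow> nat \<Rightarrow> complex \<times> complex" where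
  "orbit p q g z0 c 0 = (c, 1)"
| "orbit p q g z0 c (Suc k) =
     (hpoly (\<lambda>r. poly r (of_nat (z0 + k))) g p (fst (orbit p q g z0 c k)) (snd (orbit p q g z0 c k)),
      hpoly (\<lambda>r. poly r (of_nat (z0 + k))) g q (fst (orbit p q g z0 c k)) (snd (orbit p q g z0 c k)))"

definition vfield :: "complex poly poly \<Rightarrow> complex poly poly \<Rightarrow> complex poly poly \<Rightarrow> complex poly poly" where
  "vfield p q G = q * map_poly pderiv G + p * pderiv G"

definition row :: "bool \<Rightarrow> nat \<Rightarrow> complex poly poly \<Rightarrow> complex poly poly \<Rightarrow> nat \<Rightarrow> nat \<Rightarrow> complex \<Rightarrow>
    complex poly \<Rightarrow> complex poly \<Rightarrow> complex" where
  "row ode g p q z0 k c A B =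
     (if ode then ev2 ((vfield p q ^^ k) [:A, - B:]) (of_nat z0) c
      else poly A (of_nat (z0 + k)) * snd (orbit p q g z0 c k) -
           poly B (of_nat (z0 + k)) * fst (orbit p q g z0 c k))"

lemma map_poly_pderiv_add: "map_poly pderiv (A + B) = map_poly pderiv A + map_poly pderiv B"
  for A B :: "complex poly poly"
  by (rule poly_eqI) (simp add: coeff_map_poly pderiv_add)

lemma vfield_linear:
  "vfield p q (G + H) = vfield p q G + vfield p q H"
  "vfield p q (smult [:s:] G) = smult [:s:] (vfield p q G)"
proof -
  show "vfield p q (G + H) = vfield p q G + vfield p q H"
    by (simp add: vfield_def map_poly_pderiv_add pderiv_add algebra_simps)
  have "map_poly pderiv (smult [:s:] G) = smult [:s:] (map_poly pderiv G)"
    by (rule poly_eqI) (simp add: coeff_map_poly pderiv_smult)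
  thus "vfield p q (smult [:s:] G) = smult [:s:] (vfield p q G)"
    by (simp add: vfield_def pderiv_smult smult_add_right)
qed

lemma vfield_funpow_linear:
  "(vfield p q ^^ k) (G + H) = (vfield p q ^^ k) G + (vfield p q ^^ k) H"
  "(vfield p q ^^ k) (smult [:s:] G) = smult [:s:] ((vfield p q ^^ k) G)"
  by (induction k) (simp_all add: vfield_linear)

lemma row_linear:
  "row ode g p q z0 k c (A + A') (B + B') = row ode g p q z0 k c A B + row ode g p q z0 k c A' B'"
  "row ode g p q z0 k c (smult s A) (smult s B) = s * row ode g p q z0 k c A B"
proof -
  have 1: "[:A + A', - (B + B'):] = [:A, - B:] + [:A', - B':]" by simp
  have 2: "[:smult s A, - smult s B:] = smult [:s:] [:A, - B:]" by simp
  have 3: "smult [:s:] G = [:[:s:]:] * G" for G :: "complex poly poly" by simp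
  show "row ode g p q z0 k c (A + A') (B + B') = row ode g p q z0 k c A B + row ode g p q z0 k c A' B'"
    unfolding row_def 1 vfield_funpow_linear by (simp add: algebra_simps)
  show "row ode g p q z0 k c (smult s A) (smult s B) = s * row ode g p q z0 k c A B"
    unfolding row_def 2 vfield_funpow_linear unfolding 3 by (simp add: algebra_simps del: mult_pCons_left)
qed

lemma row_sum:
  "row ode g p q z0 k c (\<Sum>i\<in>S. smult (s i) (A i)) (\<Sum>i\<in>S. smult (s i) (B i)) =
     (\<Sum>i\<in>S. s i * row ode g p q z0 k c (A i) (B i))"
proof -
  have "row ode g p q z0 k c 0 0 = 0" using row_linear(2)[of ode g p q z0 k c 0 0 0] by simp
  thus ?thesis
    by (induction S rule: infinite_finite_induct) (simp_all add: row_linear)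
qed

lemma degree_eval_zdeg: "zdeg_le A n \<Longrightarrow> degree (poly A [:c:]) \<le> n"
proof -
  have "poly A [:c:] = (\<Sum>i\<le>degree A. smult (c ^ i) (coeff A i))"
    by (simp add: poly_altdef poly_const_pow)
  thus "zdeg_le A n \<Longrightarrow> degree (poly A [:c:]) \<le> n" unfolding zdeg_le_def
    by (auto intro!: degree_sum_le order_trans[OF degree_smult_le])
qed

text \<open>Bounds the degree of the rows in \<open>c\<close>. The derivation raises the degree in
  \<open>w\<close> by at most \<open>M\<close> per step, starting from 1; a step of the orbit
  multiplies the degree by at most \<open>M\<close>. There are \<open>2 * N\<close> steps.\<close>

definition rho :: "bool \<Rightarrow> nat \<Rightarrow> nat \<Rightarrow> nat" where
  "rho ode M N = (if ode then 1 + 2 * N * M else M ^ (2 * N))"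

lemma pf_orbit: "pf (g ^ k) (\<lambda>c. fst (orbit p q g z0 c k)) \<and> pf (g ^ k) (\<lambda>c. snd (orbit p q g z0 c k))"
proof (induction k)
  case (Suc k)
  thus ?case by (auto intro!: pf_hpoly)
qed (simp add: pf_const pf_id)

lemma degree_vfield_le: "degree p \<le> d \<Longrightarrow> degree q \<le> d \<Longrightarrow> degree ((vfield p q ^^ k) G) \<le> degree G + k * d"
proof (induction k)
  case (Suc k)
  let ?G = "(vfield p q ^^ k) G"
  have "degree (vfield p q ?G) \<le> d + degree ?G"
    unfolding vfield_def
    by (intro degree_add_le order_trans[OF degree_mult_le] add_mono Suc.prems map_poly_degree_leq)
      (simp_all add: degree_pderiv)
  also have "\<dots> \<le> degree G + Suc k * d" using Suc.IH Suc.prems by simp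
  finally show ?case by simp
qed simp

lemma pf_row:
  assumes "degree p \<le> M" "degree q \<le> M" "0 < g" "g \<le> M" "k \<le> 2 * N"
  shows "pf (rho ode M N) (\<lambda>c. row ode g p q z0 k c A B)"
proof (cases ode)
  case True
  have "degree ((vfield p q ^^ k) [:A, - B:]) \<le> degree [:A, - B:] + k * M"
    using assms by (intro degree_vfield_le) auto
  also have "\<dots> \<le> 1 + 2 * N * M" using assms(5) by (intro add_mono mult_le_mono1) auto
  finally have "degree ((vfield p q ^^ k) [:A, - B:]) \<le> rho ode M N" using True by (simp add: rho_def)
  from pf_ev2[OF this] show ?thesis using True by (simp add: row_def)
next
  case False
  have "g ^ k \<le> M ^ k" using assms by (intro power_mono) auto
  also have "\<dots> \<le> M ^ (2 * N)" using assms by (intro power_increasing) auto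
  finally have "g ^ k \<le> M ^ (2 * N)" .
  with pf_orbit[of g k p q z0] have o: "pf (rho ode M N) (\<lambda>c. fst (orbit p q g z0 c k))"
    "pf (rho ode M N) (\<lambda>c. snd (orbit p q g z0 c k))"
    using False by (auto simp: rho_def intro: pf_mono)
  show ?thesis using False pf_diff[OF pf_mult[OF pf_const[of 0] o(2)] pf_mult[OF pf_const[of 0] o(1)]]
    by (simp add: row_def)
qed

text \<open>Linearity of \<open>row\<close> in the pair separates the two ways in which
  \<open>x\<close> enters: through the powers of \<open>x\<close> in the family, of degree at most
  \<open>D\<close>, and through the value at which the conditions are imposed.\<close>

lemma pf_row_family:
  assumes M: "degree p \<le> M" "degree q \<le> M" "0 < g" "g \<le> M" "k \<le> 2 * N"
    and D: "degree A \<le> D" "degree B \<le> D"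
  shows "pf (D + rho ode M N) (\<lambda>x. row ode g p q z0 k x (poly A [:x:]) (poly B [:x:]))"
proof -
  have ev: "poly C [:x:] = (\<Sum>i\<le>D. smult (x ^ i) (coeff C i))" if "degree C \<le> D" for C :: "complex poly poly" and x
  proof -
    have "poly C [:x:] = (\<Sum>i\<le>degree C. smult (x ^ i) (coeff C i))"
      by (simp add: poly_altdef poly_const_pow)
    also have "\<dots> = (\<Sum>i\<le>D. smult (x ^ i) (coeff C i))"
      using that by (intro sum.mono_neutral_left) (auto simp: coeff_eq_0)
    finally show ?thesis .
  qed
  have "pf (D + rho ode M N) (\<lambda>x. x ^ i * row ode g p q z0 k x (coeff A i) (coeff B i))"
    if "i \<in> {..D}" for i
  proof (rule pf_mult)
    show "pf D (\<lambda>x. x ^ i)" using that pf_power[OF pf_id[of 1], of i] by (auto intro: pf_mono)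
    show "pf (rho ode M N) (\<lambda>x. row ode g p q z0 k x (coeff A i) (coeff B i))" by (rule pf_row[OF M])
  qed
  thus ?thesis unfolding ev[OF D(1)] ev[OF D(2)] row_sum by (rule pf_sum)
qed

section \<open>Solving the linear conditions over a subfield\<close>

context
  fixes K assumes K: "csubfield K"
begin

lemma poly_in: "poly_over K p \<Longrightarrow> x \<in> K \<Longrightarrow> poly p x \<in> K"
  unfolding poly_altdef poly_over_def
  by (auto intro!: csubfield_sum[OF K] csubfield_mult[OF K] csubfield_power[OF K])

lemma ev2_in: "poly2_over K p \<Longrightarrow> z \<in> K \<Longrightarrow> x \<in> K \<Longrightarrow> ev2 p z x \<in> K"
  unfolding ev2_altdef[OF order_refl]
  by (auto simp: poly2_over_def intro!: csubfield_sum[OF K] csubfield_mult[OF K] csubfield_power[OF K] poly_in)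

lemma hpoly_in:
  "poly2_over K p \<Longrightarrow> z \<in> K \<Longrightarrow> x \<in> K \<Longrightarrow> y \<in> K \<Longrightarrow> hpoly (\<lambda>r. poly r z) n p x y \<in> K"
  unfolding hpoly_def
  by (auto simp: poly2_over_def intro!: csubfield_sum[OF K] csubfield_mult[OF K] csubfield_power[OF K] poly_in)

lemma orbit_in:
  "poly2_over K p \<Longrightarrow> poly2_over K q \<Longrightarrow> c \<in> K \<Longrightarrow>
     fst (orbit p q g z0 c k) \<in> K \<and> snd (orbit p q g z0 c k) \<in> K"
  by (induction k) (auto intro!: hpoly_in csubfield_of_nat[OF K] csubfield_1[OF K] simp del: of_nat_add)

lemma poly_over_pderiv: "poly_over K p \<Longrightarrow> poly_over K (pderiv p)"
  unfolding poly_over_def coeff_pderiv by (auto intro!: csubfield_mult[OF K] csubfield_of_nat[OF K] simp del: of_nat_Suc)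

lemma poly2_over_vfield:
  assumes "poly2_over K p" "poly2_over K q" "poly2_over K G"
  shows "poly2_over K (vfield p q G)"
proof -
  have "poly2_over K (map_poly pderiv G)"
    using assms(3) by (auto simp: poly2_over_def coeff_map_poly intro: poly_over_pderiv)
  moreover have "poly2_over K (pderiv G)"
  proof -
    have "coeff (pderiv G) n = monom (of_nat (Suc n)) 0 * coeff G (Suc n)" for n
      by (simp add: coeff_pderiv of_nat_poly monom_0 del: of_nat_Suc)
    thus ?thesis using assms(3)
      by (auto simp: poly2_over_def simp del: of_nat_Suc
          intro!: poly_over_mult[OF K] poly_over_monom[OF K] csubfield_of_nat[OF K])
  qed
  ultimately show ?thesis
    unfolding vfield_def using assms by (intro poly2_over_add[OF K] poly2_over_mult[OF K])
qed

lemma poly2_over_vfield_funpow: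
  "poly2_over K p \<Longrightarrow> poly2_over K q \<Longrightarrow> poly2_over K G \<Longrightarrow> poly2_over K ((vfield p q ^^ k) G)"
  by (induction k) (auto intro: poly2_over_vfield)

lemma poly2_over_linear: "poly_over K A \<Longrightarrow> poly_over K B \<Longrightarrow> poly2_over K [:A, - B:]"
  by (auto simp: poly2_over_def coeff_pCons poly_over_minus[OF K] poly_over_0[OF K] split: nat.splits)

lemma row_in:
  assumes "poly2_over K p" "poly2_over K q" "c \<in> K" "poly_over K A" "poly_over K B"
  shows "row ode g p q z0 k c A B \<in> K"
  using assms orbit_in[OF assms(1-3), of g z0 k]
  by (auto simp: row_def simp del: of_nat_add
      intro!: ev2_in poly2_over_vfield_funpow poly2_over_linear csubfield_diff[OF K] csubfield_mult[OF K]
        poly_in csubfield_of_nat[OF K])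

lemma pointwise_kernel:
  assumes pq: "poly2_over K p" "poly2_over K q" and c: "c \<in> K"
  obtains A B where "poly_over K A" "poly_over K B" "degree A \<le> N" "degree B \<le> N" "A \<noteq> 0 \<or> B \<noteq> 0"
    "\<And>k. k \<le> 2 * N \<Longrightarrow> row ode g p q z0 k c A B = 0"
proof -
  define J where "J = (UNIV :: bool set) \<times> {..N}"
  \<comment> \<open>The two components of the standard basis of pairs: the index
    \<open>(b', j)\<close> stands for the monomial of degree \<open>j\<close> in component
    \<open>b'\<close> and 0 in the other.\<close>
  define f where "f b = (\<lambda>(b', j). if b = b' then monom (1::complex) j else 0)" for b :: bool
  have fK: "poly_over K (f b j)" for b j
    by (auto simp: f_def split: prod.split intro: poly_over_monom[OF K] poly_over_0[OF K] csubfield_1[OF K])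
  have "\<exists>x. (\<forall>j\<in>J. x j \<in> K) \<and> (\<exists>j\<in>J. x j \<noteq> 0) \<and>
      (\<forall>k\<in>{..2 * N}. (\<Sum>j\<in>J. row ode g p q z0 k c (f True j) (f False j) * x j) = 0)"
    by (rule linear_system_nontrivial_solution[OF K])
      (auto simp: J_def card_cartesian_product intro!: row_in pq c fK)
  then obtain x where x: "\<forall>j\<in>J. x j \<in> K" "\<exists>j\<in>J. x j \<noteq> 0"
    "\<forall>k\<in>{..2 * N}. (\<Sum>j\<in>J. row ode g p q z0 k c (f True j) (f False j) * x j) = 0"
    by blast
  define A where "A b = (\<Sum>j\<in>J. smult (x j) (f b j))" for b
  have coeffA: "coeff (A b) i = x (b, i)" if "i \<le> N" for b i
  proof -
    have "coeff (A b) i = (\<Sum>j\<in>J. if j = (b, i) then x j else 0)"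
      unfolding A_def coeff_sum by (rule sum.cong) (auto simp: f_def coeff_monom split: if_splits)
    thus ?thesis using that by (simp add: J_def)
  qed
  have deg: "degree (A b) \<le> N" for b unfolding A_def
    by (intro degree_sum_le)
      (auto simp: J_def f_def split: if_splits intro!: order_trans[OF degree_smult_le] order_trans[OF degree_monom_le])
  have "poly_over K (A b)" for b
    unfolding poly_over_def
  proof
    fix i
    show "coeff (A b) i \<in> K"
    proof (cases "i \<le> N")
      case True
      thus ?thesis using coeffA[of i b] x(1) by (auto simp: J_def)
    next
      case False
      hence "coeff (A b) i = 0" using deg[of b] by (intro coeff_eq_0) auto
      thus ?thesis by (simp add: csubfield_0[OF K])
    qed
  qed
  moreover have "A True \<noteq> 0 \<or> A False \<noteq> 0"
  proof -
    obtain b i where "i \<le> N" "x (b, i) \<noteq> 0" using x(2) by (auto simp: J_def)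
    hence "A b \<noteq> 0" using coeffA[of i b] by auto
    thus ?thesis by (cases b) auto
  qed
  moreover have "row ode g p q z0 k c (A True) (A False) = 0" if "k \<le> 2 * N" for k
    using x(3) that unfolding A_def row_sum by (simp add: mult.commute)
  ultimately show thesis using deg by (intro that)
qed

text \<open>The rows are imposed at the integers up to \<open>D + rho ode M N\<close>, which exceeds
  in number their degree in \<open>c\<close>, and so hold identically. There are
  \<open>2 * (D + 1) * (N + 1)\<close> unknowns and
  \<open>(2 * N + 1) * (D + rho ode M N + 1)\<close> equations; the difference is
  \<open>D + 1 - (2 * N + 1) * rho ode M N\<close>, and the choice of \<open>D\<close> makes it
  1.\<close>

lemma generic_kernel:
  assumes pq: "poly2_over K p" "poly2_over K q"
    and M: "degree p \<le> M" "degree q \<le> M" "0 < g" "g \<le> M" and D: "D = (2 * N + 1) * rho ode M N"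
  obtains A B where "poly2_over K A" "poly2_over K B" "degree A \<le> D" "degree B \<le> D"
    "zdeg_le A N" "zdeg_le B N" "A \<noteq> 0 \<or> B \<noteq> 0"
    "\<And>k c. k \<le> 2 * N \<Longrightarrow> row ode g p q z0 k c (poly A [:c:]) (poly B [:c:]) = 0"
proof -
  define r where "r = rho ode M N"
  define J where "J = (UNIV :: bool set) \<times> {..D} \<times> {..N}"
  define I where "I = {..2 * N} \<times> {..D + r}"
  define f where "f b = (\<lambda>(b', l :: nat, j). if b = b' then monom (1::complex) j else 0)" for b :: bool
  define m where "m = (\<lambda>(k, i). \<lambda>(b, l, j). of_nat i ^ l *
      row ode g p q z0 k (of_nat i) (f True (b, l :: nat, j)) (f False (b, l, j)))"
  have fK: "poly_over K (f b j)" for b j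
    by (auto simp: f_def split: prod.split intro: poly_over_monom[OF K] poly_over_0[OF K] csubfield_1[OF K])
  have "m i j \<in> K" for i j
    unfolding m_def
    by (auto split: prod.splits intro!: csubfield_mult[OF K] csubfield_power[OF K] csubfield_of_nat[OF K] row_in pq fK)
  moreover have "card I < card J"
    by (simp add: I_def J_def card_cartesian_product D flip: r_def) (simp add: algebra_simps)
  moreover have "finite I" "finite J" by (simp_all add: I_def J_def)
  ultimately obtain x where x: "\<forall>j\<in>J. x j \<in> K" "\<exists>j\<in>J. x j \<noteq> 0" "\<forall>i\<in>I. (\<Sum>j\<in>J. m i j * x j) = 0"
    using linear_system_nontrivial_solution[OF K, of I J m] by blast
  define A where "A b = (\<Sum>l\<le>D. monom (\<Sum>j\<le>N. monom (x (b, l, j)) j) l)" for b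
  have coeffA: "coeff (A b) l = (if l \<le> D then (\<Sum>j\<le>N. monom (x (b, l, j)) j) else 0)" for b l
    unfolding A_def coeff_sum by (simp add: coeff_monom)
  have coeffA2: "coeff (coeff (A b) l) j = (if l \<le> D \<and> j \<le> N then x (b, l, j) else 0)" for b l j
    unfolding coeffA by (simp add: coeff_sum coeff_monom)
  have AK: "poly2_over K (A b)" for b
    using x(1) by (auto simp: poly2_over_def poly_over_def coeffA2 J_def csubfield_0[OF K])
  have degA: "degree (A b) \<le> D" for b by (rule degree_le) (simp add: coeffA)
  have zA: "zdeg_le (A b) N" for b
    unfolding zdeg_le_def by (intro allI degree_le) (simp add: coeffA2)
  have nz: "A True \<noteq> 0 \<or> A False \<noteq> 0"
  proof -
    obtain b l i where "i \<le> N" "l \<le> D" "x (b, l, i) \<noteq> 0" using x(2) by (auto simp: J_def)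
    hence "A b \<noteq> 0" using coeffA2[of b l i] by auto
    thus ?thesis by (cases b) auto
  qed
  have evA: "poly (A b) [:c:] = (\<Sum>j\<in>J. smult (x j * c ^ fst (snd j)) (f b j))" for b c
  proof -
    have smult_sum2: "smult s (sum F S) = (\<Sum>i\<in>S. smult s (F i))" for s and F :: "nat \<Rightarrow> complex poly" and S
      by (induction S rule: infinite_finite_induct) (simp_all add: smult_add_right)
    have "poly (A b) [:c:] = (\<Sum>l\<le>D. \<Sum>j\<le>N. smult (x (b, l, j) * c ^ l) (monom 1 j))"
      unfolding A_def poly_sum poly_monom
      by (simp add: poly_const_pow smult_sum2 smult_monom mult.commute)
    also have "\<dots> = (\<Sum>b'\<in>UNIV. \<Sum>l\<le>D. \<Sum>j\<le>N. smult (x (b', l, j) * c ^ l) (f b (b', l, j)))"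
      by (cases b) (simp_all add: UNIV_bool f_def)
    also have "\<dots> = (\<Sum>j\<in>J. smult (x j * c ^ fst (snd j)) (f b j))"
      unfolding J_def by (simp add: sum.cartesian_product case_prod_unfold)
    finally show ?thesis .
  qed
  have row_eq: "row ode g p q z0 k c (poly (A True) [:c:]) (poly (A False) [:c:]) =
      (\<Sum>j\<in>J. x j * c ^ fst (snd j) * row ode g p q z0 k c (f True j) (f False j))" for k c
    unfolding evA row_sum ..
  have "row ode g p q z0 k c (poly (A True) [:c:]) (poly (A False) [:c:]) = 0" if k: "k \<le> 2 * N" for k c
  proof (rule pf_eq_0[where ?z0.0 = 0 and x = c and f = "\<lambda>c. row ode g p q z0 k c (poly (A True) [:c:]) (poly (A False) [:c:])"])
    show "pf (D + r) (\<lambda>c. row ode g p q z0 k c (poly (A True) [:c:]) (poly (A False) [:c:]))"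
      unfolding r_def by (rule pf_row_family[OF M k degA degA])
    fix i assume "i \<le> D + r"
    hence "(\<Sum>j\<in>J. m (k, i) j * x j) = 0" using x(3) k by (auto simp: I_def)
    also have "(\<Sum>j\<in>J. m (k, i) j * x j) = (\<Sum>j\<in>J. x j * of_nat i ^ fst (snd j) *
        row ode g p q z0 k (of_nat i) (f True j) (f False j))"
      by (rule sum.cong) (auto simp: m_def)
    finally show "row ode g p q z0 k (of_nat (0 + i)) (poly (A True) [:of_nat (0 + i):])
        (poly (A False) [:of_nat (0 + i):]) = 0"
      unfolding row_eq by simp
  qed
  with AK degA zA nz show thesis by (intro that)
qed

end

section \<open>Taylor expansions at z0\<close>

context
  fixes z0 :: complex
begin

text \<open>The Taylor expansion of \<open>r\<close> at \<open>z0\<close>.\<close>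

definition germ :: "complex poly \<Rightarrow> complex fps" where
  "germ r = fps_of_poly (pcompose r [:z0, 1:])"

lemma germ_simps: "germ 0 = 0" "germ (r + s) = germ r + germ s" "germ (r * s) = germ r * germ s"
  "germ (- r) = - germ r" "germ (r - s) = germ r - germ s"
  by (simp_all add: germ_def pcompose_add pcompose_mult pcompose_uminus pcompose_diff
      fps_of_poly_add fps_of_poly_mult fps_of_poly_uminus fps_of_poly_diff)

lemma germ_power: "germ (r ^ n) = germ r ^ n"
  by (induction n) (simp_all add: germ_simps germ_def[of 1] pcompose_1)

lemma germ_eq_0: "germ r = 0 \<longleftrightarrow> r = 0"
  by (simp add: germ_def pcompose_eq_0_iff)

lemma germ_nth_0: "fps_nth (germ r) 0 = poly r z0"
  by (simp add: germ_def poly_pcompose flip: poly_0_coeff_0)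

lemma fps_deriv_germ: "fps_deriv (germ r) = germ (pderiv r)"
  by (simp add: germ_def pderiv_pcompose pderiv_pCons flip: fps_of_poly_pderiv)

text \<open>The expansion of \<open>G(z, \<phi>(z))\<close> at \<open>z0\<close>, where
  \<open>\<phi>\<close> is substituted for \<open>w\<close>.\<close>

definition gsubst :: "complex fps \<Rightarrow> complex poly poly \<Rightarrow> complex fps" where
  "gsubst \<phi> G = poly (map_poly germ G) \<phi>"

lemma gsubst_pCons [simp]: "gsubst \<phi> (pCons r G) = germ r + \<phi> * gsubst \<phi> G"
  by (simp add: gsubst_def map_poly_pCons germ_simps)

lemma gsubst_0 [simp]: "gsubst \<phi> 0 = 0"
  by (simp add: gsubst_def)

lemma gsubst_add: "gsubst \<phi> (G + H) = gsubst \<phi> G + gsubst \<phi> H"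
  by (induction G H rule: poly_induct2) (simp_all add: germ_simps algebra_simps)

lemma gsubst_smult: "gsubst \<phi> (smult r G) = germ r * gsubst \<phi> G"
  by (induction G) (simp_all add: germ_simps algebra_simps)

lemma gsubst_mult: "gsubst \<phi> (G * H) = gsubst \<phi> G * gsubst \<phi> H"
  by (induction G) (simp_all add: gsubst_add gsubst_smult germ_simps algebra_simps)

lemma fps_deriv_gsubst:
  "fps_deriv (gsubst \<phi> G) = gsubst \<phi> (map_poly pderiv G) + gsubst \<phi> (pderiv G) * fps_deriv \<phi>"
  by (induction G)
    (simp_all add: map_poly_pCons pderiv_pCons gsubst_add germ_simps fps_deriv_germ algebra_simps)

lemma gsubst_nth_0: "fps_nth (gsubst \<phi> G) 0 = ev2 G z0 (fps_nth \<phi> 0)"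
  by (induction G) (simp_all add: germ_nth_0 germ_simps)

lemma hpoly_germ: "degree p \<le> n \<Longrightarrow> hpoly germ n p \<phi> 1 = gsubst \<phi> p"
proof (induction p arbitrary: n)
  case (pCons r p)
  show ?case
  proof (cases n)
    case (Suc n')
    hence "degree p \<le> n'" using pCons.prems by (auto split: if_splits)
    thus ?thesis using pCons.IH Suc by (simp add: hpoly_Suc_pCons)
  qed (use pCons.prems in \<open>auto simp: hpoly_0 split: if_splits\<close>)
qed (simp add: hpoly_def germ_simps)

lemma germ_hpoly: "germ (hpoly (\<lambda>x. x) n p a b) = hpoly germ n p (germ a) (germ b)"
proof -
  have "germ (sum f A) = (\<Sum>i\<in>A. germ (f i))" for f :: "nat \<Rightarrow> complex poly" and A
    by (induction A rule: infinite_finite_induct) (simp_all add: germ_simps)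
  thus ?thesis by (simp add: hpoly_def germ_simps germ_power)
qed

text \<open>As \<open>Q\<close> is invertible, vanishing of the first coefficients of
  \<open>Q * fps_deriv h\<close> passes to \<open>fps_deriv h\<close> and so to \<open>h\<close>,
  apart from the constant term, which is the case \<open>k = 0\<close>.\<close>

lemma fps_vanishing:
  fixes Q h :: "complex fps"
  assumes Q: "fps_nth Q 0 \<noteq> 0"
    and "\<And>k. k \<le> n \<Longrightarrow> fps_nth (((\<lambda>h. Q * fps_deriv h) ^^ k) h) 0 = 0"
  shows "\<forall>i\<le>n. fps_nth h i = 0"
  using assms(2)
proof (induction n arbitrary: h)
  case 0
  from "0.prems"[of 0] show ?case by simp
next
  case (Suc n)
  let ?L = "\<lambda>h. Q * fps_deriv h"
  have van: "\<forall>i\<le>n. fps_nth (?L h) i = 0"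
  proof (rule Suc.IH)
    fix k assume "k \<le> n"
    thus "fps_nth ((?L ^^ k) (?L h)) 0 = 0"
      using Suc.prems[of "Suc k"] by (simp add: funpow_Suc_right del: funpow.simps)
  qed
  have inv: "fps_deriv h = inverse Q * ?L h"
    using inverse_mult_eq_1[OF Q] by (metis mult.assoc mult_1_left)
  have "fps_nth (fps_deriv h) i = 0" if "i \<le> n" for i
    using van that by (subst inv, subst fps_mult_nth, intro sum.neutral) simp
  hence "fps_nth h (Suc i) = 0" if "i \<le> n" for i
    using that by (simp del: of_nat_Suc)
  moreover have "fps_nth h 0 = 0" using Suc.prems[of 0] by simp
  ultimately show ?case by (metis Suc_le_mono not0_implies_Suc)
qed

end

section \<open>A solution is determined by its value at a regular point\<close>

context
  fixes p q u v :: "complex poly poly" and r :: "complex poly" and g N z0 :: nat and a b :: "complex poly"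
  assumes comb: "u * p + v * q = [:r:]" and dg: "degree p \<le> g" "degree q \<le> g"
    and good: "\<And>k. k \<le> 2 * N \<Longrightarrow> poly b (of_nat (z0 + k)) \<noteq> 0"
      "\<And>k. k \<le> 2 * N \<Longrightarrow> poly r (of_nat (z0 + k)) \<noteq> 0"
    and ab: "degree a \<le> N" "degree b \<le> N"
begin

text \<open>The nonzero value of \<open>r\<close> in the Bezout identity excludes the indeterminate
  form 0/0 at the points in question.\<close>

lemma no_common_zero: "k \<le> 2 * N \<Longrightarrow> ev2 p (of_nat (z0 + k)) x \<noteq> 0 \<or> ev2 q (of_nat (z0 + k)) x \<noteq> 0"
proof -
  assume k: "k \<le> 2 * N"
  have "ev2 (u * p + v * q) (of_nat (z0 + k)) x = poly r (of_nat (z0 + k))" unfolding comb by simp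
  thus ?thesis using good(2)[OF k] by auto
qed

lemma hpoly_affine:
  assumes "degree s \<le> g" "y \<noteq> 0"
  shows "hpoly (\<lambda>r. poly r z) g s x y = y ^ g * ev2 s z (x / y)"
  using hpoly_scale[of "\<lambda>r. poly r z" g s y "x / y" 1] assms by (simp add: hpoly_ev2)

text \<open>The orbit follows the solution in the projective line. The factor \<open>t\<close> must
  be nonzero, since a row scaled by 0 would carry no information.\<close>

lemma difference_orbit:
  assumes sol: "defect False g p q a b = 0" and k: "k \<le> 2 * N"
    and c: "c = poly a (of_nat z0) / poly b (of_nat z0)"
  shows "\<exists>t. t \<noteq> 0 \<and> orbit p q g z0 c k = (t * poly a (of_nat (z0 + k)), t * poly b (of_nat (z0 + k)))"
  using k
proof (induction k)
  case 0
  show ?case using good(1)[of 0] c by (intro exI[of _ "1 / poly b (of_nat z0)"]) auto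
next
  case (Suc k)
  then obtain t where t: "t \<noteq> 0"
    "orbit p q g z0 c k = (t * poly a (of_nat (z0 + k)), t * poly b (of_nat (z0 + k)))" by auto
  define z where "z = (of_nat (z0 + k) :: complex)"
  define P Q where "P = hpoly (\<lambda>r. poly r z) g p (poly a z) (poly b z)"
    and "Q = hpoly (\<lambda>r. poly r z) g q (poly a z) (poly b z)"
  have nz: "ev2 p z x \<noteq> 0 \<or> ev2 q z x \<noteq> 0" for x
    using no_common_zero[of k x] Suc.prems unfolding z_def by simp
  have z1: "of_nat (z0 + Suc k) = z + 1" by (simp add: z_def)
  have b: "poly b z \<noteq> 0" "poly b (z + 1) \<noteq> 0"
    using good(1)[of k] good(1)[of "Suc k", unfolded z1] Suc.prems by (simp_all add: z_def del: of_nat_add)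
  have "poly (defect False g p q a b) z = 0" using sol by simp
  hence eq: "poly a (z + 1) * Q = poly b (z + 1) * P"
    by (simp add: defect_def stepn_def stepd_def hpoly_eval_poly P_def Q_def poly_pcompose add.commute)
  \<comment> \<open>\<open>f\<close> has no pole at \<open>z + 1\<close>, so \<open>Q = 0\<close>
    would force \<open>P = 0\<close>, and numerator and denominator of \<open>R\<close> would vanish
    together.\<close>
  have "Q \<noteq> 0"
  proof
    assume "Q = 0"
    moreover from this eq b have "P = 0" by simp
    ultimately show False
      using nz b dg by (auto simp: P_def Q_def hpoly_affine)
  qed
  have "orbit p q g z0 c (Suc k) = (t ^ g * P, t ^ g * Q)"
    using t(2) by (simp add: hpoly_scale P_def Q_def z_def del: of_nat_add)
  moreover have "P = Q / poly b (z + 1) * poly a (z + 1)" using eq b by (simp add: field_simps)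
  ultimately show ?case unfolding z1
    using b t(1) \<open>Q \<noteq> 0\<close> by (intro exI[of _ "t ^ g * (Q / poly b (z + 1))"]) simp
qed

lemma row_determines:
  assumes sol: "defect ode g p q a b = 0"
    and c: "c = poly a (of_nat z0) / poly b (of_nat z0)"
    and AB: "degree A \<le> N" "degree B \<le> N"
    and rows: "\<And>k. k \<le> 2 * N \<Longrightarrow> row ode g p q z0 k c A B = 0"
  shows "a * B = b * A"
proof -
  \<comment> \<open>\<open>F\<close> has degree at most \<open>2 * N\<close>, hence
    \<open>2 * N + 1\<close> conditions kill it: zeros at that many integers, or a zero of order
    \<open>2 * N + 1\<close> at \<open>z0\<close>.\<close>
  define F where "F = b * A - a * B"
  have deg: "degree F \<le> 2 * N"
    unfolding F_def mult_2 by (intro degree_diff_le order_trans[OF degree_mult_le] add_mono ab AB)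
  have "F = 0"
  proof (cases ode)
    case False
    have "poly F (of_nat (z0 + k)) = 0" if k: "k \<le> 2 * N" for k
    proof -
      obtain t where t: "t \<noteq> 0"
        "orbit p q g z0 c k = (t * poly a (of_nat (z0 + k)), t * poly b (of_nat (z0 + k)))"
        using difference_orbit[OF sol[unfolded False[THEN eq_False[THEN iffD2]]] k c] by blast
      have "row ode g p q z0 k c A B = t * poly F (of_nat (z0 + k))"
        using False t(2) by (simp add: row_def F_def algebra_simps del: of_nat_add)
      thus ?thesis using rows[OF k] t(1) by simp
    qed
    thus ?thesis by (rule poly_eq_0_nat[OF deg])
  next
    case True
    define z where "z = (of_nat z0 :: complex)"
    let ?T = "germ z"
    have b0: "poly b z \<noteq> 0" using good(1)[of 0] by (simp add: z_def)
    \<comment> \<open>The expansion of \<open>a / b\<close>, a power series because \<open>b\<close>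
      does not vanish at \<open>z0\<close>.\<close>
    define \<phi> where "\<phi> = ?T a * inverse (?T b)"
    have Tb0: "?T b \<noteq> 0" using b0 by (auto simp: germ_eq_0)
    have \<phi>: "?T a = ?T b * \<phi>"
      using inverse_mult_eq_1[of "?T b"] b0 by (simp add: \<phi>_def germ_nth_0 mult_ac)
    have \<phi>0: "fps_nth \<phi> 0 = c"
      using b0 c by (simp add: \<phi>_def germ_nth_0 divide_inverse flip: z_def)
    have "fps_deriv (?T a) = fps_deriv (?T b * \<phi>)" using \<phi> by simp
    hence \<phi>': "?T (pderiv a) = ?T (pderiv b) * \<phi> + ?T b * fps_deriv \<phi>"
      by (simp add: fps_deriv_germ)
    have hp: "?T (hpoly (\<lambda>x. x) g s a b) = ?T b ^ g * gsubst z \<phi> s" if "degree s \<le> g" for s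
      using hpoly_scale[of ?T g s "?T b" \<phi> 1] that by (simp add: germ_hpoly \<phi> hpoly_germ)
    have "?T (defect ode g p q a b) = ?T b ^ g * (?T b ^ 2 *
        (fps_deriv \<phi> * gsubst z \<phi> q - gsubst z \<phi> p))"
      using True by (simp add: defect_def stepn_def stepd_def germ_simps germ_power hp dg \<phi>')
        (simp add: \<phi> algebra_simps power2_eq_square)
    \<comment> \<open>The differential equation for the expansion, with the denominator
      \<open>q\<close> cleared.\<close>
    hence flow: "fps_deriv \<phi> * gsubst z \<phi> q = gsubst z \<phi> p"
      using sol Tb0 by (simp add: germ_simps)
    define Q where "Q = gsubst z \<phi> q"
    have Q0: "fps_nth Q 0 \<noteq> 0"
    proof
      assume "fps_nth Q 0 = 0"
      moreover from this have "fps_nth (gsubst z \<phi> p) 0 = 0" by (simp flip: flow Q_def)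
      ultimately show False
        using no_common_zero[of 0 c] by (simp add: Q_def gsubst_nth_0 \<phi>0 flip: z_def)
    qed
    \<comment> \<open>Chain rule along the solution: substitution of \<open>\<phi>\<close> carries
      \<open>vfield\<close> to \<open>Q\<close> times the derivation. The rows are thus the iterates
      required by \<open>fps_vanishing\<close>.\<close>
    have step: "gsubst z \<phi> (vfield p q G) = Q * fps_deriv (gsubst z \<phi> G)" for G
      unfolding vfield_def gsubst_add gsubst_mult fps_deriv_gsubst flow[symmetric] Q_def
      by (simp add: algebra_simps)
    have iter: "gsubst z \<phi> ((vfield p q ^^ k) G) = ((\<lambda>h. Q * fps_deriv h) ^^ k) (gsubst z \<phi> G)" for G k
      by (induction k) (simp_all add: step)
    have "\<forall>i\<le>2 * N. fps_nth (gsubst z \<phi> [:A, - B:]) i = 0"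
    proof (rule fps_vanishing[OF Q0])
      fix k assume k: "k \<le> 2 * N"
      show "fps_nth (((\<lambda>h. Q * fps_deriv h) ^^ k) (gsubst z \<phi> [:A, - B:])) 0 = 0"
        unfolding iter[symmetric] using rows[OF k] True
        by (simp add: row_def gsubst_nth_0 \<phi>0 z_def del: gsubst_pCons)
    qed
    moreover have TF: "?T F = ?T b * gsubst z \<phi> [:A, - B:]"
      by (simp add: F_def germ_simps \<phi> algebra_simps)
    ultimately have "fps_nth (?T F) i = 0" if "i \<le> 2 * N" for i
      using that unfolding TF fps_mult_nth by simp
    hence "coeff (pcompose F [:z, 1:]) i = 0" if "i \<le> 2 * N" for i
      using that by (simp add: germ_def)
    moreover have "degree (pcompose F [:z, 1:]) \<le> 2 * N" using deg by (simp add: degree_pcompose)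
    ultimately have "pcompose F [:z, 1:] = 0"
      by (intro poly_eqI) (metis coeff_0 coeff_eq_0 le_trans not_le)
    thus ?thesis by (simp add: pcompose_eq_0_iff)
  qed
  thus ?thesis by (simp add: F_def)
qed

end

section \<open>Finiteness of the set of solutions\<close>

text \<open>The equation for a pair with denominators cleared; the middle conjunct is the guard of
  \<open>eq_subst\<close>, which clearing would otherwise lose.\<close>

definition is_sol :: "bool \<Rightarrow> nat \<Rightarrow> complex poly poly \<Rightarrow> complex poly poly \<Rightarrow> complex poly \<Rightarrow> complex poly \<Rightarrow> bool" where
  "is_sol ode g p q a b \<longleftrightarrow> b \<noteq> 0 \<and> hpoly (\<lambda>x. x) g q a b \<noteq> 0 \<and> defect ode g p q a b = 0"

lemma defect_scale:
  "defect ode g p q (c * a) (c * b) =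
     (if ode then c ^ 2 else pcompose c [:1, 1:]) * c ^ g * defect ode g p q a b"
  unfolding defect_def hpoly_scale
  by (cases ode) (simp_all add: stepn_def stepd_def pderiv_mult pcompose_mult
      algebra_simps power2_eq_square)

text \<open>Both pairs have the common multiple \<open>(B * a, B * b) = (b * A, b * B)\<close>, and
  scaling changes defect and denominator by nonzero factors only. Neither pair has to be
  coprime.\<close>

lemma is_sol_proportional:
  assumes sol: "is_sol ode g p q a b" and pr: "a * B = b * A" and B: "B \<noteq> 0"
  shows "is_sol ode g p q A B"
proof -
  have b: "b \<noteq> 0" "hpoly (\<lambda>x. x) g q a b \<noteq> 0" "defect ode g p q a b = 0"
    using sol by (auto simp: is_sol_def)
  have eq: "hpoly (\<lambda>x. x) g q (B * a) (B * b) = hpoly (\<lambda>x. x) g q (b * A) (b * B)"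
    "defect ode g p q (B * a) (B * b) = defect ode g p q (b * A) (b * B)"
    using pr by (simp_all add: mult.commute)
  have "defect ode g p q A B = 0"
    using eq(2) b unfolding defect_scale by (auto simp: pcompose_eq_0_iff split: if_splits)
  moreover have "hpoly (\<lambda>x. x) g q A B \<noteq> 0"
    using eq(1) b B unfolding hpoly_scale by auto
  ultimately show ?thesis using B by (simp add: is_sol_def)
qed

definition step :: "bool \<Rightarrow> ratfun \<Rightarrow> ratfun" where
  "step ode = (if ode then ratfun_deriv else shift)"

definition solutions :: "bool \<Rightarrow> ratfun2 \<Rightarrow> ratfun set" where
  "solutions ode R = {f. eq_subst (step ode f) R f}"

lemma step_Fract: "b \<noteq> 0 \<Longrightarrow> step ode (Fract a b) = Fract (stepn ode a b) (stepd ode b)"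
  by (simp add: step_def stepn_def stepd_def shift_Fract ratfun_deriv_Fract)

lemma poly_fract_poly_Fract:
  fixes a b :: "complex poly"
  assumes "degree p \<le> n" "b \<noteq> 0"
  shows "poly (fract_poly p) (Fract a b) = Fract (hpoly (\<lambda>x. x) n p a b) (b ^ n)"
  using assms(1)
proof (induction p arbitrary: n)
  case 0
  show ?case using assms(2) by (simp add: hpoly_def Fract_of_int_eq eq_fract Zero_fract_def)
next
  case (pCons r p)
  show ?case
  proof (cases n)
    case 0
    hence "p = 0" using pCons.prems by (auto split: if_splits)
    thus ?thesis using 0 by (simp add: hpoly_0 map_poly_pCons) (simp add: to_fract_def)
  next
    case (Suc n')
    hence "degree p \<le> n'" using pCons.prems by (auto split: if_splits)
    with pCons.IH[OF this] show ?thesis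
      using assms(2) Suc by (simp add: hpoly_Suc_pCons map_poly_pCons)
        (simp add: to_fract_def algebra_simps)
  qed
qed

text \<open>In the combination for \<open>k = 0\<close>, a vanishing \<open>r\<close> would make
  \<open>q\<close> divide \<open>u\<close> and \<open>p\<close> divide \<open>v\<close>, which is
  incompatible with the degrees of \<open>u\<close> and \<open>v\<close>.\<close>

lemma coprime_imp_rcoprime:
  assumes "coprime p q" "q \<noteq> 0"
  shows "rcoprime p q"
proof (cases "max (degree p) (degree q) = 0")
  case True
  then obtain c where "q = [:c:]" by (metis degree_eq_zeroE max_nat.eq_neutr_iff)
  thus ?thesis using assms(2) unfolding rcoprime_def
    by (intro exI[of _ 0] exI[of _ 1] exI[of _ c]) auto
next
  case False
  define d where "d = max (degree p) (degree q)"
  obtain \<delta> where z: "zdeg_le p \<delta>" "zdeg_le q \<delta>" using zdeg_le_exists2 by blast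
  have "csubfield UNIV" by (simp add: csubfield_def)
  then obtain u v r where uv: "degree u < d" "degree v < d" "u \<noteq> 0 \<or> v \<noteq> 0" "u * p + v * q = monom r 0"
    by (rule sylvester_combination[of UNIV p q d \<delta> 0])
      (use False z in \<open>auto simp: d_def poly2_over_def poly_over_def\<close>)
  have "r \<noteq> 0"
  proof
    assume "r = 0"
    hence e: "u * p = - v * q" using uv(4) by (simp add: eq_neg_iff_add_eq_0)
    hence "q dvd u * p" "p dvd - v * q" by (metis dvd_triv_right)+
    hence "q dvd u" "p dvd v"
      using assms(1) by (simp_all add: coprime_dvd_mult_left_iff coprime_commute)
    hence uvd: "u = 0 \<or> degree q < d" "v = 0 \<or> degree p < d"
      using uv(1,2) dvd_imp_degree_le by (metis le_less_trans)+
    hence "u = 0 \<or> v = 0" by (auto simp: d_def)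
    thus False using e uv(1,2,3) uvd assms(2) False by (auto simp: d_def)
  qed
  thus ?thesis using uv(4) unfolding rcoprime_def monom_0 by blast
qed

lemma num2_den2: "coprime (num2 R) (den2 R)" "den2 R \<noteq> 0" "Fract (num2 R) (den2 R) = R"
  using coprime_quot_of_fract[of R] snd_quot_of_fract_nonzero[of R] quot_to_fract_quot_of_fract[of R]
  by (auto simp: num2_def den2_def quot_to_fract_def case_prod_unfold)

lemma rcoprime_num2_den2: "rcoprime (num2 R) (den2 R)"
  by (intro coprime_imp_rcoprime num2_den2)

text \<open>Makes any representation \<open>p / q\<close> with a Bezout identity as good as the
  reduced one: in either representation numerator and denominator cannot both vanish at
  \<open>f\<close>, so the two denominators vanish at the same \<open>f\<close>.\<close>

lemma solutions_iff:
  assumes rep: "p * den2 R = num2 R * q" and rc: "rcoprime p q"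
    and g: "degree p \<le> g" "degree q \<le> g" and b: "b \<noteq> 0"
  shows "Fract a b \<in> solutions ode R \<longleftrightarrow> is_sol ode g p q a b"
proof -
  define e where "e P = poly (fract_poly P) (Fract a b)" for P :: "complex poly poly"
  have e_mult: "e (P * Q) = e P * e Q" and e_add: "e (P + Q) = e P + e Q" for P Q
    by (simp_all add: e_def fract_poly_mult fract_poly_add)
  have nz: "e P \<noteq> 0 \<or> e Q \<noteq> 0" if PQ: "rcoprime P Q" for P Q
  proof -
    obtain u v r where "r \<noteq> 0" "u * P + v * Q = [:r:]" using PQ by (auto simp: rcoprime_def)
    hence "e u * e P + e v * e Q = to_fract r" "r \<noteq> 0"
      by (simp_all flip: e_mult e_add) (simp add: e_def map_poly_pCons)
    thus ?thesis by auto
  qed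
  have cross: "e p * e (den2 R) = e (num2 R) * e q" by (simp add: rep flip: e_mult)
  have iff: "e (den2 R) = 0 \<longleftrightarrow> e q = 0"
    using cross nz[OF rc] nz[OF rcoprime_num2_den2[of R]] by auto
  define P Q where "P = hpoly (\<lambda>x. x) g p a b" and "Q = hpoly (\<lambda>x. x) g q a b"
  have ev: "e p = Fract P (b ^ g)" "e q = Fract Q (b ^ g)"
    using b g by (simp_all add: e_def P_def Q_def poly_fract_poly_Fract)
  have "Fract a b \<in> solutions ode R \<longleftrightarrow>
      e (den2 R) \<noteq> 0 \<and> step ode (Fract a b) = e (num2 R) / e (den2 R)"
    by (simp add: solutions_def eq_subst_def e_def)
  also have "\<dots> \<longleftrightarrow> e q \<noteq> 0 \<and> step ode (Fract a b) = e p / e q"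
    using cross by (auto simp: iff frac_eq_eq)
  also have "\<dots> \<longleftrightarrow> is_sol ode g p q a b"
  proof (cases "Q = 0")
    case False
    have "e p / e q = Fract P Q" using False b by (simp add: ev eq_fract)
    moreover have "e q \<noteq> 0" using False b by (simp add: ev Zero_fract_def eq_fract)
    ultimately show ?thesis
      using False b stepd_nonzero[OF b, of ode]
      by (auto simp: step_Fract eq_fract is_sol_def defect_def mult.commute simp flip: P_def Q_def)
  qed (use b in \<open>simp add: ev is_sol_def Zero_fract_def eq_fract flip: Q_def\<close>)
  finally show ?thesis .
qed

text \<open>The product of the \<open>2 * N + 1\<close> translates of \<open>F\<close> has at most
  \<open>(2 * N + 1) * m\<close> roots, one fewer than the starting points available.\<close>

lemma good_start_exists:
  fixes F :: "complex poly"
  assumes "F \<noteq> 0" "degree F \<le> m"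
  obtains z0 where "z0 \<le> (2 * N + 1) * m" "\<And>k. k \<le> 2 * N \<Longrightarrow> poly F (of_nat (z0 + k)) \<noteq> 0"
proof -
  define P where "P = (\<Prod>k\<le>2 * N. pcompose F [:of_nat k, 1:])"
  have "P \<noteq> 0" using assms(1) by (simp add: P_def pcompose_eq_0_iff)
  moreover have "degree P \<le> (2 * N + 1) * m"
  proof -
    have "degree P \<le> (\<Sum>k\<le>2 * N. degree (pcompose F [:of_nat k, 1:]))"
      unfolding P_def using degree_prod_sum_le[of "{..2 * N}" "\<lambda>k. pcompose F [:of_nat k, 1:]"] by simp
    also have "\<dots> \<le> (\<Sum>k\<le>2 * N. m)" using assms(2) by (intro sum_mono) (simp add: degree_pcompose)
    finally show ?thesis by simp
  qed
  ultimately obtain z0 where "z0 \<le> (2 * N + 1) * m" "poly P (of_nat z0) \<noteq> 0"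
    using poly_eq_0_nat[of P _ 0] by force
  thus thesis by (intro that[of z0]) (auto simp: P_def poly_prod poly_pcompose add.commute)
qed

lemma ev2_nonzero:
  assumes "A \<noteq> 0"
  obtains z x :: nat where "ev2 A (of_nat z) (of_nat x) \<noteq> 0"
proof -
  have "\<exists>x::nat. poly A [:of_nat x:] \<noteq> 0"
  proof (rule ccontr)
    assume "\<not> ?thesis"
    hence "range (\<lambda>x::nat. [:of_nat x :: complex:]) \<subseteq> {y. poly A y = 0}" by auto
    moreover have "infinite (range (\<lambda>x::nat. [:of_nat x :: complex:]))"
      by (subst finite_image_iff) (auto intro: injI)
    ultimately show False using poly_roots_finite[OF assms] finite_subset by blast
  qed
  then obtain x :: nat where x: "poly A [:of_nat x:] \<noteq> 0" ..
  then obtain z :: nat where "poly (poly A [:of_nat x:]) (of_nat z) \<noteq> 0"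
    using poly_eq_0_nat[of "poly A [:of_nat x:]" _ 0] by force
  thus thesis by (intro that) (simp add: ev2_def)
qed

text \<open>
  \<open>headf\<close> is a linear combination of \<open>A\<close> and \<open>B\<close>: where it does not vanish, \<open>(A, B)\<close> is not zero.
\<close>

definition headf :: "complex poly poly \<Rightarrow> complex poly poly \<Rightarrow> complex \<Rightarrow> complex \<Rightarrow> complex \<Rightarrow> complex" where
  "headf A B s z x = ev2 A z x + s * ev2 B z x"

definition defectf :: "bool \<Rightarrow> nat \<Rightarrow> complex poly poly \<Rightarrow> complex poly poly \<Rightarrow>
    complex poly poly \<Rightarrow> complex poly poly \<Rightarrow> complex \<Rightarrow> complex \<Rightarrow> complex" where
  "defectf ode g p q A B z x = poly (defect ode g p q (poly A [:x:]) (poly B [:x:])) z"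

lemma defectf_eq:
  "defectf ode g p q A B z x =
     (if ode then ev2 (map_poly pderiv A) z x * ev2 B z x - ev2 A z x * ev2 (map_poly pderiv B) z x
      else ev2 A (z + 1) x) * hpoly (\<lambda>r. poly r z) g q (ev2 A z x) (ev2 B z x) -
     (if ode then ev2 B z x ^ 2 else ev2 B (z + 1) x) * hpoly (\<lambda>r. poly r z) g p (ev2 A z x) (ev2 B z x)"
  by (simp add: defectf_def defect_def stepn_def stepd_def ev2_def pderiv_eval hpoly_eval_poly
      poly_pcompose poly_power add.commute)

lemma pf_headf: "degree A \<le> D \<Longrightarrow> degree B \<le> D \<Longrightarrow> pf D (headf A B s z)"
  unfolding headf_def using pf_add[OF pf_ev2 pf_mult[OF pf_const[of 0] pf_ev2]] by simp

lemma pf_defectf: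
  assumes "degree A \<le> D" "degree B \<le> D"
  shows "pf ((g + 2) * D) (defectf ode g p q A B z)"
proof -
  have D: "degree (map_poly pderiv C) \<le> D" if "degree C \<le> D" for C
    using map_poly_degree_leq[of pderiv C] that by linarith
  have 1: "pf (2 * D) (\<lambda>x. if ode then ev2 (map_poly pderiv A) z x * ev2 B z x - ev2 A z x * ev2 (map_poly pderiv B) z x
      else ev2 A (z + 1) x)"
  proof (cases ode)
    case True
    thus ?thesis unfolding mult_2 if_P[OF True] by (intro pf_diff pf_mult pf_ev2 D assms)
  qed (use assms in \<open>auto intro!: pf_mono[OF pf_ev2]\<close>)
  have 2: "pf (2 * D) (\<lambda>x. if ode then ev2 B z x ^ 2 else ev2 B (z + 1) x)"
    using assms by (cases ode) (auto intro!: pf_power pf_ev2 pf_mono[OF pf_ev2])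
  have 3: "pf (g * D) (\<lambda>x. hpoly (\<lambda>r. poly r z) g s (ev2 A z x) (ev2 B z x))" for s
    by (intro pf_hpoly pf_ev2 assms)
  have e: "(g + 2) * D = 2 * D + g * D" by (simp add: algebra_simps)
  show ?thesis
    unfolding defectf_eq[abs_def] e by (intro pf_diff pf_mult 1 2 3)
qed

lemma headf_nonzero:
  assumes "A \<noteq> 0 \<or> B \<noteq> 0"
  obtains s z x :: nat where "headf A B (of_nat s) (of_nat z) (of_nat x) \<noteq> 0"
proof (cases "A = 0")
  case True
  with assms obtain z x :: nat where "ev2 B (of_nat z) (of_nat x) \<noteq> 0" using ev2_nonzero by blast
  thus ?thesis using True by (intro that[of 1 z x]) (simp add: headf_def)
next
  case False
  then obtain z x :: nat where "ev2 A (of_nat z) (of_nat x) \<noteq> 0" using ev2_nonzero by blast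
  thus ?thesis by (intro that[of 0 z x]) (simp add: headf_def)
qed

text \<open>The two functions may be nonzero at different points: the product of two nonzero
  polynomials is nonzero, and so it is nonzero at some integer.\<close>

lemma pf_nonzero_mult:
  assumes "pf m f" "pf n h" "f x \<noteq> 0" "h y \<noteq> 0"
  shows "\<exists>z::nat. f (of_nat z) * h (of_nat z) \<noteq> 0"
proof -
  obtain P Q where PQ: "\<And>x. f x = poly P x" "\<And>x. h x = poly Q x"
    using assms(1,2) by (auto simp: pf_def)
  hence "P * Q \<noteq> 0" using assms(3,4) by auto
  then obtain z :: nat where "poly (P * Q) (of_nat z) \<noteq> 0" using poly_eq_0_nat[of "P * Q" _ 0] by force
  thus ?thesis using PQ by auto
qed

text \<open>A defect vanishing at all integer points vanishes identically in \<open>z\<close> and in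
  the parameter, and then the quotient does not depend on the parameter.\<close>

lemma defectf_dichotomy:
  assumes "rcoprime p q" "edeg ode < max (degree p) (degree q)" "degree p \<le> g" "degree q \<le> g"
  shows "(\<exists>z x :: nat. defectf ode g p q A B (of_nat z) (of_nat x) \<noteq> 0) \<or>
    (\<forall>c c'. poly A [:c:] * poly B [:c':] = poly B [:c:] * poly A [:c':])"
proof (cases "\<exists>z x :: nat. defectf ode g p q A B (of_nat z) (of_nat x) \<noteq> 0")
  case False
  hence 0: "defectf ode g p q A B (of_nat z) (of_nat x) = 0" for z x :: nat by blast
  define D where "D = max (degree A) (degree B)"
  have "defectf ode g p q A B (of_nat z) c = 0" for z :: nat and c
    by (rule pf_eq_0[OF pf_defectf[of A D B g ode p q], where ?z0.0 = 0]) (auto simp: 0 D_def)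
  hence "poly (defect ode g p q (poly A [:c:]) (poly B [:c:])) (of_nat (0 + z)) = 0" for z :: nat and c
    by (simp add: defectf_def)
  hence sol: "defect ode g p q (poly A [:c:]) (poly B [:c:]) = 0" for c
    by (rule poly_eq_0_nat[OF order_refl])
  have "max (degree p) (degree q) \<le> g" using assms(3,4) by simp
  from family_constant[OF assms(1) refl assms(2) this sol] show ?thesis by blast
qed blast

lemma proportional_Fract:
  fixes a b A B :: "complex poly"
  assumes "a * B = b * A" "b \<noteq> 0" "A \<noteq> 0 \<or> B \<noteq> 0"
  shows "B \<noteq> 0" "Fract a b = Fract A B"
proof -
  show "B \<noteq> 0" using assms by auto
  thus "Fract a b = Fract A B" using assms by (simp add: eq_fract mult.commute)
qed

lemma constant_family_proportional:
  fixes a b A B A' B' :: "complex poly"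
  assumes "a * B = b * A" "b \<noteq> 0" "A \<noteq> 0 \<or> B \<noteq> 0" "A * B' = B * A'"
  shows "a * B' = b * A'"
proof -
  have B: "B \<noteq> 0" using assms by auto
  have "B * (a * B') = B * (b * A')" using assms(1,4) by algebra
  thus ?thesis using B by simp
qed

section \<open>Counting the solutions\<close>

definition fnum :: "ratfun \<Rightarrow> complex poly" where "fnum f = fst (quot_of_fract f)"
definition fden :: "ratfun \<Rightarrow> complex poly" where "fden f = snd (quot_of_fract f)"

lemma fnum_fden: "coprime (fnum f) (fden f)" "fden f \<noteq> 0" "Fract (fnum f) (fden f) = f"
  using coprime_quot_of_fract[of f] snd_quot_of_fract_nonzero[of f] quot_to_fract_quot_of_fract[of f]
  by (auto simp: fnum_def fden_def quot_to_fract_def case_prod_unfold)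

definition fval :: "nat \<Rightarrow> ratfun \<Rightarrow> complex" where
  "fval z0 f = poly (fnum f) (of_nat z0) / poly (fden f) (of_nat z0)"

text \<open>\<open>Nb M\<close> simplifies \<open>(6 * d + 2) * \<delta>\<close> for
  \<open>1 \<le> d \<le> M\<close> and \<open>\<delta> \<le> M\<close>. In \<open>Zb\<close>, the
  second factor bounds the degree of the denominator of \<open>f\<close> times the Bezout constant
  \<open>r\<close>, and the first counts the points that must avoid its roots.\<close>

definition Nb :: "nat \<Rightarrow> nat" where "Nb M = 8 * M * M"
definition Zb :: "nat \<Rightarrow> nat" where "Zb M = (2 * Nb M + 1) * (Nb M + (2 * M + 1) * M)"

context
  fixes ode :: bool and R :: ratfun2 and p q :: "complex poly poly" and g M :: nat
  assumes rep: "p * den2 R = num2 R * q" and rc: "rcoprime p q"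
    and dM: "edeg ode < max (degree p) (degree q)" and g: "degree p \<le> g" "degree q \<le> g" "g \<le> M"
    and z: "zdeg_le p M" "zdeg_le q M"
begin

lemma solution_is_sol: "f \<in> solutions ode R \<longleftrightarrow> is_sol ode g p q (fnum f) (fden f)"
  using solutions_iff[OF rep rc g(1,2) fnum_fden(2)[of f], of "fnum f" ode] by (simp add: fnum_fden)

lemma solution_degree:
  assumes "f \<in> solutions ode R"
  shows "degree (fnum f) \<le> Nb M" "degree (fden f) \<le> Nb M"
proof -
  define d where "d = max (degree p) (degree q)"
  have "max (degree (fnum f)) (degree (fden f)) \<le> (6 * d + 2) * M"
    using assms g fnum_fden(1,2)[of f] unfolding solution_is_sol
    by (intro solution_degree_le[OF rc d_def]) (auto simp: d_def dM is_sol_def z)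
  also have "\<dots> \<le> Nb M"
  proof -
    have "1 \<le> d" "d \<le> M" using dM g by (auto simp: d_def)
    hence "6 * d + 2 \<le> 8 * M" by linarith
    thus ?thesis unfolding Nb_def by (rule mult_le_mono1)
  qed
  finally show "degree (fnum f) \<le> Nb M" "degree (fden f) \<le> Nb M" by auto
qed

text \<open>A start \<open>z0\<close> is admissible if \<open>f\<close> is finite and the equation regular at \<open>z0, ..., z0 + 2N\<close>.\<close>

definition admissible :: "nat \<Rightarrow> ratfun \<Rightarrow> bool" where
  "admissible z0 f \<longleftrightarrow> f \<in> solutions ode R \<and> (\<exists>u v r. u * p + v * q = [:r:] \<and>
     (\<forall>k\<le>2 * Nb M. poly (fden f) (of_nat (z0 + k)) \<noteq> 0 \<and> poly r (of_nat (z0 + k)) \<noteq> 0))"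

lemma admissible_start:
  assumes f: "f \<in> solutions ode R"
  obtains z0 where "z0 \<le> Zb M" "admissible z0 f"
proof -
  define d where "d = max (degree p) (degree q)"
  have d0: "0 < 2 * d" "d \<le> M" using dM g by (auto simp: d_def)
  obtain u v r where uvr: "u * p + v * q = monom r 0" "r \<noteq> 0" "degree r \<le> (2 * d + 1) * M"
    by (rule rcoprime_combination[OF rc d_def z d0(1)]) (rule that)
  have "degree r \<le> (2 * M + 1) * M"
    using uvr(3) d0(2) by (meson add_le_mono1 mult_le_mono1 mult_le_mono2 order_trans)
  hence dg: "degree (fden f * r) \<le> Nb M + (2 * M + 1) * M"
    using solution_degree(2)[OF f] by (intro order_trans[OF degree_mult_le] add_mono)
  have nz: "fden f * r \<noteq> 0" using fnum_fden(2)[of f] uvr(2) by simp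
  obtain z0 where z0: "z0 \<le> Zb M"
    "\<And>k. k \<le> 2 * Nb M \<Longrightarrow> poly (fden f * r) (of_nat (z0 + k)) \<noteq> 0"
    by (rule good_start_exists[OF nz dg, of "Nb M", folded Zb_def]) (rule that)
  have "admissible z0 f"
    unfolding admissible_def using f uvr(1) z0(2)
    by (intro conjI exI[of _ u] exI[of _ v] exI[of _ r]) (auto simp: monom_0)
  with z0(1) show thesis by (rule that)
qed

lemma admissible_determined:
  assumes f: "admissible z0 f" and AB: "degree A \<le> Nb M" "degree B \<le> Nb M"
    and rows: "\<And>k. k \<le> 2 * Nb M \<Longrightarrow> row ode g p q z0 k (fval z0 f) A B = 0"
  shows "fnum f * B = fden f * A"
proof -
  obtain u v r where uvr: "f \<in> solutions ode R" "u * p + v * q = [:r:]"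
    "\<And>k. k \<le> 2 * Nb M \<Longrightarrow> poly (fden f) (of_nat (z0 + k)) \<noteq> 0"
    "\<And>k. k \<le> 2 * Nb M \<Longrightarrow> poly r (of_nat (z0 + k)) \<noteq> 0"
    using f unfolding admissible_def by blast
  show ?thesis
    by (rule row_determines[OF uvr(2) g(1,2) uvr(3,4) solution_degree[OF uvr(1)] _ fval_def AB rows])
      (use uvr(1) in \<open>auto simp: solution_is_sol is_sol_def\<close>)
qed

text \<open>The value at \<open>z0\<close> separates the admissible solutions, so roots are counted:
  \<open>D\<close> from the head, at most \<open>(M + 2) * D\<close> from the defect, and one more
  candidate in case the family is constant.\<close>

lemma card_admissible:
  defines "D \<equiv> (2 * Nb M + 1) * rho ode M (Nb M)"
  shows "finite {f. admissible z0 f} \<and> card {f. admissible z0 f} \<le> (M + 3) * D + 1"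
proof -
  define S where "S = {f. admissible z0 f}"
  have UNIV: "csubfield UNIV" "\<And>P. poly_over UNIV P" "\<And>P. poly2_over UNIV P"
    by (auto simp: csubfield_def poly_over_def poly2_over_def)
  have g0: "0 < g" using dM g by auto
  obtain A B where AB: "degree A \<le> D" "degree B \<le> D" "zdeg_le A (Nb M)" "zdeg_le B (Nb M)" "A \<noteq> 0 \<or> B \<noteq> 0"
    "\<And>k c. k \<le> 2 * Nb M \<Longrightarrow> row ode g p q z0 k c (poly A [:c:]) (poly B [:c:]) = 0"
    by (rule generic_kernel[OF UNIV(1,3,3) order_trans[OF g(1,3)] order_trans[OF g(2,3)] g0 g(3),
          of D "Nb M" ode z0]) (use D_def in simp, rule that)
  have AB_pr: "fnum f * poly B [:fval z0 f:] = fden f * poly A [:fval z0 f:]" if "f \<in> S" for f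
    using that AB(6) by (intro admissible_determined) (auto simp: S_def degree_eval_zdeg AB)
  obtain s z2 x2 :: nat where h: "headf A B (of_nat s) (of_nat z2) (of_nat x2) \<noteq> 0"
    using headf_nonzero[OF AB(5)] .
  let ?h = "headf A B (of_nat s) (of_nat z2)"
  have pfh: "pf D ?h" by (intro pf_headf AB)
  have headf_nz: "poly A [:x:] \<noteq> 0 \<or> poly B [:x:] \<noteq> 0" if "?h x \<noteq> 0" for x
    using that by (auto simp: headf_def ev2_def)
  \<comment> \<open>Solutions with the same value obey the same linear conditions; one nonzero pair
    satisfying these conditions therefore represents both.\<close>
  have inj: "inj_on (fval z0) S"
  proof (rule inj_onI)
    fix f f' assume ff': "f \<in> S" "f' \<in> S" "fval z0 f = fval z0 f'"
    obtain A' B' where K: "degree A' \<le> Nb M" "degree B' \<le> Nb M" "A' \<noteq> 0 \<or> B' \<noteq> 0"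
      "\<And>k. k \<le> 2 * Nb M \<Longrightarrow> row ode g p q z0 k (fval z0 f) A' B' = 0"
      using pointwise_kernel[OF UNIV(1,3,3) UNIV_I] by metis
    have "fnum f * B' = fden f * A'" "fnum f' * B' = fden f' * A'"
      using ff' K by (auto simp: S_def intro!: admissible_determined)
    thus "f = f'"
      using proportional_Fract(2)[OF _ fnum_fden(2) K(3)] fnum_fden(3) by metis
  qed
  \<comment> \<open>\<open>H\<close> is head times defect, or the head alone if the quotient of the
    family is constant; this quotient is then the exception \<open>f0\<close>.\<close>
  obtain H f0 where H: "H \<noteq> 0" "degree H \<le> (M + 3) * D"
    "\<And>f. f \<in> S \<Longrightarrow> poly H (fval z0 f) = 0 \<or> f = f0"
  proof (cases "\<exists>z x :: nat. defectf ode g p q A B (of_nat z) (of_nat x) \<noteq> 0")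
    case True
    then obtain z1 x1 :: nat where E: "defectf ode g p q A B (of_nat z1) (of_nat x1) \<noteq> 0" by blast
    let ?E = "defectf ode g p q A B (of_nat z1)"
    have pfE: "pf ((g + 2) * D) ?E" by (intro pf_defectf AB)
    have "pf (D + (g + 2) * D) (\<lambda>x. ?h x * ?E x)" by (intro pf_mult pfh pfE)
    moreover have "D + (g + 2) * D \<le> (M + 3) * D" using g(3) by (simp add: add_mult_distrib)
    ultimately obtain H where H: "degree H \<le> (M + 3) * D" "\<And>x. ?h x * ?E x = poly H x"
      by (meson pf_def pf_mono)
    have "H \<noteq> 0" using pf_nonzero_mult[OF pfh pfE h E] H(2) by auto
    moreover have "poly H (fval z0 f) = 0" if f: "f \<in> S" for f
    proof (cases "?h (fval z0 f) = 0")
      case False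
      have sol: "is_sol ode g p q (fnum f) (fden f)"
        using f by (auto simp: S_def admissible_def solution_is_sol)
      from proportional_Fract(1)[OF AB_pr[OF f] fnum_fden(2) headf_nz[OF False]]
      have "is_sol ode g p q (poly A [:fval z0 f:]) (poly B [:fval z0 f:])"
        by (rule is_sol_proportional[OF sol AB_pr[OF f]])
      thus ?thesis by (simp add: is_sol_def defectf_def flip: H(2))
    qed (simp flip: H(2))
    ultimately show thesis using H(1) that by blast
  next
    case False
    hence const: "poly A [:c:] * poly B [:c':] = poly B [:c:] * poly A [:c':]" for c c'
      using defectf_dichotomy[OF rc dM g(1,2)] by blast
    obtain H where H: "degree H \<le> D" "\<And>x. ?h x = poly H x" using pfh by (auto simp: pf_def)
    define x where "x = (of_nat x2 :: complex)"
    \<comment> \<open>Taken at a parameter where the head is nonzero, so that the pair is not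
      \<open>(0, 0)\<close>.\<close>
    define f0 where "f0 = Fract (poly A [:x:]) (poly B [:x:])"
    have "H \<noteq> 0" using h H(2) by auto
    moreover have "degree H \<le> (M + 3) * D" using H(1) by (simp add: add_mult_distrib)
    moreover have "poly H (fval z0 f) = 0 \<or> f = f0" if f: "f \<in> S" for f
    proof (cases "?h (fval z0 f) = 0")
      case False
      have "fnum f * poly B [:x:] = fden f * poly A [:x:]"
        by (rule constant_family_proportional[OF AB_pr[OF f] fnum_fden(2) headf_nz[OF False] const])
      from proportional_Fract(2)[OF this fnum_fden(2) headf_nz] show ?thesis
        using h by (simp add: f0_def x_def fnum_fden)
    qed (simp flip: H(2))
    ultimately show thesis using that by blast
  qed
  have fin: "finite {x. poly H x = 0}" by (rule poly_roots_finite[OF H(1)])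
  have cardH: "card {x. poly H x = 0} \<le> (M + 3) * D"
    using card_poly_roots_bound[OF H(1)] H(2) by linarith
  define S' where "S' = {f \<in> S. poly H (fval z0 f) = 0}"
  have "fval z0 ` S' \<subseteq> {x. poly H x = 0}" "inj_on (fval z0) S'"
    using inj by (auto simp: S'_def intro: inj_on_subset)
  hence S': "finite S'" "card S' \<le> (M + 3) * D"
    using fin cardH finite_imageD finite_subset card_inj_on_le order_trans by metis+
  have sub: "S \<subseteq> insert f0 S'" using H(3) by (auto simp: S'_def)
  have "card S \<le> card (insert f0 S')" by (rule card_mono[OF _ sub]) (simp add: S')
  also have "\<dots> \<le> (M + 3) * D + 1" using S' by (simp add: card_insert_if)
  finally show ?thesis using sub S' finite_subset[OF sub] unfolding S_def by simp
qed

lemma card_solutions: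
  "finite (solutions ode R) \<and> card (solutions ode R) \<le>
     (Zb M + 1) * ((M + 3) * ((2 * Nb M + 1) * rho ode M (Nb M)) + 1)"
proof -
  have "\<exists>z0\<in>{..Zb M}. admissible z0 f" if "f \<in> solutions ode R" for f
    using that by (rule admissible_start) auto
  moreover have "f \<in> solutions ode R" if "admissible z0 f" for z0 f
    using that by (simp add: admissible_def)
  ultimately have eq: "solutions ode R = (\<Union>z0\<le>Zb M. {f. admissible z0 f})" by auto
  have "card (\<Union>z0\<le>Zb M. {f. admissible z0 f}) \<le> (\<Sum>z0\<le>Zb M. card {f. admissible z0 f})"
    by (rule card_UN_le) simp
  also have "\<dots> \<le> (\<Sum>z0\<le>Zb M. (M + 3) * ((2 * Nb M + 1) * rho ode M (Nb M)) + 1)"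
    using card_admissible by (intro sum_mono) blast
  finally show ?thesis unfolding eq using card_admissible by simp
qed

end

section \<open>Arithmetic with names\<close>

definition Wd :: "(nat \<Rightarrow> nat) set" where "Wd = diagram ` Collect acf_numbering"

lemma WdE:
  assumes "\<omega> \<in> Wd"
  obtains \<nu> where "\<omega> = diagram \<nu>" "acf_numbering \<nu>"
  using assms by (auto simp: Wd_def)

text \<open>
  The functions below compute with names; \<open>nadd\<close>, \<open>neval\<close> etc. return names of sums, values etc., and
  \<open>nzero\<close>, \<open>none\<close>, \<open>nnat k\<close> are names of \<open>0\<close>, \<open>1\<close>, \<open>k\<close>.
\<close>

definition is_add :: "(nat \<Rightarrow> nat) \<Rightarrow> nat \<Rightarrow> nat \<Rightarrow> nat \<Rightarrow> bool" where
  "is_add \<omega> a b c \<longleftrightarrow> \<omega> (prod_encode (a, prod_encode (b, c))) = 1 \<or> \<omega> (prod_encode (a, prod_encode (b, c))) = 3"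

definition is_mul :: "(nat \<Rightarrow> nat) \<Rightarrow> nat \<Rightarrow> nat \<Rightarrow> nat \<Rightarrow> bool" where
  "is_mul \<omega> a b c \<longleftrightarrow> \<omega> (prod_encode (a, prod_encode (b, c))) = 2 \<or> \<omega> (prod_encode (a, prod_encode (b, c))) = 3"

lemma is_add_diagram: "is_add (diagram \<nu>) a b c \<longleftrightarrow> \<nu> a + \<nu> b = \<nu> c"
  and is_mul_diagram: "is_mul (diagram \<nu>) a b c \<longleftrightarrow> \<nu> a * \<nu> b = \<nu> c"
  by (auto simp: is_add_def is_mul_def diagram_def)

definition nadd where "nadd \<omega> a b = (LEAST c. is_add \<omega> a b c)"
definition nmul where "nmul \<omega> a b = (LEAST c. is_mul \<omega> a b c)"
definition nsub where "nsub \<omega> a b = (LEAST c. is_add \<omega> c b a)"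
text \<open>0 is characterized by \<open>a + a = a\<close>, and 1 as the idempotent distinct from 0;
  both can be recognized in the diagram.\<close>

definition nzero where "nzero \<omega> = (LEAST a. is_add \<omega> a a a)"
definition none where "none \<omega> = (LEAST a. is_mul \<omega> a a a \<and> \<not> is_add \<omega> a a a)"
text \<open>Equality of the named numbers, not inequality: the prefix \<open>n\<close> marks
  operations on names.\<close>

definition neq where "neq \<omega> a b \<longleftrightarrow> is_add \<omega> a (nzero \<omega>) b"
definition nnat where "nnat \<omega> k = rec_nat (nzero \<omega>) (\<lambda>_ r. nadd \<omega> r (none \<omega>)) k"

context
  fixes \<nu> assumes \<nu>: "acf_numbering \<nu>"
begin

lemma csubfield_range: "csubfield (range \<nu>)"
  using \<nu> unfolding acf_numbering_def csubfield_def by blast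

lemma ex_name: "x \<in> range \<nu> \<Longrightarrow> \<exists>c. \<nu> c = x"
  by auto

lemma numbering_total:
  "\<exists>c. is_add (diagram \<nu>) a b c" "\<exists>c. is_mul (diagram \<nu>) a b c" "\<exists>c. is_add (diagram \<nu>) c b a"
  "\<exists>a. is_add (diagram \<nu>) a a a" "\<exists>a. is_mul (diagram \<nu>) a a a \<and> \<not> is_add (diagram \<nu>) a a a"
proof -
  note c = csubfield_range
  have "\<exists>c. \<nu> c = \<nu> a + \<nu> b" "\<exists>c. \<nu> c = \<nu> a * \<nu> b" "\<exists>c. \<nu> c = \<nu> a - \<nu> b" "\<exists>c. \<nu> c = 0" "\<exists>c. \<nu> c = 1"
    by (rule ex_name, intro csubfield_intros[OF c] rangeI)+
  then obtain s m d z e where "\<nu> s = \<nu> a + \<nu> b" "\<nu> m = \<nu> a * \<nu> b" "\<nu> d = \<nu> a - \<nu> b" "\<nu> z = 0" "\<nu> e = 1"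
    by blast
  hence "is_add (diagram \<nu>) a b s" "is_mul (diagram \<nu>) a b m" "is_add (diagram \<nu>) d b a"
    "is_add (diagram \<nu>) z z z" "is_mul (diagram \<nu>) e e e \<and> \<not> is_add (diagram \<nu>) e e e"
    by (simp_all add: is_add_diagram is_mul_diagram)
  thus "\<exists>c. is_add (diagram \<nu>) a b c" "\<exists>c. is_mul (diagram \<nu>) a b c"
    "\<exists>c. is_add (diagram \<nu>) c b a" "\<exists>a. is_add (diagram \<nu>) a a a"
    "\<exists>a. is_mul (diagram \<nu>) a a a \<and> \<not> is_add (diagram \<nu>) a a a"
    by blast+
qed

lemma nadd_val [simp]: "\<nu> (nadd (diagram \<nu>) a b) = \<nu> a + \<nu> b"
  using LeastI_ex[OF numbering_total(1)[of a b]] by (simp add: nadd_def is_add_diagram)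

lemma nmul_val [simp]: "\<nu> (nmul (diagram \<nu>) a b) = \<nu> a * \<nu> b"
  using LeastI_ex[OF numbering_total(2)[of a b]] by (simp add: nmul_def is_mul_diagram)

lemma nsub_val [simp]: "\<nu> (nsub (diagram \<nu>) a b) = \<nu> a - \<nu> b"
  using LeastI_ex[OF numbering_total(3)[of b a]] by (simp add: nsub_def is_add_diagram algebra_simps)

lemma nzero_val [simp]: "\<nu> (nzero (diagram \<nu>)) = 0"
  using LeastI_ex[OF numbering_total(4)] by (simp add: nzero_def is_add_diagram)

lemma none_val [simp]: "\<nu> (none (diagram \<nu>)) = 1"
  using LeastI_ex[OF numbering_total(5)] by (auto simp: none_def is_add_diagram is_mul_diagram)

lemma neq_val [simp]: "neq (diagram \<nu>) a b \<longleftrightarrow> \<nu> a = \<nu> b"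
  by (simp add: neq_def is_add_diagram)

lemma nnat_val [simp]: "\<nu> (nnat (diagram \<nu>) k) = of_nat k"
  by (induction k) (simp_all add: nnat_def)

end

lemma dp_is_add: "cf Wd A \<Longrightarrow> cf Wd B \<Longrightarrow> cf Wd C \<Longrightarrow> dp Wd (\<lambda>\<omega> x. is_add \<omega> (A \<omega> x) (B \<omega> x) (C \<omega> x))"
  unfolding is_add_def by (intro dp_disj dp_eq cf_oracle cf_prod_encode cf_const)

lemma dp_is_mul: "cf Wd A \<Longrightarrow> cf Wd B \<Longrightarrow> cf Wd C \<Longrightarrow> dp Wd (\<lambda>\<omega> x. is_mul \<omega> (A \<omega> x) (B \<omega> x) (C \<omega> x))"
  unfolding is_mul_def by (intro dp_disj dp_eq cf_oracle cf_prod_encode cf_const)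

lemma cf_nadd:
  assumes "cf Wd A" "cf Wd B"
  shows "cf Wd (\<lambda>\<omega> x. nadd \<omega> (A \<omega> x) (B \<omega> x))"
  unfolding nadd_def
  by (rule cf_minimize, intro dp_is_add cf_psnd cf_id assms[THEN cf_comp] cf_pfst)
    (erule WdE, simp add: numbering_total)

lemma cf_nmul:
  assumes "cf Wd A" "cf Wd B"
  shows "cf Wd (\<lambda>\<omega> x. nmul \<omega> (A \<omega> x) (B \<omega> x))"
  unfolding nmul_def
  by (rule cf_minimize, intro dp_is_mul cf_psnd cf_id assms[THEN cf_comp] cf_pfst)
    (erule WdE, simp add: numbering_total)

lemma cf_nsub:
  assumes "cf Wd A" "cf Wd B"
  shows "cf Wd (\<lambda>\<omega> x. nsub \<omega> (A \<omega> x) (B \<omega> x))"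
  unfolding nsub_def
  by (rule cf_minimize, intro dp_is_add cf_psnd cf_id assms[THEN cf_comp] cf_pfst)
    (erule WdE, simp add: numbering_total)

lemma cf_nzero: "cf Wd (\<lambda>\<omega> x. nzero \<omega>)"
  unfolding nzero_def
  by (rule cf_minimize[where P = "\<lambda>\<omega> x y. is_add \<omega> y y y"])
    (intro dp_is_add cf_psnd cf_id, erule WdE, simp add: numbering_total)

lemma cf_none: "cf Wd (\<lambda>\<omega> x. none \<omega>)"
  unfolding none_def
  by (rule cf_minimize[where P = "\<lambda>\<omega> x y. is_mul \<omega> y y y \<and> \<not> is_add \<omega> y y y"])
    (intro dp_is_add dp_is_mul dp_conj dp_not cf_psnd cf_id, erule WdE, simp add: numbering_total)

lemma dp_neq: "cf Wd A \<Longrightarrow> cf Wd B \<Longrightarrow> dp Wd (\<lambda>\<omega> x. neq \<omega> (A \<omega> x) (B \<omega> x))"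
  unfolding neq_def by (intro dp_is_add cf_nzero)

lemmas cf_base = cf_id cf_const cf_Suc cf_add cf_diff cf_mult cf_prod_encode cf_pfst cf_psnd
  cf_power cf_clength cf_cnth cf_nadd cf_nmul cf_nsub cf_nzero cf_none

lemma cf_nnat: "cf Wd A \<Longrightarrow> cf Wd (\<lambda>\<omega> x. nnat \<omega> (A \<omega> x))"
  unfolding nnat_def by (intro cf_rec_nat cf_base)

section \<open>Evaluation of polynomials given by names\<close>

definition neval where
  "neval \<omega> p x = foldr (\<lambda>c s. nadd \<omega> c (nmul \<omega> x s)) (list_decode p) (nzero \<omega>)"

text \<open>Horner scheme for value and derivative at once; the pair holds both.\<close>

definition ndeval where
  "ndeval \<omega> p x = psnd (foldr (\<lambda>c s. prod_encode (nadd \<omega> c (nmul \<omega> x (pfst s)),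
     nadd \<omega> (pfst s) (nmul \<omega> x (psnd s)))) (list_decode p) (prod_encode (nzero \<omega>, nzero \<omega>)))"

definition nev2 where
  "nev2 \<omega> p z x = foldr (\<lambda>c s. nadd \<omega> (neval \<omega> c z) (nmul \<omega> x s)) (list_decode p) (nzero \<omega>)"

definition nev2z where
  "nev2z \<omega> p z x = foldr (\<lambda>c s. nadd \<omega> (ndeval \<omega> c z) (nmul \<omega> x s)) (list_decode p) (nzero \<omega>)"

definition nev2w where
  "nev2w \<omega> p z x = psnd (foldr (\<lambda>c s. prod_encode (nadd \<omega> (neval \<omega> c z) (nmul \<omega> x (pfst s)),
     nadd \<omega> (pfst s) (nmul \<omega> x (psnd s)))) (list_decode p) (prod_encode (nzero \<omega>, nzero \<omega>)))"

text \<open>Horner scheme for the homogeneous form. The second component is the power of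
  \<open>y\<close> needed to homogenize the next coefficient, so the degree of the form is the list
  length minus 1, whether or not the leading coefficients vanish.\<close>

definition nhev where
  "nhev \<omega> p z x y = pfst (foldr (\<lambda>c s. prod_encode (nadd \<omega> (nmul \<omega> (neval \<omega> c z) (psnd s)) (nmul \<omega> x (pfst s)),
     nmul \<omega> (psnd s) y)) (list_decode p) (prod_encode (nzero \<omega>, none \<omega>)))"

definition nprod where
  "nprod \<omega> e cs x = foldr (\<lambda>c s. nmul \<omega> (nsub \<omega> x c) s) (list_decode cs) e"

definition norbit where
  "norbit \<omega> p q z0 c k = rec_nat (prod_encode (c, none \<omega>))
     (\<lambda>k r. prod_encode (nhev \<omega> p (nnat \<omega> (z0 + k)) (pfst r) (psnd r),
                         nhev \<omega> q (nnat \<omega> (z0 + k)) (pfst r) (psnd r))) k"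

lemma cf_neval: assumes "cf Wd A" "cf Wd B" shows "cf Wd (\<lambda>\<omega> x. neval \<omega> (A \<omega> x) (B \<omega> x))"
  unfolding neval_def by (intro cf_foldr cf_base assms assms[THEN cf_comp])

lemma cf_ndeval: assumes "cf Wd A" "cf Wd B" shows "cf Wd (\<lambda>\<omega> x. ndeval \<omega> (A \<omega> x) (B \<omega> x))"
  unfolding ndeval_def by (intro cf_foldr cf_base assms assms[THEN cf_comp])

lemma cf_nev2: assumes "cf Wd A" "cf Wd B" "cf Wd C" shows "cf Wd (\<lambda>\<omega> x. nev2 \<omega> (A \<omega> x) (B \<omega> x) (C \<omega> x))"
  unfolding nev2_def by (intro cf_foldr cf_neval cf_base assms assms[THEN cf_comp])

lemma cf_nev2z: assumes "cf Wd A" "cf Wd B" "cf Wd C" shows "cf Wd (\<lambda>\<omega> x. nev2z \<omega> (A \<omega> x) (B \<omega> x) (C \<omega> x))"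
  unfolding nev2z_def by (intro cf_foldr cf_ndeval cf_base assms assms[THEN cf_comp])

lemma cf_nev2w: assumes "cf Wd A" "cf Wd B" "cf Wd C" shows "cf Wd (\<lambda>\<omega> x. nev2w \<omega> (A \<omega> x) (B \<omega> x) (C \<omega> x))"
  unfolding nev2w_def by (intro cf_foldr cf_neval cf_base assms assms[THEN cf_comp])

lemma cf_nhev: assumes "cf Wd A" "cf Wd B" "cf Wd C" "cf Wd D"
  shows "cf Wd (\<lambda>\<omega> x. nhev \<omega> (A \<omega> x) (B \<omega> x) (C \<omega> x) (D \<omega> x))"
  unfolding nhev_def by (intro cf_foldr cf_neval cf_base assms assms[THEN cf_comp])

lemma cf_nprod: assumes "cf Wd A" "cf Wd B" "cf Wd C" shows "cf Wd (\<lambda>\<omega> x. nprod \<omega> (A \<omega> x) (B \<omega> x) (C \<omega> x))"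
  unfolding nprod_def by (intro cf_foldr cf_base assms assms[THEN cf_comp])

lemma cf_norbit: assumes "cf Wd A" "cf Wd B" "cf Wd C" "cf Wd D" "cf Wd E"
  shows "cf Wd (\<lambda>\<omega> x. norbit \<omega> (A \<omega> x) (B \<omega> x) (C \<omega> x) (D \<omega> x) (E \<omega> x))"
  unfolding norbit_def by (intro cf_rec_nat cf_nhev cf_nnat cf_base assms assms[THEN cf_comp])

lemma ev2_pderiv_pCons: "ev2 (pderiv (pCons r P)) z x = ev2 P z x + x * ev2 (pderiv P) z x"
  by (simp add: pderiv_pCons)

context
  fixes \<nu> assumes \<nu>: "acf_numbering \<nu>"
begin

lemma neval_val: "\<nu> (neval (diagram \<nu>) p x) = poly (poly_of \<nu> p) (\<nu> x)"
proof -
  have "\<nu> (foldr (\<lambda>c s. nadd (diagram \<nu>) c (nmul (diagram \<nu>) x s)) cs (nzero (diagram \<nu>))) =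
      poly (Poly (map \<nu> cs)) (\<nu> x)" for cs
    by (induction cs) (simp_all add: \<nu>)
  thus ?thesis by (simp add: neval_def poly_of_def)
qed

lemma ndeval_val: "\<nu> (ndeval (diagram \<nu>) p x) = poly (pderiv (poly_of \<nu> p)) (\<nu> x)"
proof -
  let ?f = "\<lambda>cs. foldr (\<lambda>c s. prod_encode (nadd (diagram \<nu>) c (nmul (diagram \<nu>) x (pfst s)),
     nadd (diagram \<nu>) (pfst s) (nmul (diagram \<nu>) x (psnd s)))) cs (prod_encode (nzero (diagram \<nu>), nzero (diagram \<nu>)))"
  have "\<nu> (pfst (?f cs)) = poly (Poly (map \<nu> cs)) (\<nu> x) \<and> \<nu> (psnd (?f cs)) = poly (pderiv (Poly (map \<nu> cs))) (\<nu> x)" for cs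
    by (induction cs) (simp_all add: \<nu> pderiv_pCons)
  thus ?thesis by (simp add: ndeval_def poly_of_def)
qed

lemma nev2_val: "\<nu> (nev2 (diagram \<nu>) p z x) = ev2 (poly2_of \<nu> p) (\<nu> z) (\<nu> x)"
proof -
  have "\<nu> (foldr (\<lambda>c s. nadd (diagram \<nu>) (neval (diagram \<nu>) c z) (nmul (diagram \<nu>) x s)) cs (nzero (diagram \<nu>))) =
      ev2 (Poly (map (poly_of \<nu>) cs)) (\<nu> z) (\<nu> x)" for cs
    by (induction cs) (simp_all add: \<nu> neval_val)
  thus ?thesis by (simp add: nev2_def poly2_of_def)
qed

lemma nev2z_val: "\<nu> (nev2z (diagram \<nu>) p z x) = ev2 (map_poly pderiv (poly2_of \<nu> p)) (\<nu> z) (\<nu> x)"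
proof -
  have "\<nu> (foldr (\<lambda>c s. nadd (diagram \<nu>) (ndeval (diagram \<nu>) c z) (nmul (diagram \<nu>) x s)) cs (nzero (diagram \<nu>))) =
      ev2 (map_poly pderiv (Poly (map (poly_of \<nu>) cs))) (\<nu> z) (\<nu> x)" for cs
    by (induction cs) (simp_all add: \<nu> ndeval_val map_poly_pCons)
  thus ?thesis by (simp add: nev2z_def poly2_of_def)
qed

lemma nev2w_val: "\<nu> (nev2w (diagram \<nu>) p z x) = ev2 (pderiv (poly2_of \<nu> p)) (\<nu> z) (\<nu> x)"
proof -
  let ?f = "\<lambda>cs. foldr (\<lambda>c s. prod_encode (nadd (diagram \<nu>) (neval (diagram \<nu>) c z) (nmul (diagram \<nu>) x (pfst s)),
     nadd (diagram \<nu>) (pfst s) (nmul (diagram \<nu>) x (psnd s)))) cs (prod_encode (nzero (diagram \<nu>), nzero (diagram \<nu>)))"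
  have "\<nu> (pfst (?f cs)) = ev2 (Poly (map (poly_of \<nu>) cs)) (\<nu> z) (\<nu> x) \<and>
      \<nu> (psnd (?f cs)) = ev2 (pderiv (Poly (map (poly_of \<nu>) cs))) (\<nu> z) (\<nu> x)" for cs
    by (induction cs) (simp_all add: \<nu> neval_val ev2_pderiv_pCons)
  thus ?thesis by (simp add: nev2w_def poly2_of_def)
qed

lemma nhev_val:
  assumes "clength p = Suc g"
  shows "\<nu> (nhev (diagram \<nu>) p z x y) = hpoly (\<lambda>r. poly r (\<nu> z)) g (poly2_of \<nu> p) (\<nu> x) (\<nu> y)"
proof -
  let ?f = "\<lambda>cs. foldr (\<lambda>c s. prod_encode (nadd (diagram \<nu>) (nmul (diagram \<nu>) (neval (diagram \<nu>) c z) (psnd s)) (nmul (diagram \<nu>) x (pfst s)),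
     nmul (diagram \<nu>) (psnd s) y)) cs (prod_encode (nzero (diagram \<nu>), none (diagram \<nu>)))"
  have "\<nu> (psnd (?f cs)) = \<nu> y ^ length cs \<and> \<nu> (pfst (?f cs)) = (if cs = [] then 0 else
      hpoly (\<lambda>r. poly r (\<nu> z)) (length cs - 1) (Poly (map (poly_of \<nu>) cs)) (\<nu> x) (\<nu> y))" for cs
  proof (induction cs)
    case (Cons c cs)
    show ?case
    proof (cases cs)
      case Nil
      thus ?thesis by (simp add: \<nu> neval_val hpoly_0)
    next
      case (Cons c' cs')
      have "hpoly (\<lambda>r. poly r (\<nu> z)) (length cs) (Poly (map (poly_of \<nu>) (c # cs))) (\<nu> x) (\<nu> y) =
          poly (poly_of \<nu> c) (\<nu> z) * \<nu> y ^ length cs +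
          \<nu> x * hpoly (\<lambda>r. poly r (\<nu> z)) (length cs - 1) (Poly (map (poly_of \<nu>) cs)) (\<nu> x) (\<nu> y)"
        using hpoly_Suc_pCons[of "\<lambda>r. poly r (\<nu> z)" "length cs'"] Cons by simp
      thus ?thesis using Cons.IH Cons by (simp add: \<nu> neval_val mult.commute)
    qed
  qed (simp add: \<nu>)
  from this[of "list_decode p"] show ?thesis
    using assms by (auto simp: nhev_def poly2_of_def)
qed

lemma nprod_val: "\<nu> (nprod (diagram \<nu>) e cs x) = \<nu> e * (\<Prod>c\<leftarrow>list_decode cs. \<nu> x - \<nu> c)"
proof -
  have "\<nu> (foldr (\<lambda>c s. nmul (diagram \<nu>) (nsub (diagram \<nu>) x c) s) ds e) = \<nu> e * (\<Prod>c\<leftarrow>ds. \<nu> x - \<nu> c)" for ds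
    by (induction ds) (simp_all add: \<nu> mult_ac)
  thus ?thesis by (simp add: nprod_def)
qed

lemma norbit_val:
  assumes "clength p = Suc g" "clength q = Suc g"
  shows "(\<nu> (pfst (norbit (diagram \<nu>) p q z0 c k)), \<nu> (psnd (norbit (diagram \<nu>) p q z0 c k))) =
    orbit (poly2_of \<nu> p) (poly2_of \<nu> q) g z0 (\<nu> c) k"
proof (induction k)
  case (Suc k)
  have "norbit (diagram \<nu>) p q z0 c (Suc k) =
     (let r = norbit (diagram \<nu>) p q z0 c k in
       prod_encode (nhev (diagram \<nu>) p (nnat (diagram \<nu>) (z0 + k)) (pfst r) (psnd r),
                    nhev (diagram \<nu>) q (nnat (diagram \<nu>) (z0 + k)) (pfst r) (psnd r)))"
    by (simp add: norbit_def Let_def)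
  with Suc.IH[symmetric] show ?case
    by (simp add: Let_def nhev_val[OF assms(1)] nhev_val[OF assms(2)] \<nu>)
qed (simp add: norbit_def \<nu>)

end

section \<open>A semidecidable certificate of completeness\<close>

lemma sd_neq: "cf Wd A \<Longrightarrow> cf Wd B \<Longrightarrow> sd Wd (\<lambda>\<omega> x. neq \<omega> (A \<omega> x) (B \<omega> x))"
  and sd_not_neq: "cf Wd A \<Longrightarrow> cf Wd B \<Longrightarrow> sd Wd (\<lambda>\<omega> x. \<not> neq \<omega> (A \<omega> x) (B \<omega> x))"
  by (intro sd_dp dp_not dp_neq; assumption)+

lemma sd_le: "cf W A \<Longrightarrow> cf W B \<Longrightarrow> sd W (\<lambda>\<omega> x. A \<omega> x \<le> B \<omega> x)"
  by (intro sd_dp dp_le)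

lemma sd_eq: "cf W A \<Longrightarrow> cf W B \<Longrightarrow> sd W (\<lambda>\<omega> x. A \<omega> x = B \<omega> x)"
  by (intro sd_dp dp_eq)

lemma sd_mem: "cf W A \<Longrightarrow> cf W B \<Longrightarrow> sd W (\<lambda>\<omega> x. A \<omega> x \<in> set (list_decode (B \<omega> x)))"
  by (intro sd_dp dp_mem)

lemmas cf_all = cf_base cf_nnat cf_neval cf_ndeval cf_nev2 cf_nev2z cf_nev2w cf_nhev cf_nprod cf_norbit
lemmas sd_all = sd_neq sd_not_neq sd_le sd_eq sd_mem sd_conj sd_disj sd_ex sd_all_less sd_all_mem

text \<open>
  Polynomial identities are checked by evaluation at more integers than the degree, and degrees
  are bounded by the codes of the polynomials.
\<close>

definition nflow where
  "nflow \<omega> p q N z0 c A B G \<longleftrightarrow>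
     (\<forall>i < p + q + A + B + G + 2. \<forall>j < p + q + A + B + G + 2.
        neq \<omega> (nadd \<omega> (nev2 \<omega> (cnth G 0) (nnat \<omega> i) (nnat \<omega> j)) (nmul \<omega> (nnat \<omega> j) (nev2 \<omega> B (nnat \<omega> i) c)))
          (nev2 \<omega> A (nnat \<omega> i) c)) \<and>
     (\<forall>k < 2 * N. \<forall>i < p + q + A + B + G + 2. \<forall>j < p + q + A + B + G + 2.
        neq \<omega> (nev2 \<omega> (cnth G (Suc k)) (nnat \<omega> i) (nnat \<omega> j))
          (nadd \<omega> (nmul \<omega> (nev2 \<omega> q (nnat \<omega> i) (nnat \<omega> j)) (nev2z \<omega> (cnth G k) (nnat \<omega> i) (nnat \<omega> j)))
             (nmul \<omega> (nev2 \<omega> p (nnat \<omega> i) (nnat \<omega> j)) (nev2w \<omega> (cnth G k) (nnat \<omega> i) (nnat \<omega> j))))) \<and>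
     (\<forall>k < Suc (2 * N). neq \<omega> (nev2 \<omega> (cnth G k) (nnat \<omega> z0) c) (nzero \<omega>))"

definition norb where
  "norb \<omega> p q N z0 c A B \<longleftrightarrow> (\<forall>k < Suc (2 * N).
     neq \<omega> (nmul \<omega> (nev2 \<omega> A (nnat \<omega> (z0 + k)) c) (psnd (norbit \<omega> p q z0 c k)))
       (nmul \<omega> (nev2 \<omega> B (nnat \<omega> (z0 + k)) c) (pfst (norbit \<omega> p q z0 c k))))"

definition czdeg :: "nat \<Rightarrow> nat \<Rightarrow> bool" where
  "czdeg A N \<longleftrightarrow> (\<forall>r \<in> set (list_decode A). clength r \<le> Suc N)"

definition nker where
  "nker ode \<omega> p q N z0 c A B \<longleftrightarrow> czdeg A N \<and> czdeg B N \<and>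
     (if ode then \<exists>G. nflow \<omega> p q N z0 c A B G else norb \<omega> p q N z0 c A B)"

lemma sd_nker:
  assumes "cf Wd p" "cf Wd q" "cf Wd N" "cf Wd z0" "cf Wd c" "cf Wd A" "cf Wd B"
  shows "sd Wd (\<lambda>\<omega> x. nker ode \<omega> (p \<omega> x) (q \<omega> x) (N \<omega> x) (z0 \<omega> x) (c \<omega> x) (A \<omega> x) (B \<omega> x))"
proof (cases ode)
  case True
  show ?thesis unfolding nker_def if_P[OF True] czdeg_def nflow_def
    by (intro sd_all cf_all assms[THEN cf_comp] assms)
next
  case False
  show ?thesis unfolding nker_def if_not_P[OF False] czdeg_def norb_def
    by (intro sd_all cf_all assms[THEN cf_comp] assms)
qed

definition nhead where
  "nhead \<omega> A B s z x = nadd \<omega> (nev2 \<omega> A z x) (nmul \<omega> s (nev2 \<omega> B z x))"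

definition ndefect where
  "ndefect ode \<omega> p q A B z x = nsub \<omega>
     (nmul \<omega> (if ode then nsub \<omega> (nmul \<omega> (nev2z \<omega> A z x) (nev2 \<omega> B z x)) (nmul \<omega> (nev2 \<omega> A z x) (nev2z \<omega> B z x))
              else nev2 \<omega> A (nadd \<omega> z (none \<omega>)) x) (nhev \<omega> q z (nev2 \<omega> A z x) (nev2 \<omega> B z x)))
     (nmul \<omega> (if ode then nmul \<omega> (nev2 \<omega> B z x) (nev2 \<omega> B z x) else nev2 \<omega> B (nadd \<omega> z (none \<omega>)) x)
        (nhev \<omega> p z (nev2 \<omega> A z x) (nev2 \<omega> B z x)))"

lemma cf_nhead:
  assumes "cf Wd A" "cf Wd B" "cf Wd s" "cf Wd z" "cf Wd c"
  shows "cf Wd (\<lambda>\<omega> x. nhead \<omega> (A \<omega> x) (B \<omega> x) (s \<omega> x) (z \<omega> x) (c \<omega> x))"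
  unfolding nhead_def by (intro cf_all assms)

lemma cf_ndefect:
  assumes "cf Wd p" "cf Wd q" "cf Wd A" "cf Wd B" "cf Wd z" "cf Wd c"
  shows "cf Wd (\<lambda>\<omega> x. ndefect ode \<omega> (p \<omega> x) (q \<omega> x) (A \<omega> x) (B \<omega> x) (z \<omega> x) (c \<omega> x))"
proof (cases ode)
  case True
  show ?thesis unfolding ndefect_def if_P[OF True] by (intro cf_all assms)
next
  case False
  show ?thesis unfolding ndefect_def if_not_P[OF False] by (intro cf_all assms)
qed

text \<open>The code of a one-element list: a pair of polynomials becomes a family constant in the
  parameter, to which the tests for families apply.\<close>

abbreviation sing :: "nat \<Rightarrow> nat" where "sing a \<equiv> Suc (prod_encode (a, 0))"

definition nden where
  "nden \<omega> q a b i = nmul \<omega> (neval \<omega> b (nnat \<omega> i))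
     (nhev \<omega> q (nnat \<omega> i) (neval \<omega> a (nnat \<omega> i)) (neval \<omega> b (nnat \<omega> i)))"

text \<open>Exceeds the degrees in \<open>z\<close> of the defect and of the denominator:
  \<open>a + b\<close> bounds the degrees of the pair, \<open>p + q\<close> the degree of the forms
  and of their coefficients.\<close>

definition tsol :: "nat \<Rightarrow> nat \<Rightarrow> nat \<Rightarrow> nat \<Rightarrow> nat" where
  "tsol p q a b = Suc ((p + q + 2) * (a + b) + (p + q))"

definition nsol where
  "nsol ode \<omega> p q a b \<longleftrightarrow> (\<exists>i. \<not> neq \<omega> (nden \<omega> q a b i) (nzero \<omega>)) \<and>
     (\<forall>i < tsol p q a b. neq \<omega> (ndefect ode \<omega> p q (sing a) (sing b) (nnat \<omega> i) (nzero \<omega>)) (nzero \<omega>))"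

text \<open>The complement of \<open>nsol\<close>, written positively because semidecidable
  predicates are not closed under negation; the bounded and unbounded quantifiers change
  places.\<close>

definition nnot where
  "nnot ode \<omega> p q a b \<longleftrightarrow> (\<forall>i < tsol p q a b. neq \<omega> (nden \<omega> q a b i) (nzero \<omega>)) \<or>
     (\<exists>i. \<not> neq \<omega> (ndefect ode \<omega> p q (sing a) (sing b) (nnat \<omega> i) (nzero \<omega>)) (nzero \<omega>))"

definition cand where
  "cand ode \<omega> p q L a b \<longleftrightarrow>
     (\<exists>i. \<not> neq \<omega> (neval \<omega> a (nnat \<omega> i)) (nzero \<omega>) \<or> \<not> neq \<omega> (neval \<omega> b (nnat \<omega> i)) (nzero \<omega>)) \<and>
     (nnot ode \<omega> p q a b \<or> prod_encode (a, b) \<in> set (list_decode L))"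

lemma sd_nsol:
  assumes "cf Wd p" "cf Wd q" "cf Wd a" "cf Wd b"
  shows "sd Wd (\<lambda>\<omega> x. nsol ode \<omega> (p \<omega> x) (q \<omega> x) (a \<omega> x) (b \<omega> x))"
  unfolding nsol_def nden_def tsol_def
  by (intro sd_all cf_all cf_ndefect assms[THEN cf_comp] assms)

lemma sd_cand:
  assumes "cf Wd p" "cf Wd q" "cf Wd L" "cf Wd a" "cf Wd b"
  shows "sd Wd (\<lambda>\<omega> x. cand ode \<omega> (p \<omega> x) (q \<omega> x) (L \<omega> x) (a \<omega> x) (b \<omega> x))"
  unfolding cand_def nnot_def nden_def tsol_def
  by (intro sd_all cf_all cf_ndefect assms[THEN cf_comp] assms)

text \<open>
  \<open>(A, B)\<close> is a solution of the linear conditions depending polynomially on \<open>c\<close>. Either its defect is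
  not identically zero, and every value \<open>f(z0)\<close> is among the roots \<open>cs\<close>; or \<open>A/B\<close> does not depend on
  \<open>c\<close> and equals the only further candidate \<open>a/b\<close>. For each root, one solution of the linear
  conditions at \<open>c\<close> yields the only candidate with this value.
\<close>

definition covered where
  "covered ode \<omega> p q L N T z0 A B s z2 cs e \<longleftrightarrow>
     \<not> neq \<omega> e (nzero \<omega>) \<and>
     (\<forall>i < T. nker ode \<omega> p q N z0 (nnat \<omega> i) A B) \<and>
     (\<forall>c \<in> set (list_decode cs). \<exists>a b. nker ode \<omega> p q N z0 c (sing a) (sing b) \<and> cand ode \<omega> p q L a b) \<and>
     ((\<exists>z1. \<forall>i < T. neq \<omega> (nmul \<omega> (nhead \<omega> A B s z2 (nnat \<omega> i)) (ndefect ode \<omega> p q A B (nnat \<omega> z1) (nnat \<omega> i)))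
                          (nprod \<omega> e cs (nnat \<omega> i))) \<or>
      (\<forall>i < T. neq \<omega> (nhead \<omega> A B s z2 (nnat \<omega> i)) (nprod \<omega> e cs (nnat \<omega> i))) \<and>
      (\<exists>a b. cand ode \<omega> p q L a b \<and> (\<forall>i < T. \<forall>j < A + B + a + b + 1.
         neq \<omega> (nmul \<omega> (nev2 \<omega> A (nnat \<omega> j) (nnat \<omega> i)) (neval \<omega> b (nnat \<omega> j)))
           (nmul \<omega> (nev2 \<omega> B (nnat \<omega> j) (nnat \<omega> i)) (neval \<omega> a (nnat \<omega> j))))))"

text \<open>The number of test points exceeds every degree in the parameter that occurs:
  \<open>A + B\<close> bounds that of the family, the factor \<open>p + q + 3\<close> accounts for
  head times defect, \<open>rho\<close> for the rows, and the code \<open>cs\<close> for the number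
  of listed roots.\<close>

definition complete where
  "complete ode \<omega> p q L \<longleftrightarrow> (\<forall>z0 < Suc (Zb (p + q)). \<exists>A B s z2 cs e.
     covered ode \<omega> p q L (Nb (p + q)) (Suc ((p + q + 3) * (A + B) + rho ode (p + q) (Nb (p + q)) + cs))
       z0 A B s z2 cs e)"

lemma sd_covered:
  assumes "cf Wd p" "cf Wd q" "cf Wd L" "cf Wd N" "cf Wd T" "cf Wd z0" "cf Wd A" "cf Wd B" "cf Wd s"
    "cf Wd z2" "cf Wd cs" "cf Wd e"
  shows "sd Wd (\<lambda>\<omega> x. covered ode \<omega> (p \<omega> x) (q \<omega> x) (L \<omega> x) (N \<omega> x) (T \<omega> x) (z0 \<omega> x) (A \<omega> x) (B \<omega> x)
    (s \<omega> x) (z2 \<omega> x) (cs \<omega> x) (e \<omega> x))"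
  unfolding covered_def
  by (intro sd_all sd_nker sd_cand cf_all cf_nhead cf_ndefect assms[THEN cf_comp] assms)

lemma cf_Nb: "cf W M \<Longrightarrow> cf W (\<lambda>\<omega> x. Nb (M \<omega> x))"
  unfolding Nb_def by (intro cf_mult cf_const)

lemma cf_Zb: "cf W M \<Longrightarrow> cf W (\<lambda>\<omega> x. Zb (M \<omega> x))"
  unfolding Zb_def by (intro cf_mult cf_add cf_Nb cf_const)

lemma cf_rho: "cf W M \<Longrightarrow> cf W N \<Longrightarrow> cf W (\<lambda>\<omega> x. rho ode (M \<omega> x) (N \<omega> x))"
  unfolding rho_def
  by (cases ode, simp_all only: if_True if_False) (intro cf_mult cf_add cf_const cf_power; assumption)+

lemma sd_complete:
  assumes "cf Wd p" "cf Wd q" "cf Wd L"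
  shows "sd Wd (\<lambda>\<omega> x. complete ode \<omega> (p \<omega> x) (q \<omega> x) (L \<omega> x))"
  unfolding complete_def
  by (intro sd_all sd_covered cf_all cf_Nb cf_Zb cf_rho assms[THEN cf_comp] assms)

definition reduced where
  "reduced \<omega> p q u v r \<longleftrightarrow> (\<exists>i. \<not> neq \<omega> (neval \<omega> r (nnat \<omega> i)) (nzero \<omega>)) \<and>
     (\<forall>i < Suc (p + q + u + v + r). \<forall>j < Suc (p + q + u + v + r).
        neq \<omega> (nadd \<omega> (nmul \<omega> (nev2 \<omega> u (nnat \<omega> i) (nnat \<omega> j)) (nev2 \<omega> p (nnat \<omega> i) (nnat \<omega> j)))
                (nmul \<omega> (nev2 \<omega> v (nnat \<omega> i) (nnat \<omega> j)) (nev2 \<omega> q (nnat \<omega> i) (nnat \<omega> j))))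
          (neval \<omega> r (nnat \<omega> i)))"

text \<open>Equal code lengths give numerator and denominator the same homogenization
  degree.\<close>

definition same_fraction where
  "same_fraction \<omega> p0 q0 p q \<longleftrightarrow> clength p = clength q \<and>
     (\<exists>i j. \<not> neq \<omega> (nev2 \<omega> q (nnat \<omega> i) (nnat \<omega> j)) (nzero \<omega>)) \<and>
     (\<forall>i < Suc (p0 + q0 + p + q). \<forall>j < Suc (p0 + q0 + p + q).
        neq \<omega> (nmul \<omega> (nev2 \<omega> p0 (nnat \<omega> i) (nnat \<omega> j)) (nev2 \<omega> q (nnat \<omega> i) (nnat \<omega> j)))
          (nmul \<omega> (nev2 \<omega> p (nnat \<omega> i) (nnat \<omega> j)) (nev2 \<omega> q0 (nnat \<omega> i) (nnat \<omega> j))))"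

text \<open>Minimization requires a search that always succeeds, also for inputs outside the domain.
  There the first alternative (zero denominator) or the length test (degree in \<open>w\<close> at
  most \<open>edeg ode\<close>) accepts any list.\<close>

definition answer where
  "answer ode \<omega> n L \<longleftrightarrow>
     (\<forall>i < Suc n. \<forall>j < Suc n. neq \<omega> (nev2 \<omega> (psnd n) (nnat \<omega> i) (nnat \<omega> j)) (nzero \<omega>)) \<or>
     (\<exists>p q. same_fraction \<omega> (pfst n) (psnd n) p q \<and>
        (clength p \<le> Suc (edeg ode) \<or>
         (\<exists>u v r. reduced \<omega> p q u v r) \<and>
         (\<forall>f \<in> set (list_decode L). nsol ode \<omega> p q (pfst f) (psnd f)) \<and> complete ode \<omega> p q L))"

lemma sd_answer: "sd Wd (\<lambda>\<omega> x. answer ode \<omega> (pfst x) (psnd x))"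
  unfolding answer_def same_fraction_def reduced_def
  by (intro sd_all sd_nsol sd_complete cf_all)

section \<open>Correctness of the certificate\<close>

lemma clength_le: "clength n \<le> n"
proof -
  have "length xs \<le> list_encode xs" for xs
  proof (induction xs)
    case (Cons x xs)
    thus ?case using le_prod_encode_2[of "list_encode xs" x] by simp
  qed simp
  from this[of "list_decode n"] show ?thesis by simp
qed

lemma member_code_le: "r \<in> set (list_decode n) \<Longrightarrow> r \<le> n"
proof -
  have "r \<in> set xs \<Longrightarrow> r \<le> list_encode xs" for xs
  proof (induction xs)
    case (Cons x xs)
    thus ?case using le_prod_encode_1[of x "list_encode xs"] le_prod_encode_2[of "list_encode xs" x] by auto
  qed simp
  from this[of "list_decode n"] show "r \<in> set (list_decode n) \<Longrightarrow> r \<le> n" by simp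
qed

lemma cnth_le: "cnth n i \<le> n"
proof -
  have "rec_nat n (\<lambda>_ r. psnd (r - 1)) i \<le> n"
    by (induction i) (auto intro: order_trans[OF psnd_le])
  thus ?thesis unfolding cnth_def using pfst_le[of "rec_nat n (\<lambda>_ r. psnd (r - 1)) i - 1"] by linarith
qed

lemma degree_Poly_le: "degree (Poly xs) \<le> length xs - 1"
  by (rule degree_le) (auto simp: nth_default_def)

lemma degree_poly_of_clength: "degree (poly_of \<nu> n) \<le> clength n - 1"
  unfolding poly_of_def using degree_Poly_le[of "map \<nu> (list_decode n)"] by simp

lemma degree_poly_of: "degree (poly_of \<nu> n) \<le> n"
  using degree_poly_of_clength[of \<nu> n] clength_le[of n] by linarith

lemma degree_poly2_of_clength: "degree (poly2_of \<nu> n) \<le> clength n - 1"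
  unfolding poly2_of_def using degree_Poly_le[of "map (poly_of \<nu>) (list_decode n)"] by simp

lemma degree_poly2_of: "degree (poly2_of \<nu> n) \<le> n"
  using degree_poly2_of_clength[of \<nu> n] clength_le[of n] by linarith

lemma zdeg_poly2_of_czdeg:
  assumes "czdeg n N"
  shows "zdeg_le (poly2_of \<nu> n) N"
  unfolding zdeg_le_def
proof
  fix i
  show "degree (coeff (poly2_of \<nu> n) i) \<le> N"
  proof (cases "i < clength n")
    case True
    hence "clength (list_decode n ! i) \<le> Suc N" using assms nth_mem by (auto simp: czdeg_def)
    hence "degree (poly_of \<nu> (list_decode n ! i)) \<le> N"
      using degree_poly_of_clength[of \<nu> "list_decode n ! i"] by linarith
    thus ?thesis using True by (simp add: poly2_of_def nth_default_def)
  qed (simp add: poly2_of_def nth_default_def)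
qed

lemma zdeg_poly2_of: "zdeg_le (poly2_of \<nu> n) n"
proof (rule zdeg_poly2_of_czdeg)
  have "clength r \<le> Suc n" if "r \<in> set (list_decode n)" for r
    using member_code_le[OF that] clength_le[of r] by linarith
  thus "czdeg n n" by (simp add: czdeg_def)
qed

lemma ev2_grid_eq_0:
  assumes "zdeg_le D m" "degree D \<le> n" "m < T" "n < T"
    "\<And>i j. i < T \<Longrightarrow> j < T \<Longrightarrow> ev2 D (of_nat i) (of_nat j) = 0"
  shows "D = 0"
proof (rule ccontr)
  assume "D \<noteq> 0"
  then obtain z x :: nat where zx: "ev2 D (of_nat z) (of_nat x) \<noteq> 0" by (rule ev2_nonzero)
  have "ev2 D (of_nat i) (of_nat x) = 0" if "i < T" for i
    by (rule pf_eq_0[OF pf_ev2[OF assms(2), of "of_nat i"], of 0]) (use assms(4,5) that in auto)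
  hence "poly (poly D [:of_nat x:]) (of_nat (0 + i)) = 0" if "i \<le> m" for i
    using that assms(3) by (simp add: ev2_def)
  hence "poly D [:of_nat x:] = 0" by (rule poly_eq_0_nat[OF degree_eval_zdeg[OF assms(1)]])
  thus False using zx by (simp add: ev2_def)
qed

lemma ev2_diff [simp]: "ev2 (D - E) z x = ev2 D z x - ev2 E z x"
  by (simp add: ev2_def)

lemma ev2_grid_eq:
  assumes "zdeg_le D m" "zdeg_le E m" "degree D \<le> m" "degree E \<le> m" "m < T"
    "\<And>i j. i < T \<Longrightarrow> j < T \<Longrightarrow> ev2 D (of_nat i) (of_nat j) = ev2 E (of_nat i) (of_nat j)"
  shows "D = E"
proof -
  have "zdeg_le (- E) m" using assms(2) by (simp add: zdeg_le_def)
  hence "zdeg_le (D + - E) m" by (intro zdeg_le_add assms)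
  moreover have "degree (D + - E) \<le> m" by (intro degree_add_le) (use assms in auto)
  ultimately have "D + - E = 0"
    by (rule ev2_grid_eq_0[where T = T]) (use assms(5,6) in auto)
  thus ?thesis by (simp add: add_eq_0_iff)
qed

lemma poly_grid_eq_0: "degree f < T \<Longrightarrow> (\<And>i. i < T \<Longrightarrow> poly f (of_nat i) = (0::complex)) \<Longrightarrow> f = 0"
  using poly_eq_0_nat[of f "T - 1" 0] by force

lemma ex_nat_nonroot: "f \<noteq> 0 \<Longrightarrow> \<exists>i::nat. poly f (of_nat i) \<noteq> (0::complex)"
  using poly_eq_0_nat[of f _ 0, OF order_refl] by auto

lemma grid_iff: "degree f < T \<Longrightarrow> (\<forall>i<T. poly f (of_nat i) = (0::complex)) \<longleftrightarrow> f = 0"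
  using poly_grid_eq_0[of f T] by auto

lemma nonroot_iff: "(\<exists>i::nat. poly f (of_nat i) \<noteq> (0::complex)) \<longleftrightarrow> f \<noteq> 0"
  using ex_nat_nonroot[of f] by auto

lemma ev2_nonroot_iff: "(\<exists>i j::nat. ev2 A (of_nat i) (of_nat j) \<noteq> 0) \<longleftrightarrow> A \<noteq> 0"
proof
  assume "A \<noteq> 0"
  thus "\<exists>i j::nat. ev2 A (of_nat i) (of_nat j) \<noteq> 0" by (rule ev2_nonzero) blast
qed auto

lemma zdeg_le_pderiv: "zdeg_le G n \<Longrightarrow> zdeg_le (map_poly pderiv G) n"
  and zdeg_le_pderiv': "zdeg_le G n \<Longrightarrow> zdeg_le (pderiv G) n"
proof -
  show "zdeg_le G n \<Longrightarrow> zdeg_le (map_poly pderiv G) n"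
    by (auto simp: zdeg_le_def coeff_map_poly degree_pderiv intro: order_trans[OF diff_le_self])
  have "degree (of_nat k * r) \<le> n" if "degree r \<le> n" for k and r :: "complex poly"
    using that degree_mult_le[of "of_nat k" r] by simp
  thus "zdeg_le G n \<Longrightarrow> zdeg_le (pderiv G) n"
    by (auto simp: zdeg_le_def coeff_pderiv simp del: of_nat_Suc)
qed

lemma zdeg_le_vfield: "zdeg_le p n \<Longrightarrow> zdeg_le q n \<Longrightarrow> zdeg_le G m \<Longrightarrow> zdeg_le (vfield p q G) (n + m)"
  unfolding vfield_def by (intro zdeg_le_add zdeg_le_mult zdeg_le_pderiv zdeg_le_pderiv')

text \<open>Codes are padded with names of 0 to a prescribed length, since lengths serve as formal
  degrees.\<close>

lemma poly_code_exists:
  assumes "poly_over (range \<nu>) r" "degree r < n"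
  obtains a where "poly_of \<nu> a = r" "clength a = n"
proof -
  have "\<exists>c. \<nu> c = coeff r i" for i
  proof -
    have "coeff r i \<in> range \<nu>" using assms(1) by (simp add: poly_over_def)
    thus ?thesis by auto
  qed
  then obtain c where c: "\<And>i. \<nu> (c i) = coeff r i" by metis
  have "Poly (map \<nu> (map c [0..<n])) = r"
    using assms(2) by (intro poly_eqI) (auto simp: nth_default_def c coeff_eq_0)
  thus thesis by (intro that[of "list_encode (map c [0..<n])"]) (simp_all add: poly_of_def)
qed

lemma poly2_code_exists:
  assumes "poly2_over (range \<nu>) P" "degree P < n" "zdeg_le P N"
  obtains a where "poly2_of \<nu> a = P" "clength a = n" "czdeg a N"
proof -
  have "\<exists>c. poly_of \<nu> c = coeff P i \<and> clength c = Suc N" for i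
    by (rule poly_code_exists[of \<nu> "coeff P i" "Suc N"])
      (use assms in \<open>auto simp: poly2_over_def zdeg_le_def less_Suc_eq_le\<close>)
  then obtain c where c: "\<And>i. poly_of \<nu> (c i) = coeff P i" "\<And>i. clength (c i) = Suc N" by metis
  have "Poly (map (poly_of \<nu>) (map c [0..<n])) = P"
    using assms(2) by (intro poly_eqI) (auto simp: nth_default_def c coeff_eq_0)
  thus thesis
    by (intro that[of "list_encode (map c [0..<n])"]) (auto simp: poly2_of_def czdeg_def c)
qed

lemma poly_over_poly_of: "csubfield (range \<nu>) \<Longrightarrow> poly_over (range \<nu>) (poly_of \<nu> n)"
  by (auto simp: poly_over_def poly_of_def nth_default_def csubfield_0)

lemma poly2_over_poly2_of: "csubfield (range \<nu>) \<Longrightarrow> poly2_over (range \<nu>) (poly2_of \<nu> n)"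
  by (auto simp: poly2_over_def poly2_of_def nth_default_def poly_over_poly_of poly_over_0)

lemma poly_over_eval: "csubfield K \<Longrightarrow> poly2_over K A \<Longrightarrow> c \<in> K \<Longrightarrow> poly_over K (poly A [:c:])"
proof -
  assume K: "csubfield K" "poly2_over K A" "c \<in> K"
  have "poly A [:c:] = (\<Sum>i\<le>degree A. coeff A i * monom (c ^ i) 0)"
    by (simp add: poly_altdef poly_const_pow monom_0)
  thus ?thesis using K
    by (auto simp: poly2_over_def intro!: poly_over_sum poly_over_mult poly_over_monom csubfield_power)
qed

section \<open>Meaning of the tested conditions\<close>

abbreviation slice :: "(nat \<Rightarrow> complex) \<Rightarrow> nat \<Rightarrow> nat \<Rightarrow> complex poly" where
  "slice \<nu> A c \<equiv> poly (poly2_of \<nu> A) [:\<nu> c:]"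

context
  fixes \<nu> p q g P Q
  assumes \<nu>: "acf_numbering \<nu>" and lens: "clength p = Suc g" "clength q = Suc g"
    and PQ: "P = poly2_of \<nu> p" "Q = poly2_of \<nu> q"
begin

lemma norb_val:
  "norb (diagram \<nu>) p q N z0 c A B \<longleftrightarrow> (\<forall>k\<le>2 * N. row False g P Q z0 k (\<nu> c) (slice \<nu> A c) (slice \<nu> B c) = 0)"
proof -
  have "\<nu> (psnd (norbit (diagram \<nu>) p q z0 c k)) = snd (orbit P Q g z0 (\<nu> c) k)"
    "\<nu> (pfst (norbit (diagram \<nu>) p q z0 c k)) = fst (orbit P Q g z0 (\<nu> c) k)" for k
    using norbit_val[OF \<nu> lens, of z0 c k, symmetric] by (simp_all add: PQ)
  thus ?thesis
    by (simp add: norb_def \<nu> nev2_val[OF \<nu>] row_def less_Suc_eq_le ev2_def)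
qed

text \<open>The iterates of \<open>vfield\<close> are polynomials, so they are guessed as the list
  \<open>G\<close> and verified through identities; orbits consist of numbers and are computed
  directly. The true iterates have coefficients in the numbered field, which guarantees a correct
  guess.\<close>

lemma nflow_val:
  "(\<exists>G. nflow (diagram \<nu>) p q N z0 c A B G) \<longleftrightarrow>
     (\<forall>k\<le>2 * N. row True g P Q z0 k (\<nu> c) (slice \<nu> A c) (slice \<nu> B c) = 0)"
proof
  define F where "F = [:slice \<nu> A c, - slice \<nu> B c:]"
  have evF: "ev2 F z w = ev2 (poly2_of \<nu> A) z (\<nu> c) - w * ev2 (poly2_of \<nu> B) z (\<nu> c)" for z w
    by (simp add: F_def ev2_def)
  have degF: "degree F \<le> 1" by (simp add: F_def)
  have zdegF: "zdeg_le F (A + B)"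
    using degree_eval_zdeg[OF zdeg_poly2_of, of \<nu> A "\<nu> c"] degree_eval_zdeg[OF zdeg_poly2_of, of \<nu> B "\<nu> c"]
    by (auto simp: zdeg_le_def F_def coeff_pCons split: nat.splits)
  {
    assume "\<exists>G. nflow (diagram \<nu>) p q N z0 c A B G"
    then obtain G where G: "nflow (diagram \<nu>) p q N z0 c A B G" ..
    define T where "T = p + q + A + B + G + 2"
    define H where "H k = poly2_of \<nu> (cnth G k)" for k
    \<comment> \<open>The entries of the list coded by \<open>G\<close> have codes at most
      \<open>G\<close>; this bounds all degrees uniformly, with no estimate of their growth in
      \<open>k\<close>.\<close>
    have H: "zdeg_le (H k) G" "degree (H k) \<le> G" for k
      using zdeg_le_mono[OF zdeg_poly2_of[of \<nu> "cnth G k"]] degree_poly2_of[of \<nu> "cnth G k"] cnth_le[of G k]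
      by (auto simp: H_def)
    have "H k = (vfield P Q ^^ k) F" if "k \<le> 2 * N" for k
      using that
    proof (induction k)
      case 0
      show ?case
      proof (rule ev2_grid_eq)
        show "zdeg_le (H 0) (A + B + G + 1)" "zdeg_le ((vfield P Q ^^ 0) F) (A + B + G + 1)"
          using zdeg_le_mono[OF H(1)] zdeg_le_mono[OF zdegF] by auto
        show "degree (H 0) \<le> A + B + G + 1" "degree ((vfield P Q ^^ 0) F) \<le> A + B + G + 1"
          using H(2)[of 0] degF by auto
        show "A + B + G + 1 < T" by (simp add: T_def)
        show "ev2 (H 0) (of_nat i) (of_nat j) = ev2 ((vfield P Q ^^ 0) F) (of_nat i) (of_nat j)"
          if "i < T" "j < T" for i j
          using G that unfolding nflow_def T_def[symmetric]
          by (simp add: \<nu> nev2_val[OF \<nu>] H_def evF algebra_simps)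
      qed
    next
      case (Suc k)
      have "H (Suc k) = vfield P Q (H k)"
      proof (rule ev2_grid_eq)
        have PQd: "zdeg_le P (p + q)" "zdeg_le Q (p + q)" "degree P \<le> p + q" "degree Q \<le> p + q"
          using zdeg_le_mono[OF zdeg_poly2_of[of \<nu> p]] zdeg_le_mono[OF zdeg_poly2_of[of \<nu> q]]
            degree_poly2_of[of \<nu> p] degree_poly2_of[of \<nu> q] by (auto simp: PQ)
        show "zdeg_le (H (Suc k)) (p + q + G)" "zdeg_le (vfield P Q (H k)) (p + q + G)"
          using zdeg_le_mono[OF H(1)] zdeg_le_vfield[OF PQd(1,2) H(1)] by auto
        show "degree (H (Suc k)) \<le> p + q + G" "degree (vfield P Q (H k)) \<le> p + q + G"
          using H(2)[of "Suc k"] H(2)[of k] degree_vfield_le[OF PQd(3,4), of 1 "H k"] by auto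
        show "p + q + G < T" by (simp add: T_def)
        show "ev2 (H (Suc k)) (of_nat i) (of_nat j) = ev2 (vfield P Q (H k)) (of_nat i) (of_nat j)"
          if "i < T" "j < T" for i j
          using G that Suc.prems unfolding nflow_def T_def[symmetric]
          by (simp add: \<nu> nev2_val[OF \<nu>] nev2z_val[OF \<nu>] nev2w_val[OF \<nu>] H_def vfield_def PQ)
      qed
      thus ?case using Suc by simp
    qed
    moreover have "ev2 (H k) (of_nat z0) (\<nu> c) = 0" if "k \<le> 2 * N" for k
      using G that by (simp add: nflow_def \<nu> nev2_val[OF \<nu>] H_def less_Suc_eq_le)
    ultimately show "\<forall>k\<le>2 * N. row True g P Q z0 k (\<nu> c) (slice \<nu> A c) (slice \<nu> B c) = 0"
      by (simp add: row_def F_def)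
  }
  {
    assume rows: "\<forall>k\<le>2 * N. row True g P Q z0 k (\<nu> c) (slice \<nu> A c) (slice \<nu> B c) = 0"
    note K = csubfield_range[OF \<nu>]
    have "poly2_over (range \<nu>) ((vfield P Q ^^ k) F)" for k
      unfolding F_def PQ
      by (intro poly2_over_vfield_funpow[OF K] poly2_over_poly2_of[OF K] poly2_over_linear[OF K]
          poly_over_eval[OF K] rangeI)
    hence "\<exists>a. poly2_of \<nu> a = (vfield P Q ^^ k) F" for k
      using zdeg_le_exists by (meson lessI poly2_code_exists)
    then obtain h where h: "\<And>k. poly2_of \<nu> (h k) = (vfield P Q ^^ k) F" by metis
    define G where "G = list_encode (map h [0..<Suc (2 * N)])"
    have "cnth G k = h k" if "k \<le> 2 * N" for k
      using that cnth_nth[of k G] by (simp add: G_def del: upt_Suc)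
    hence Gk: "poly2_of \<nu> (cnth G k) = (vfield P Q ^^ k) F" if "k \<le> 2 * N" for k using that h by simp
    have "nflow (diagram \<nu>) p q N z0 c A B G"
      unfolding nflow_def using rows
      by (simp add: \<nu> nev2_val[OF \<nu>] nev2z_val[OF \<nu>] nev2w_val[OF \<nu>] Gk evF vfield_def PQ row_def
          less_Suc_eq_le F_def[symmetric])
    thus "\<exists>G. nflow (diagram \<nu>) p q N z0 c A B G" ..
  }
qed

lemma nker_val:
  "nker ode (diagram \<nu>) p q N z0 c A B \<longleftrightarrow> czdeg A N \<and> czdeg B N \<and>
     (\<forall>k\<le>2 * N. row ode g P Q z0 k (\<nu> c) (slice \<nu> A c) (slice \<nu> B c) = 0)"
  by (cases ode) (simp_all add: nker_def norb_val nflow_val)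

lemma nhead_val:
  "\<nu> (nhead (diagram \<nu>) A B s z x) = headf (poly2_of \<nu> A) (poly2_of \<nu> B) (\<nu> s) (\<nu> z) (\<nu> x)"
  by (simp add: nhead_def headf_def \<nu> nev2_val[OF \<nu>])

lemma ndefect_val:
  "\<nu> (ndefect ode (diagram \<nu>) p q A B z x) = defectf ode g P Q (poly2_of \<nu> A) (poly2_of \<nu> B) (\<nu> z) (\<nu> x)"
  by (cases ode) (simp_all add: ndefect_def defectf_eq \<nu> nev2_val[OF \<nu>] nev2z_val[OF \<nu>]
      nhev_val[OF \<nu> lens(1)] nhev_val[OF \<nu> lens(2)] power2_eq_square PQ)

lemma poly2_of_sing: "poly2_of \<nu> (sing a) = [:poly_of \<nu> a:]"
  by (simp add: poly2_of_def)

lemma ndefect_sing_val: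
  "\<nu> (ndefect ode (diagram \<nu>) p q (sing a) (sing b) z x) = poly (defect ode g P Q (poly_of \<nu> a) (poly_of \<nu> b)) (\<nu> z)"
  by (simp add: ndefect_val poly2_of_sing defectf_def)

lemma nden_val: "\<nu> (nden (diagram \<nu>) q a b i) =
   poly (poly_of \<nu> b * hpoly (\<lambda>x. x) g Q (poly_of \<nu> a) (poly_of \<nu> b)) (of_nat i)"
  by (simp add: nden_def \<nu> neval_val[OF \<nu>] nhev_val[OF \<nu> lens(2)] hpoly_eval_poly PQ)

lemma degree_sol_polys:
  "degree (defect ode g P Q (poly_of \<nu> a) (poly_of \<nu> b)) < tsol p q a b"
  "degree (poly_of \<nu> b * hpoly (\<lambda>x. x) g Q (poly_of \<nu> a) (poly_of \<nu> b)) < tsol p q a b"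
proof -
  define S M where "S = a + b" and "M = p + q"
  have gM: "g \<le> M" using lens clength_le[of p] by (simp add: M_def)
  have ab: "degree (poly_of \<nu> a) \<le> S" "degree (poly_of \<nu> b) \<le> S"
    using degree_poly_of[of \<nu> a] degree_poly_of[of \<nu> b] by (auto simp: S_def)
  have h: "degree (hpoly (\<lambda>x. x) g R (poly_of \<nu> a) (poly_of \<nu> b)) \<le> M + M * S"
    if "zdeg_le R M" for R
  proof -
    have "degree (hpoly (\<lambda>x. x) g R (poly_of \<nu> a) (poly_of \<nu> b)) \<le> M + g * S"
      using that by (intro degree_hpoly_le ab) (simp add: zdeg_le_def)
    also have "\<dots> \<le> M + M * S" using gM by simp
    finally show ?thesis .
  qed
  have z: "zdeg_le P M" "zdeg_le Q M"
    using zdeg_le_mono[OF zdeg_poly2_of[of \<nu> p]] zdeg_le_mono[OF zdeg_poly2_of[of \<nu> q]]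
    by (auto simp: M_def PQ)
  have e: "edeg ode * S \<le> 2 * S" by (simp add: edeg_def)
  have t: "tsol p q a b = Suc (2 * S + (M + M * S))" by (simp add: tsol_def S_def M_def algebra_simps)
  have "degree (defect ode g P Q (poly_of \<nu> a) (poly_of \<nu> b)) \<le> 2 * S + (M + M * S)"
    unfolding defect_def
    by (intro degree_diff_le order_trans[OF degree_mult_le] add_mono h z order_trans[OF degree_step_le(1)[OF ab] e]
        order_trans[OF degree_step_le(2)[OF ab] e])
  thus "degree (defect ode g P Q (poly_of \<nu> a) (poly_of \<nu> b)) < tsol p q a b" by (simp add: t)
  have "degree (poly_of \<nu> b * hpoly (\<lambda>x. x) g Q (poly_of \<nu> a) (poly_of \<nu> b)) \<le> 2 * S + (M + M * S)"
    by (intro order_trans[OF degree_mult_le] add_mono h z order_trans[OF ab(2)]) simp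
  thus "degree (poly_of \<nu> b * hpoly (\<lambda>x. x) g Q (poly_of \<nu> a) (poly_of \<nu> b)) < tsol p q a b" by (simp add: t)
qed

lemma nsol_val: "nsol ode (diagram \<nu>) p q a b \<longleftrightarrow> is_sol ode g P Q (poly_of \<nu> a) (poly_of \<nu> b)"
  unfolding nsol_def neq_val[OF \<nu>] nden_val ndefect_sing_val nzero_val[OF \<nu>] nnat_val[OF \<nu>]
    grid_iff[OF degree_sol_polys(1)] nonroot_iff
  by (auto simp: is_sol_def)

lemma nnot_val: "nnot ode (diagram \<nu>) p q a b \<longleftrightarrow> \<not> is_sol ode g P Q (poly_of \<nu> a) (poly_of \<nu> b)"
  unfolding nnot_def neq_val[OF \<nu>] nden_val ndefect_sing_val nzero_val[OF \<nu>] nnat_val[OF \<nu>]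
    grid_iff[OF degree_sol_polys(2)] nonroot_iff
  by (auto simp: is_sol_def)

lemma cand_val:
  "cand ode (diagram \<nu>) p q L a b \<longleftrightarrow> (poly_of \<nu> a \<noteq> 0 \<or> poly_of \<nu> b \<noteq> 0) \<and>
     (is_sol ode g P Q (poly_of \<nu> a) (poly_of \<nu> b) \<longrightarrow> prod_encode (a, b) \<in> set (list_decode L))"
  unfolding cand_def nnot_val neq_val[OF \<nu>] neval_val[OF \<nu>] nzero_val[OF \<nu>] nnat_val[OF \<nu>]
    ex_disj_distrib nonroot_iff by auto

end

section \<open>Named roots and the completeness of certified lists\<close>

lemma pf_eq:
  assumes "pf m f" "pf m h" "\<And>i. i \<le> m \<Longrightarrow> f (of_nat i) = h (of_nat i)"
  shows "f x = h x"
  using pf_eq_0[OF pf_diff[OF assms(1,2)], of 0 x] assms(3) by simp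

lemma pf_prod_list: "pf (length cs) (\<lambda>x. e * (\<Prod>c\<leftarrow>cs. x - \<nu> c))"
proof (induction cs)
  case (Cons c cs)
  have "pf (1 + length cs) (\<lambda>x. (x - \<nu> c) * (e * (\<Prod>c\<leftarrow>cs. x - \<nu> c)))"
    by (intro pf_mult pf_diff pf_id pf_const Cons.IH) simp
  thus ?case by (simp add: mult_ac)
qed (simp add: pf_const)

text \<open>Dividing \<open>f\<close> minus its value at \<open>m\<close> by the linear factor for
  \<open>m\<close> gives a quotient of smaller degree whose values at larger integers are difference
  quotients in \<open>K\<close>. Raising \<open>m\<close> in the induction keeps the divisor
  nonzero.\<close>

lemma poly_over_if_nat_values:
  assumes K: "csubfield K" and "\<And>k. m \<le> k \<Longrightarrow> poly f (of_nat k) \<in> K"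
  shows "poly_over K f"
  using assms(2)
proof (induction "degree f" arbitrary: f m)
  case 0
  then obtain c where "f = [:c:]" by (metis degree_eq_zeroE)
  thus ?case using 0(2)[of m] K by (auto simp: poly_over_def coeff_pCons csubfield_0 split: nat.splits)
next
  case (Suc n)
  define h where "h = synthetic_div f (of_nat m)"
  have f: "[:- of_nat m, 1:] * h + [:poly f (of_nat m):] = f"
    unfolding h_def by (rule synthetic_div_correct')
  have "poly_over K h"
  proof (rule Suc.hyps(1))
    show "n = degree h" using Suc.hyps(2) by (simp add: h_def degree_synthetic_div)
    fix k assume k: "Suc m \<le> k"
    have "poly f (of_nat k) = (of_nat k - of_nat m) * poly h (of_nat k) + poly f (of_nat m)"
      by (subst f[symmetric]) (simp add: algebra_simps)
    moreover have "of_nat k - of_nat m \<noteq> (0 :: complex)" using k by simp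
    ultimately have "poly h (of_nat k) = (poly f (of_nat k) - poly f (of_nat m)) / (of_nat k - of_nat m)"
      by (simp add: field_simps)
    thus "poly h (of_nat k) \<in> K"
      using Suc.prems k by (auto intro!: csubfield_divide[OF K] csubfield_diff[OF K] csubfield_of_nat[OF K])
  qed
  moreover have "poly_over K [:- of_nat m, 1:]" "poly_over K [:poly f (of_nat m):]"
    using Suc.prems[of m] by (auto simp: poly_over_def coeff_pCons csubfield_0[OF K] csubfield_1[OF K]
        intro: csubfield_minus[OF K] csubfield_of_nat[OF K] split: nat.splits)
  ultimately show ?case by (subst f[symmetric]) (intro poly_over_add[OF K] poly_over_mult[OF K])
qed

lemma acf_factorization:
  assumes \<nu>: "acf_numbering \<nu>" and f: "poly_over (range \<nu>) f" "f \<noteq> 0"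
  obtains e cs where "\<nu> e \<noteq> 0" "\<And>x. poly f x = \<nu> e * (\<Prod>c\<leftarrow>cs. x - \<nu> c)"
proof -
  obtain A where A: "size A = degree f" "f = smult (lead_coeff f) (\<Prod>x\<in>#A. [:- x, 1:])"
    using alg_closed_imp_factorization[OF f(2)] by metis
  obtain xs where xs: "mset xs = A" using ex_mset by blast
  have val: "poly f x = lead_coeff f * (\<Prod>c\<leftarrow>xs. x - c)" for x
  proof -
    have "(\<Prod>x\<in>#A. [:- x, 1:]) = (\<Prod>c\<leftarrow>xs. [:- c, 1:])"
      unfolding xs[symmetric] by (simp flip: prod_mset_prod_list)
    moreover have "poly (\<Prod>c\<leftarrow>xs. [:- c, 1:]) x = (\<Prod>c\<leftarrow>xs. x - c)"
      by (induction xs) (auto simp: algebra_simps)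
    ultimately show ?thesis by (subst A(2)) simp
  qed
  have "\<exists>c. \<nu> c = x" if "x \<in> set xs" for x
  proof -
    have "poly f x = 0" unfolding val using that by (auto simp: prod_list_zero_iff)
    moreover have "set (coeffs f) \<subseteq> range \<nu>" using f(1) by (auto simp: poly_over_def coeffs_def)
    ultimately have "x \<in> range \<nu>" using \<nu> f(2) unfolding acf_numbering_def by blast
    thus ?thesis by auto
  qed
  then obtain cs where cs: "map \<nu> cs = xs" by (metis ex_map_conv)
  have "lead_coeff f \<in> range \<nu>" using f(1) by (simp add: poly_over_def)
  then obtain e where "\<nu> e = lead_coeff f" by auto
  thus thesis using f(2) val by (intro that[of e cs]) (simp_all add: o_def flip: cs)
qed

context
  fixes \<nu> p q g P Q ode M
  assumes \<nu>: "acf_numbering \<nu>" and lens: "clength p = Suc g" "clength q = Suc g"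
    and PQ: "P = poly2_of \<nu> p" "Q = poly2_of \<nu> q" and M: "M = p + q"
    and rc: "rcoprime P Q" and dM: "edeg ode < max (degree P) (degree Q)"
begin

lemmas cv = nker_val[OF \<nu> lens PQ] nhead_val[OF \<nu> lens PQ] ndefect_val[OF \<nu> lens PQ]
  cand_val[OF \<nu> lens PQ] neq_val[OF \<nu>] nzero_val[OF \<nu>] nnat_val[OF \<nu>] nmul_val[OF \<nu>]
  nprod_val[OF \<nu>] nev2_val[OF \<nu>] neval_val[OF \<nu>]

lemma size_bounds: "degree P \<le> g" "degree Q \<le> g" "0 < g" "g \<le> M" "zdeg_le P M" "zdeg_le Q M"
  "degree P \<le> M" "degree Q \<le> M"
proof -
  show "degree P \<le> g" "degree Q \<le> g"
    using degree_poly2_of_clength[of \<nu> p] degree_poly2_of_clength[of \<nu> q] lens by (simp_all add: PQ)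
  thus "0 < g" using dM by auto
  show "g \<le> M" using clength_le[of p] lens by (simp add: M)
  show "zdeg_le P M" "zdeg_le Q M"
    using zdeg_le_mono[OF zdeg_poly2_of[of \<nu> p]] zdeg_le_mono[OF zdeg_poly2_of[of \<nu> q]] by (auto simp: M PQ)
  show "degree P \<le> M" "degree Q \<le> M"
    using degree_poly2_of[of \<nu> p] degree_poly2_of[of \<nu> q] by (auto simp: M PQ)
qed

text \<open>The value \<open>c0\<close> of \<open>f\<close> at the start is not assumed to have a
  name. Identities tested at integers extend to it by their degree in the parameter, and then either
  it is one of the named roots or \<open>f\<close> is the named extra candidate.\<close>

lemma complete_sound:
  assumes rep: "P * den2 R = num2 R * Q" and comp: "complete ode (diagram \<nu>) p q L"
    and f: "f \<in> solutions ode R"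
  shows "f \<in> ratfun_of \<nu> ` set (list_decode L)"
proof -
  note ctx = rep rc dM size_bounds(1,2,4,5,6)
  obtain z0 where z0: "z0 \<le> Zb M" "admissible ode R P Q M z0 f"
    by (rule admissible_start[OF ctx f])
  define N where "N = Nb M"
  from comp z0(1) obtain A B s z2 cs e where cov:
    "covered ode (diagram \<nu>) p q L N (Suc ((M + 3) * (A + B) + rho ode M N + cs)) z0 A B s z2 cs e"
    unfolding complete_def M[symmetric] N_def by (meson le_imp_less_Suc)
  define T where "T = Suc ((M + 3) * (A + B) + rho ode M N + cs)"
  define D where "D = A + B"
  define A' B' where "A' = poly2_of \<nu> A" and "B' = poly2_of \<nu> B"
  have degAB: "degree A' \<le> D" "degree B' \<le> D"
    using degree_poly2_of[of \<nu> A] degree_poly2_of[of \<nu> B] by (auto simp: A'_def B'_def D_def)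
  note cov' = cov[unfolded covered_def cv, folded A'_def B'_def T_def]
  have T: "D \<le> T - 1" "D + rho ode M N \<le> T - 1" "(M + 3) * D \<le> T - 1" "cs \<le> T - 1" "0 < T"
    by (simp_all add: T_def D_def algebra_simps)
  define c0 where "c0 = fval z0 f"
  have czd: "czdeg A N" "czdeg B N" using cov' T(5) by blast+
  have rows: "row ode g P Q z0 k c0 (poly A' [:c0:]) (poly B' [:c0:]) = 0" if k: "k \<le> 2 * N" for k
  proof (rule pf_eq[where h = "\<lambda>_. 0" and x = c0 and
        f = "\<lambda>x. row ode g P Q z0 k x (poly A' [:x:]) (poly B' [:x:])"])
    show "pf (D + rho ode M N) (\<lambda>x. row ode g P Q z0 k x (poly A' [:x:]) (poly B' [:x:]))"
      by (rule pf_row_family[OF size_bounds(7,8,3,4) k degAB])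
    show "row ode g P Q z0 k (of_nat i) (poly A' [:of_nat i:]) (poly B' [:of_nat i:]) = 0"
      if "i \<le> D + rho ode M N" for i
      using cov' k that T by (auto simp: A'_def B'_def)
  qed (rule pf_const)
  have deg: "degree (poly A' [:x:]) \<le> N" "degree (poly B' [:x:]) \<le> N" for x
    using czd by (auto simp: A'_def B'_def intro!: degree_eval_zdeg zdeg_poly2_of_czdeg)
  have pr: "fnum f * poly B' [:c0:] = fden f * poly A' [:c0:]"
    using rows deg unfolding N_def c0_def by (intro admissible_determined[OF ctx z0(2)]) auto
  have sol: "is_sol ode g P Q (fnum f) (fden f)"
    using f by (simp add: solution_is_sol[OF ctx])
  have in_L: "f \<in> ratfun_of \<nu> ` set (list_decode L)"
    if "fnum f * poly_of \<nu> b = fden f * poly_of \<nu> a" "poly_of \<nu> a \<noteq> 0 \<or> poly_of \<nu> b \<noteq> 0"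
      "is_sol ode g P Q (poly_of \<nu> a) (poly_of \<nu> b) \<longrightarrow> prod_encode (a, b) \<in> set (list_decode L)" for a b
  proof -
    note frac = proportional_Fract[OF that(1) fnum_fden(2) that(2)]
    have "is_sol ode g P Q (poly_of \<nu> a) (poly_of \<nu> b)"
      by (rule is_sol_proportional[OF sol that(1) frac(1)])
    moreover have "ratfun_of \<nu> (prod_encode (a, b)) = f"
      using frac(2) by (simp add: ratfun_of_def fnum_fden)
    ultimately show ?thesis using that(3) by (intro image_eqI[of _ _ "prod_encode (a, b)"]) auto
  qed
  define h where "h = headf A' B' (\<nu> s) (\<nu> z2)"
  define root_pf where "root_pf x = \<nu> e * (\<Prod>c\<leftarrow>list_decode cs. x - \<nu> c)" for x
  have pfh: "pf D h" unfolding h_def by (intro pf_headf degAB)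
  have pf_root_pf: "pf cs root_pf" unfolding root_pf_def by (rule pf_mono[OF pf_prod_list clength_le])
  have h_nz: "poly A' [:x:] \<noteq> 0 \<or> poly B' [:x:] \<noteq> 0" if "h x \<noteq> 0" for x
    using that by (auto simp: h_def headf_def ev2_def)
  \<comment> \<open>At a listed root the certificate provides a nonzero solution of the linear
    conditions; it represents \<open>f\<close>, hence it solves the equation and must be
    listed.\<close>
  have root: ?thesis if pr0: "root_pf c0 = 0"
  proof -
    have "\<nu> e \<noteq> 0" using cov' by simp
    then obtain c where c: "c \<in> set (list_decode cs)" "\<nu> c = c0"
      using pr0 by (auto simp: root_pf_def prod_list_zero_iff)
    then obtain a b where ab: "czdeg (sing a) N" "czdeg (sing b) N"
      "\<And>k. k \<le> 2 * N \<Longrightarrow> row ode g P Q z0 k c0 (poly_of \<nu> a) (poly_of \<nu> b) = 0"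
      "poly_of \<nu> a \<noteq> 0 \<or> poly_of \<nu> b \<noteq> 0"
      "is_sol ode g P Q (poly_of \<nu> a) (poly_of \<nu> b) \<longrightarrow> prod_encode (a, b) \<in> set (list_decode L)"
      using cov' by (auto simp: poly2_of_sing[OF \<nu> lens PQ])
    have "degree (poly_of \<nu> a) \<le> N" "degree (poly_of \<nu> b) \<le> N"
      using ab(1,2) degree_poly_of_clength[of \<nu> a] degree_poly_of_clength[of \<nu> b]
      by (auto simp: czdeg_def)
    hence "fnum f * poly_of \<nu> b = fden f * poly_of \<nu> a"
      using ab(3) unfolding N_def c0_def by (intro admissible_determined[OF ctx z0(2)]) auto
    thus ?thesis by (rule in_L) (use ab in auto)
  qed
  consider z1 where "\<And>i. i < T \<Longrightarrow> h (of_nat i) * defectf ode g P Q A' B' (of_nat z1) (of_nat i) = root_pf (of_nat i)"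
    | a b where "\<And>i. i < T \<Longrightarrow> h (of_nat i) = root_pf (of_nat i)"
      "\<And>i j. i < T \<Longrightarrow> j < A + B + a + b + 1 \<Longrightarrow>
         ev2 A' (of_nat j) (of_nat i) * poly (poly_of \<nu> b) (of_nat j) =
         ev2 B' (of_nat j) (of_nat i) * poly (poly_of \<nu> a) (of_nat j)"
      "poly_of \<nu> a \<noteq> 0 \<or> poly_of \<nu> b \<noteq> 0"
      "is_sol ode g P Q (poly_of \<nu> a) (poly_of \<nu> b) \<longrightarrow> prod_encode (a, b) \<in> set (list_decode L)"
    using cov' unfolding h_def root_pf_def by blast
  thus ?thesis
  proof cases
    case 1
    have "(g + 2) * D + D \<le> (M + 3) * D" using size_bounds(4) by (simp add: algebra_simps)
    hence pfa: "pf (T - 1) (\<lambda>x. h x * defectf ode g P Q A' B' (of_nat z1) x)"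
      using T by (intro pf_mono[OF pf_mult[OF pfh pf_defectf[OF degAB]]]) linarith
    have eq: "h c0 * defectf ode g P Q A' B' (of_nat z1) c0 = root_pf c0"
      by (rule pf_eq[OF pfa pf_mono[OF pf_root_pf T(4)]]) (use 1 T(5) in auto)
    show ?thesis
    proof (cases "h c0 = 0")
      case False
      have "is_sol ode g P Q (poly A' [:c0:]) (poly B' [:c0:])"
        by (rule is_sol_proportional[OF sol pr proportional_Fract(1)[OF pr fnum_fden(2) h_nz[OF False]]])
      hence "defectf ode g P Q A' B' (of_nat z1) c0 = 0" by (simp add: is_sol_def defectf_def)
      thus ?thesis using eq root by simp
    qed (use eq root in simp)
  next
    case 2
    have eq: "h c0 = root_pf c0"
      by (rule pf_eq[OF pf_mono[OF pfh T(1)] pf_mono[OF pf_root_pf T(4)]]) (use 2(1) T(5) in auto)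
    show ?thesis
    proof (cases "h c0 = 0")
      case False
      define F where "F = poly A' [:c0:] * poly_of \<nu> b - poly B' [:c0:] * poly_of \<nu> a"
      have "F = 0"
      proof (rule poly_grid_eq_0[of _ "A + B + a + b + 1"])
        have z: "degree (poly A' [:c0:]) \<le> A" "degree (poly B' [:c0:]) \<le> B"
          unfolding A'_def B'_def by (intro degree_eval_zdeg zdeg_poly2_of)+
        have "degree F \<le> A + B + a + b"
          unfolding F_def using z degree_poly_of[of \<nu> a] degree_poly_of[of \<nu> b]
          by (intro degree_diff_le order_trans[OF degree_mult_le]) linarith+
        thus "degree F < A + B + a + b + 1" by simp
        fix j assume j: "j < A + B + a + b + 1"
        have "ev2 A' (of_nat j) c0 * poly (poly_of \<nu> b) (of_nat j) =
            ev2 B' (of_nat j) c0 * poly (poly_of \<nu> a) (of_nat j)"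
        proof (rule pf_eq[where x = c0 and f = "\<lambda>x. ev2 A' (of_nat j) x * poly (poly_of \<nu> b) (of_nat j)"
              and h = "\<lambda>x. ev2 B' (of_nat j) x * poly (poly_of \<nu> a) (of_nat j)"])
          show "pf (D + 0) (\<lambda>x. ev2 A' (of_nat j) x * poly (poly_of \<nu> b) (of_nat j))"
            "pf (D + 0) (\<lambda>x. ev2 B' (of_nat j) x * poly (poly_of \<nu> a) (of_nat j))"
            by (intro pf_mult pf_ev2 pf_const degAB)+
        qed (use 2(2) j T in auto)
        thus "poly F (of_nat j) = 0" by (simp add: F_def ev2_def)
      qed
      hence "poly A' [:c0:] * poly_of \<nu> b = poly B' [:c0:] * poly_of \<nu> a" by (simp add: F_def)
      from constant_family_proportional[OF pr fnum_fden(2) h_nz[OF False] this]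
      show ?thesis by (rule in_L) (use 2 in auto)
    qed (use eq root in simp)
  qed
qed

text \<open>The candidates form a finite set \<open>X\<close> chosen before \<open>L\<close>, so
  that one list can serve all starting points. The bound \<open>T\<close> is arbitrary because the
  identities hold at every integer.\<close>

lemma covered_exists:
  "\<exists>X. finite X \<and> (\<forall>L. (\<forall>x\<in>X. is_sol ode g P Q (poly_of \<nu> (pfst x)) (poly_of \<nu> (psnd x)) \<longrightarrow>
       x \<in> set (list_decode L)) \<longrightarrow>
     (\<exists>A B s z2 cs e. covered ode (diagram \<nu>) p q L N (T A B cs) z0 A B s z2 cs e))"
proof -
  note K = csubfield_range[OF \<nu>]
  have PK: "poly2_over (range \<nu>) P" "poly2_over (range \<nu>) Q"
    unfolding PQ by (intro poly2_over_poly2_of[OF K])+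
  obtain A' B' where AB': "poly2_over (range \<nu>) A'" "poly2_over (range \<nu>) B'"
    "zdeg_le A' N" "zdeg_le B' N" "A' \<noteq> 0 \<or> B' \<noteq> 0"
    "\<And>k c. k \<le> 2 * N \<Longrightarrow> row ode g P Q z0 k c (poly A' [:c:]) (poly B' [:c:]) = 0"
    by (rule generic_kernel[OF K PK size_bounds(7,8,3,4) refl]) (rule that)
  obtain A where A: "poly2_of \<nu> A = A'" "czdeg A N" using poly2_code_exists[OF AB'(1) lessI AB'(3)] by metis
  obtain B where B: "poly2_of \<nu> B = B'" "czdeg B N" using poly2_code_exists[OF AB'(2) lessI AB'(4)] by metis
  obtain s z2 x2 :: nat where h: "headf A' B' (of_nat s) (of_nat z2) (of_nat x2) \<noteq> 0"
    using headf_nonzero[OF AB'(5)] .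
  define ns nz2 where "ns = nnat (diagram \<nu>) s" and "nz2 = nnat (diagram \<nu>) z2"
  have ns: "\<nu> ns = of_nat s" "\<nu> nz2 = of_nat z2" by (simp_all add: ns_def nz2_def \<nu>)
  let ?h = "headf A' B' (of_nat s) (of_nat z2)"
  have pfh: "pf (max (degree A') (degree B')) ?h" by (intro pf_headf) auto
  have hK: "?h (of_nat i) \<in> range \<nu>" for i
    using nhead_val[OF \<nu> lens PQ, of A B ns nz2 "nnat (diagram \<nu>) i"] ns by (metis A(1) B(1) nnat_val[OF \<nu>] rangeI)
  have EK: "defectf ode g P Q A' B' (of_nat z) (of_nat i) \<in> range \<nu>" for z i
    using ndefect_val[OF \<nu> lens PQ, of ode A B "nnat (diagram \<nu>) z" "nnat (diagram \<nu>) i"]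
    by (metis A(1) B(1) nnat_val[OF \<nu>] rangeI)
  \<comment> \<open>Values in the numbered field at the integers force coefficients in it, and
    algebraic closedness then supplies names for the roots.\<close>
  have roots: "\<exists>e cs. \<nu> e \<noteq> 0 \<and> (\<forall>x. w x = \<nu> e * (\<Prod>c\<leftarrow>cs. x - \<nu> c))"
    if w: "pf n w" "\<And>i::nat. w (of_nat i) \<in> range \<nu>" "w x \<noteq> 0" for n w x
  proof -
    obtain f where f: "\<And>x. w x = poly f x" using w(1) by (auto simp: pf_def)
    have "poly_over (range \<nu>) f"
      by (rule poly_over_if_nat_values[OF K, of 0]) (use w(2) f in simp)
    moreover have "f \<noteq> 0" using w(3) f by auto
    ultimately obtain e cs where "\<nu> e \<noteq> 0" "\<And>x. poly f x = \<nu> e * (\<Prod>c\<leftarrow>cs. x - \<nu> c)"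
      by (rule acf_factorization[OF \<nu>]) (rule that)
    thus ?thesis using f by auto
  qed
  have ker: "\<exists>x. nker ode (diagram \<nu>) p q N z0 c (sing (pfst x)) (sing (psnd x)) \<and>
      (poly_of \<nu> (pfst x) \<noteq> 0 \<or> poly_of \<nu> (psnd x) \<noteq> 0)" for c
  proof -
    obtain a' b' where ab': "poly_over (range \<nu>) a'" "poly_over (range \<nu>) b'" "degree a' \<le> N" "degree b' \<le> N"
      "a' \<noteq> 0 \<or> b' \<noteq> 0" "\<And>k. k \<le> 2 * N \<Longrightarrow> row ode g P Q z0 k (\<nu> c) a' b' = 0"
      by (rule pointwise_kernel[OF K PK rangeI]) (rule that)
    obtain a where a: "poly_of \<nu> a = a'" "clength a = Suc N"
      using poly_code_exists[OF ab'(1), of "Suc N"] ab'(3) by (metis less_Suc_eq_le)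
    obtain b where b: "poly_of \<nu> b = b'" "clength b = Suc N"
      using poly_code_exists[OF ab'(2), of "Suc N"] ab'(4) by (metis less_Suc_eq_le)
    show ?thesis
      by (rule exI[of _ "prod_encode (a, b)"])
        (use ab' a b in \<open>simp add: cv czdeg_def poly2_of_sing[OF \<nu> lens PQ]\<close>)
  qed
  then obtain kf where kf: "\<And>c. nker ode (diagram \<nu>) p q N z0 c (sing (pfst (kf c))) (sing (psnd (kf c)))"
    "\<And>c. poly_of \<nu> (pfst (kf c)) \<noteq> 0 \<or> poly_of \<nu> (psnd (kf c)) \<noteq> 0"
    by metis
  have cands: "\<forall>c\<in>set (list_decode (list_encode cs)). \<exists>a b. nker ode (diagram \<nu>) p q N z0 c (sing a) (sing b) \<and>
      cand ode (diagram \<nu>) p q L a b"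
    if "\<forall>x\<in>kf ` set cs. is_sol ode g P Q (poly_of \<nu> (pfst x)) (poly_of \<nu> (psnd x)) \<longrightarrow>
       x \<in> set (list_decode L)" for L cs
  proof
    fix c assume "c \<in> set (list_decode (list_encode cs))"
    thus "\<exists>a b. nker ode (diagram \<nu>) p q N z0 c (sing a) (sing b) \<and> cand ode (diagram \<nu>) p q L a b"
      using that kf[of c]
      by (intro exI[of _ "pfst (kf c)"] exI[of _ "psnd (kf c)"]) (auto simp: cand_val[OF \<nu> lens PQ])
  qed
  show ?thesis
  proof (cases "\<exists>z x :: nat. defectf ode g P Q A' B' (of_nat z) (of_nat x) \<noteq> 0")
    case True
    then obtain z1 x1 :: nat where E: "defectf ode g P Q A' B' (of_nat z1) (of_nat x1) \<noteq> 0" by blast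
    let ?E = "defectf ode g P Q A' B' (of_nat z1)"
    have pfE: "pf ((g + 2) * max (degree A') (degree B')) ?E" by (intro pf_defectf) auto
    obtain x :: nat where x: "?h (of_nat x) * ?E (of_nat x) \<noteq> 0" using pf_nonzero_mult[OF pfh pfE h E] by blast
    obtain e cs where ecs: "\<nu> e \<noteq> 0" "\<And>x. ?h x * ?E x = \<nu> e * (\<Prod>c\<leftarrow>cs. x - \<nu> c)"
      using roots[OF pf_mult[OF pfh pfE] csubfield_mult[OF K hK EK] x] by blast
    show ?thesis
    proof (rule exI[of _ "kf ` set cs"], intro conjI allI impI)
      fix L assume "\<forall>x\<in>kf ` set cs. is_sol ode g P Q (poly_of \<nu> (pfst x)) (poly_of \<nu> (psnd x)) \<longrightarrow>
         x \<in> set (list_decode L)"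
      note c = cands[OF this]
      have "covered ode (diagram \<nu>) p q L N (T A B (list_encode cs)) z0 A B ns nz2 (list_encode cs) e"
        unfolding covered_def using c ecs
        by (intro conjI disjI1 exI[of _ z1]) (simp_all add: cv ns A B AB'(6))
      thus "\<exists>A B s z2 cs e. covered ode (diagram \<nu>) p q L N (T A B cs) z0 A B s z2 cs e" by blast
    qed simp
  next
    case False
    hence const: "poly A' [:c:] * poly B' [:c':] = poly B' [:c:] * poly A' [:c':]" for c c'
      using defectf_dichotomy[OF rc dM size_bounds(1,2)] by blast
    obtain e cs where ecs: "\<nu> e \<noteq> 0" "\<And>x. ?h x = \<nu> e * (\<Prod>c\<leftarrow>cs. x - \<nu> c)"
      using roots[OF pfh hK h] by blast
    have x2: "of_nat x2 \<in> range \<nu>" by (rule csubfield_of_nat[OF K])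
    obtain a where a: "poly_of \<nu> a = poly A' [:of_nat x2:]"
      using poly_code_exists[OF poly_over_eval[OF K AB'(1) x2] lessI] by metis
    obtain b where b: "poly_of \<nu> b = poly B' [:of_nat x2:]"
      using poly_code_exists[OF poly_over_eval[OF K AB'(2) x2] lessI] by metis
    have ab: "poly_of \<nu> a \<noteq> 0 \<or> poly_of \<nu> b \<noteq> 0"
      using h unfolding a b by (auto simp: headf_def ev2_def)
    have proportional: "ev2 A' z x * poly (poly_of \<nu> b) z = ev2 B' z x * poly (poly_of \<nu> a) z" for z x
      using const[of x "of_nat x2"] unfolding a b ev2_def by (metis poly_mult)
    show ?thesis
    proof (rule exI[of _ "insert (prod_encode (a, b)) (kf ` set cs)"], intro conjI allI impI)
      fix L assume L: "\<forall>x\<in>insert (prod_encode (a, b)) (kf ` set cs).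
        is_sol ode g P Q (poly_of \<nu> (pfst x)) (poly_of \<nu> (psnd x)) \<longrightarrow> x \<in> set (list_decode L)"
      have c: "\<forall>c\<in>set (list_decode (list_encode cs)). \<exists>a b. nker ode (diagram \<nu>) p q N z0 c (sing a) (sing b) \<and>
          cand ode (diagram \<nu>) p q L a b"
        by (rule cands) (use L in auto)
      have "cand ode (diagram \<nu>) p q L a b" using L ab by (auto simp: cand_val[OF \<nu> lens PQ])
      hence "covered ode (diagram \<nu>) p q L N (T A B (list_encode cs)) z0 A B ns nz2 (list_encode cs) e"
        unfolding covered_def using c ecs
        by (intro conjI disjI2 exI[of _ a] exI[of _ b]) (simp_all add: cv ns A B AB'(6) proportional)
      thus "\<exists>A B s z2 cs e. covered ode (diagram \<nu>) p q L N (T A B cs) z0 A B s z2 cs e" by blast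
    qed simp
  qed
qed

end

section \<open>Effective computability and the explicit bounds\<close>

lemma deg_w_0: "deg_w 0 = 0"
proof -
  have "deg_w (Fract 0 1) = 0" by (subst deg_w_deg_z_Fract) auto
  thus ?thesis by (simp add: Zero_fract_def)
qed

lemma cross_num2_den2:
  assumes "p0 * q = p * q0" "q0 \<noteq> 0"
  shows "p * den2 (Fract p0 q0) = num2 (Fract p0 q0) * q"
proof -
  let ?R = "Fract p0 q0"
  have "Fract (num2 ?R) (den2 ?R) = Fract p0 q0" by (rule num2_den2)
  hence "num2 ?R * q0 = p0 * den2 ?R" using assms(2) num2_den2(2)[of ?R] by (simp add: eq_fract)
  hence "q0 * (p * den2 ?R) = q0 * (num2 ?R * q)" using assms(1) by algebra
  thus ?thesis using assms(2) by simp
qed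

lemma same_fraction_val:
  assumes \<nu>: "acf_numbering \<nu>"
  shows "same_fraction (diagram \<nu>) p0 q0 p q \<longleftrightarrow> clength p = clength q \<and> poly2_of \<nu> q \<noteq> 0 \<and>
     poly2_of \<nu> p0 * poly2_of \<nu> q = poly2_of \<nu> p * poly2_of \<nu> q0"
proof -
  let ?T = "p0 + q0 + p + q"
  have z: "zdeg_le (poly2_of \<nu> a * poly2_of \<nu> b) ?T" "degree (poly2_of \<nu> a * poly2_of \<nu> b) \<le> ?T"
    if "a + b \<le> ?T" for a b
    using zdeg_le_mono[OF zdeg_le_mult[OF zdeg_poly2_of[of \<nu> a] zdeg_poly2_of[of \<nu> b]] that]
      degree_mult_le[of "poly2_of \<nu> a" "poly2_of \<nu> b"] degree_poly2_of[of \<nu> a] degree_poly2_of[of \<nu> b] that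
    by auto
  have "(\<forall>i<Suc ?T. \<forall>j<Suc ?T. ev2 (poly2_of \<nu> p0) (of_nat i) (of_nat j) * ev2 (poly2_of \<nu> q) (of_nat i) (of_nat j) =
      ev2 (poly2_of \<nu> p) (of_nat i) (of_nat j) * ev2 (poly2_of \<nu> q0) (of_nat i) (of_nat j)) \<longleftrightarrow>
      poly2_of \<nu> p0 * poly2_of \<nu> q = poly2_of \<nu> p * poly2_of \<nu> q0"
    (is "?l \<longleftrightarrow> ?r")
  proof
    assume ?l
    thus ?r by (intro ev2_grid_eq[OF z(1) z(1) z(2) z(2) lessI]) auto
  next
    assume r: ?r
    have "ev2 (poly2_of \<nu> p0 * poly2_of \<nu> q) z x = ev2 (poly2_of \<nu> p * poly2_of \<nu> q0) z x" for z x
      unfolding r ..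
    thus ?l by simp
  qed
  thus ?thesis
    unfolding same_fraction_def
    by (simp only: neq_val[OF \<nu>] nev2_val[OF \<nu>] nmul_val[OF \<nu>] nnat_val[OF \<nu>] nzero_val[OF \<nu>] ev2_nonroot_iff)
qed

lemma reduced_val:
  assumes \<nu>: "acf_numbering \<nu>"
  shows "reduced (diagram \<nu>) p q u v r \<longleftrightarrow> poly_of \<nu> r \<noteq> 0 \<and>
     poly2_of \<nu> u * poly2_of \<nu> p + poly2_of \<nu> v * poly2_of \<nu> q = [:poly_of \<nu> r:]"
proof -
  let ?T = "p + q + u + v + r"
  let ?C = "poly2_of \<nu> u * poly2_of \<nu> p + poly2_of \<nu> v * poly2_of \<nu> q"
  have z: "zdeg_le (poly2_of \<nu> a * poly2_of \<nu> b) ?T" "degree (poly2_of \<nu> a * poly2_of \<nu> b) \<le> ?T"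
    if "a + b \<le> ?T" for a b
    using zdeg_le_mono[OF zdeg_le_mult[OF zdeg_poly2_of[of \<nu> a] zdeg_poly2_of[of \<nu> b]] that]
      degree_mult_le[of "poly2_of \<nu> a" "poly2_of \<nu> b"] degree_poly2_of[of \<nu> a] degree_poly2_of[of \<nu> b] that
    by auto
  have "(\<forall>i<Suc ?T. \<forall>j<Suc ?T. ev2 (poly2_of \<nu> u) (of_nat i) (of_nat j) * ev2 (poly2_of \<nu> p) (of_nat i) (of_nat j) +
      ev2 (poly2_of \<nu> v) (of_nat i) (of_nat j) * ev2 (poly2_of \<nu> q) (of_nat i) (of_nat j) =
      poly (poly_of \<nu> r) (of_nat i)) \<longleftrightarrow> ?C = [:poly_of \<nu> r:]" (is "?l \<longleftrightarrow> ?r")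
  proof
    assume l: ?l
    show ?r
    proof (rule ev2_grid_eq)
      show "zdeg_le ?C ?T" "degree ?C \<le> ?T"
        using z by (auto intro!: zdeg_le_add degree_add_le)
      show "zdeg_le [:poly_of \<nu> r:] ?T"
        using degree_poly_of[of \<nu> r] by (auto simp: zdeg_le_def coeff_pCons split: nat.splits)
      show "ev2 ?C (of_nat i) (of_nat j) = ev2 [:poly_of \<nu> r:] (of_nat i) (of_nat j)"
        if "i < Suc ?T" "j < Suc ?T" for i j using l that by simp
    qed auto
  next
    assume r: ?r
    have "ev2 ?C z x = ev2 [:poly_of \<nu> r:] z x" for z x
      unfolding r ..
    thus ?l by simp
  qed
  thus ?thesis
    unfolding reduced_def
    by (simp only: neq_val[OF \<nu>] nev2_val[OF \<nu>] nmul_val[OF \<nu>] nadd_val[OF \<nu>] nnat_val[OF \<nu>] nzero_val[OF \<nu>]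
        neval_val[OF \<nu>] nonroot_iff)
qed

lemma poly2_of_eq_0_iff:
  "poly2_of \<nu> n = 0 \<longleftrightarrow> (\<forall>i<Suc m. \<forall>j<Suc m. ev2 (poly2_of \<nu> n) (of_nat i) (of_nat j) = 0)" if "n \<le> m"
proof
  assume "\<forall>i<Suc m. \<forall>j<Suc m. ev2 (poly2_of \<nu> n) (of_nat i) (of_nat j) = 0"
  thus "poly2_of \<nu> n = 0"
    using zdeg_le_mono[OF zdeg_poly2_of that] degree_poly2_of[of \<nu> n] that
    by (intro ev2_grid_eq_0[where T = "Suc m"]) auto
qed simp

lemma answer_sound:
  assumes \<nu>: "acf_numbering \<nu>" and ans: "answer ode (diagram \<nu>) n L"
    and deg: "edeg ode < deg_w (ratfun2_of \<nu> n)"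
  shows "ratfun_of \<nu> ` set (list_decode L) = solutions ode (ratfun2_of \<nu> n)"
proof -
  define p0 q0 R where "p0 = pfst n" and "q0 = psnd n" and "R = ratfun2_of \<nu> n"
  have R: "R = Fract (poly2_of \<nu> p0) (poly2_of \<nu> q0)"
    by (simp add: R_def ratfun2_of_def p0_def q0_def case_prod_unfold)
  have q0: "poly2_of \<nu> q0 \<noteq> 0"
  proof
    assume "poly2_of \<nu> q0 = 0"
    hence "R = 0" by (simp add: R eq_fract(2) Zero_fract_def)
    thus False using deg deg_w_0 by (simp flip: R_def)
  qed
  hence "\<not> (\<forall>i < Suc n. \<forall>j < Suc n. neq (diagram \<nu>) (nev2 (diagram \<nu>) q0 (nnat (diagram \<nu>) i) (nnat (diagram \<nu>) j)) (nzero (diagram \<nu>)))"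
    using poly2_of_eq_0_iff[of q0 n \<nu>] psnd_le[of n] by (simp add: \<nu> nev2_val[OF \<nu>] q0_def)
  then obtain p q where pq: "same_fraction (diagram \<nu>) p0 q0 p q" and
    alt: "clength p \<le> Suc (edeg ode) \<or> (\<exists>u v r. reduced (diagram \<nu>) p q u v r) \<and>
         (\<forall>f \<in> set (list_decode L). nsol ode (diagram \<nu>) p q (pfst f) (psnd f)) \<and> complete ode (diagram \<nu>) p q L"
    using ans unfolding answer_def p0_def[symmetric] q0_def[symmetric] by blast
  define P Q where PQ: "P = poly2_of \<nu> p" "Q = poly2_of \<nu> q"
  have sf: "clength p = clength q" "Q \<noteq> 0" "poly2_of \<nu> p0 * Q = P * poly2_of \<nu> q0"
    using pq unfolding same_fraction_val[OF \<nu>] PQ by auto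
  have "clength q \<noteq> 0" using sf(2) by (auto simp: PQ poly2_of_def)
  then obtain g where g: "clength p = Suc g" "clength q = Suc g" using sf(1) by (metis not0_implies_Suc)
  have rep: "P * den2 R = num2 R * Q" unfolding R by (rule cross_num2_den2[OF sf(3) q0])
  \<comment> \<open>The reduced pair satisfies a Bezout identity, so no other representation of
    \<open>R\<close> has smaller degree; the length test therefore cannot be what accepted
    \<open>L\<close>.\<close>
  have "deg_w R \<le> max (degree P) (degree Q)"
    using rcoprime_degree_le[OF rcoprime_num2_den2[of R], of Q P] rep sf(2) unfolding deg_w_def by auto
  hence dM: "edeg ode < max (degree P) (degree Q)" using deg by (simp flip: R_def)
  also have "max (degree P) (degree Q) \<le> g"
    using degree_poly2_of_clength[of \<nu> p] degree_poly2_of_clength[of \<nu> q] g by (simp add: PQ)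
  finally have "\<not> clength p \<le> Suc (edeg ode)" using g by simp
  with alt obtain u v r where red: "reduced (diagram \<nu>) p q u v r"
    and sols: "\<And>f. f \<in> set (list_decode L) \<Longrightarrow> nsol ode (diagram \<nu>) p q (pfst f) (psnd f)"
    and comp: "complete ode (diagram \<nu>) p q L" by blast
  have rc: "rcoprime P Q" using red unfolding reduced_val[OF \<nu>] rcoprime_def PQ by blast
  note sb = size_bounds[OF \<nu> g PQ refl rc dM]
  show ?thesis unfolding R_def[symmetric]
  proof (intro equalityI subsetI)
    fix f assume "f \<in> solutions ode R"
    thus "f \<in> ratfun_of \<nu> ` set (list_decode L)"
      by (rule complete_sound[OF \<nu> g PQ refl rc dM rep comp])
  next
    fix f assume "f \<in> ratfun_of \<nu> ` set (list_decode L)"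
    then obtain x where x: "x \<in> set (list_decode L)" "f = Fract (poly_of \<nu> (pfst x)) (poly_of \<nu> (psnd x))"
      by (auto simp: ratfun_of_def case_prod_unfold)
    have "is_sol ode g P Q (poly_of \<nu> (pfst x)) (poly_of \<nu> (psnd x))"
      using sols[OF x(1)] unfolding nsol_val[OF \<nu> g PQ] .
    thus "f \<in> solutions ode R"
      unfolding x(2) using solutions_iff[OF rep rc sb(1,2)] by (auto simp: is_sol_def)
  qed
qed

text \<open>Among the representations with coefficients in \<open>K\<close> one of least degree is
  taken. If its Bezout combination over \<open>K\<close> had \<open>r = 0\<close>, then
  \<open>- v / u\<close> would represent the same fraction in smaller degree.\<close>

lemma reduced_representation:
  assumes K: "csubfield K" and p0q0: "poly2_over K p0" "poly2_over K q0" "q0 \<noteq> 0"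
  obtains p q where "poly2_over K p" "poly2_over K q" "q \<noteq> 0" "p0 * q = p * q0"
    "max (degree p) (degree q) = 0 \<or>
     (\<exists>u v r. poly2_over K u \<and> poly2_over K v \<and> poly_over K r \<and> r \<noteq> 0 \<and> u * p + v * q = [:r:])"
proof -
  define rep where "rep p q d \<longleftrightarrow> poly2_over K p \<and> poly2_over K q \<and> q \<noteq> 0 \<and> p0 * q = p * q0 \<and>
    max (degree p) (degree q) = d" for p q d
  define d where "d = (LEAST d. \<exists>p q. rep p q d)"
  have "\<exists>d p q. rep p q d" unfolding rep_def using p0q0 by blast
  hence "\<exists>p q. rep p q d" unfolding d_def by (rule LeastI_ex)
  then obtain p q where rep: "rep p q d" by blast
  hence pq: "poly2_over K p" "poly2_over K q" "q \<noteq> 0" "p0 * q = p * q0" "max (degree p) (degree q) = d"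
    by (auto simp: rep_def)
  have "\<exists>u v r. poly2_over K u \<and> poly2_over K v \<and> poly_over K r \<and> r \<noteq> 0 \<and> u * p + v * q = [:r:]" if d: "d \<noteq> 0"
  proof -
    obtain m where z: "zdeg_le p m" "zdeg_le q m" using zdeg_le_exists2 by blast
    have deg: "degree p \<le> d" "degree q \<le> d" "0 < 2 * d" using pq(5) d by auto
    obtain u v r where uv: "poly2_over K u" "poly2_over K v" "degree u < d" "degree v < d" "u \<noteq> 0 \<or> v \<noteq> 0"
      "u * p + v * q = monom r 0"
      by (rule sylvester_combination[OF K pq(1,2) deg(1,2) z deg(3)]) (rule that)
    have "poly2_over K (u * p + v * q)" using uv pq by (intro poly2_over_add poly2_over_mult K)
    hence rK: "poly_over K r" unfolding uv(6) poly2_over_def by (metis coeff_monom)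
    have "r \<noteq> 0"
    proof
      assume "r = 0"
      hence uv0: "u * p = - v * q" using uv(6) by (simp add: eq_neg_iff_add_eq_0)
      have u0: "u \<noteq> 0"
      proof
        assume "u = 0"
        thus False using uv0 uv(5) pq(3) by auto
      qed
      have "q * (p0 * u) = q * (- v * q0)" using uv0 pq(4) by algebra
      hence "p0 * u = - v * q0" using pq(3) by (simp only: mult_cancel_left) simp
      moreover have "poly2_over K (- v)"
        using uv(2) by (auto simp: poly2_over_def intro: poly_over_minus[OF K])
      ultimately have "rep (- v) u (max (degree v) (degree u))"
        using uv u0 by (simp add: rep_def)
      hence "d \<le> max (degree v) (degree u)" unfolding d_def by (intro Least_le) blast
      thus False using uv(3,4) by simp
    qed
    thus ?thesis using uv rK by (auto simp: monom_0)
  qed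
  with pq show thesis by (intro that[of p q]) auto
qed

lemma answer_exists:
  assumes \<nu>: "acf_numbering \<nu>"
  shows "\<exists>L. answer ode (diagram \<nu>) n L"
proof -
  define p0 q0 where "p0 = pfst n" and "q0 = psnd n"
  note K = csubfield_range[OF \<nu>]
  show ?thesis
  proof (cases "poly2_of \<nu> q0 = 0")
    case True
    thus ?thesis
      by (intro exI[of _ 0]) (simp add: answer_def \<nu> nev2_val[OF \<nu>] q0_def)
  next
    case False
    obtain P Q where pq: "poly2_over (range \<nu>) P" "poly2_over (range \<nu>) Q" "Q \<noteq> 0"
      "poly2_of \<nu> p0 * Q = P * poly2_of \<nu> q0"
      "max (degree P) (degree Q) = 0 \<or> (\<exists>u v r. poly2_over (range \<nu>) u \<and> poly2_over (range \<nu>) v \<and>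
         poly_over (range \<nu>) r \<and> r \<noteq> 0 \<and> u * P + v * Q = [:r:])"
      by (rule reduced_representation[OF K poly2_over_poly2_of[OF K] poly2_over_poly2_of[OF K] False]) (rule that)
    define g where "g = max (degree P) (degree Q)"
    have code: "\<exists>a. poly2_of \<nu> a = C \<and> clength a = m" if "poly2_over (range \<nu>) C" "degree C < m" for C m
      using zdeg_le_exists[of C] poly2_code_exists[OF that] by metis
    obtain p where p: "poly2_of \<nu> p = P" "clength p = Suc g" using code[OF pq(1), of "Suc g"] unfolding g_def by (metis le_imp_less_Suc max.cobounded1)
    obtain q where q: "poly2_of \<nu> q = Q" "clength q = Suc g" using code[OF pq(2), of "Suc g"] unfolding g_def by (metis le_imp_less_Suc max.cobounded2)
    have same: "same_fraction (diagram \<nu>) p0 q0 p q"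
      unfolding same_fraction_val[OF \<nu>] using p q pq by simp
    show ?thesis
    proof (cases "clength p \<le> Suc (edeg ode)")
      case True
      thus ?thesis using same unfolding answer_def p0_def q0_def by blast
    next
      case short: False
      hence dM: "edeg ode < max (degree P) (degree Q)" using p(2) by (simp only: g_def Suc_le_mono not_le)
      then obtain u' v' r' where uvr: "poly2_over (range \<nu>) u'" "poly2_over (range \<nu>) v'" "poly_over (range \<nu>) r'"
        "r' \<noteq> 0" "u' * P + v' * Q = [:r':]" using pq(5) by auto
      obtain u v where uv: "poly2_of \<nu> u = u'" "poly2_of \<nu> v = v'"
        using code[OF uvr(1) lessI] code[OF uvr(2) lessI] by metis
      obtain r where r: "poly_of \<nu> r = r'" using poly_code_exists[OF uvr(3) lessI] by metis
      have red: "reduced (diagram \<nu>) p q u v r"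
        unfolding reduced_val[OF \<nu>] using uv r p q uvr by simp
      have rc: "rcoprime P Q" using uvr unfolding rcoprime_def by blast
      note ctx = \<nu> p(2) q(2) p(1)[symmetric] q(1)[symmetric] refl rc dM
      let ?sol = "\<lambda>x. is_sol ode g P Q (poly_of \<nu> (pfst x)) (poly_of \<nu> (psnd x))"
      let ?T = "\<lambda>A B cs. Suc ((p + q + 3) * (A + B) + rho ode (p + q) (Nb (p + q)) + cs)"
      have "\<forall>z0. \<exists>X. finite X \<and> (\<forall>L. (\<forall>x\<in>X. ?sol x \<longrightarrow> x \<in> set (list_decode L)) \<longrightarrow>
          (\<exists>A B s z2 cs e. covered ode (diagram \<nu>) p q L (Nb (p + q)) (?T A B cs) z0 A B s z2 cs e))"
        using covered_exists[OF ctx, where N = "Nb (p + q)" and T = ?T] by blast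
      then obtain X where X: "\<And>z0. finite (X z0)"
        "\<And>z0 L. (\<forall>x\<in>X z0. ?sol x \<longrightarrow> x \<in> set (list_decode L)) \<Longrightarrow>
          \<exists>A B s z2 cs e. covered ode (diagram \<nu>) p q L (Nb (p + q)) (?T A B cs) z0 A B s z2 cs e"
        by metis
      \<comment> \<open>The true solutions among the candidates of all starting points: listing
        exactly these satisfies both the soundness and the completeness test.\<close>
      define Y where "Y = {x \<in> (\<Union>z0 < Suc (Zb (p + q)). X z0). ?sol x}"
      have "finite Y" unfolding Y_def using X(1) by auto
      then obtain ys where ys: "set ys = Y" using finite_list by blast
      define L where "L = list_encode ys"
      have "complete ode (diagram \<nu>) p q L"
        unfolding complete_def by (intro allI impI X(2)) (auto simp: L_def ys Y_def)
      moreover have "\<forall>f\<in>set (list_decode L). nsol ode (diagram \<nu>) p q (pfst f) (psnd f)"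
        by (auto simp: L_def ys Y_def nsol_val[OF \<nu> p(2) q(2) p(1)[symmetric] q(1)[symmetric]])
      ultimately have "answer ode (diagram \<nu>) n L"
        using same red unfolding answer_def p0_def q0_def by blast
      thus ?thesis ..
    qed
  qed
qed

lemma effectively_computable_solutions:
  "effectively_computable (\<lambda>R. edeg ode < deg_w R) (solutions ode)"
proof -
  have "\<exists>L. answer ode \<omega> n L" if "\<omega> \<in> Wd" for \<omega> n
    using that by (rule WdE) (simp add: answer_exists)
  then obtain F where F: "recursive_in Wd 1 F" "\<And>\<omega> n. \<omega> \<in> Wd \<Longrightarrow> answer ode \<omega> n (F \<omega> [n])"
    using sd_uniformize[OF sd_answer[of ode]] by metis
  show ?thesis unfolding effectively_computable_def
  proof (intro exI[of _ F] conjI allI impI)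
    show "recursive_in (diagram ` Collect acf_numbering) 1 F" using F(1) by (simp add: Wd_def)
    fix \<nu> n assume "acf_numbering \<nu>" "edeg ode < deg_w (ratfun2_of \<nu> n)"
    thus "ratfun_of \<nu> ` set (list_decode (F (diagram \<nu>) [n])) = solutions ode (ratfun2_of \<nu> n)"
      using F(2) by (intro answer_sound) (auto simp: Wd_def)
  qed
qed

text \<open>The number of starting points times the bound for a single one, with \<open>M\<close>
  the sum of both degrees of \<open>R\<close>.\<close>

definition solution_bound :: "bool \<Rightarrow> nat \<Rightarrow> nat" where
  "solution_bound ode M = (Zb M + 1) * ((M + 3) * ((2 * Nb M + 1) * rho ode M (Nb M)) + 1)"

lemma recursive2_solution_bound: "recursive2 (\<lambda>m n. solution_bound ode (m + n))"
proof -
  let ?W = "{\<lambda>_. 0} :: (nat \<Rightarrow> nat) set"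
  have "cf ?W (\<lambda>\<omega> x. solution_bound ode x)"
    unfolding solution_bound_def by (intro cf_mult cf_add cf_Zb cf_Nb cf_rho cf_const cf_id)
  hence "rec_ext ?W 2 (\<lambda>\<omega> xs. solution_bound ode (xs ! 0 + xs ! 1))"
    by (rule cf_pair_rec_ext[OF _ rec_ext_add_aux])
  then obtain F where "recursive_in ?W 2 F"
    "\<And>\<omega> xs. \<omega> \<in> ?W \<Longrightarrow> length xs = 2 \<Longrightarrow> F \<omega> xs = solution_bound ode (xs ! 0 + xs ! 1)"
    by (rule rec_extE) (rule that)
  thus ?thesis unfolding recursive2_def by (intro exI[of _ F]) simp
qed

lemma card_solutions_le:
  assumes "edeg ode < deg_w R"
  shows "finite (solutions ode R) \<and> card (solutions ode R) \<le> solution_bound ode (deg_w R + deg_z R)"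
proof -
  define M where "M = deg_w R + deg_z R"
  have "degree c \<le> deg_z R" if "c \<in> set (coeffs (num2 R)) \<union> set (coeffs (den2 R))" for c
    unfolding deg_z_def using that by (intro Max_ge) auto
  \<comment> \<open>\<open>coeffs\<close> omits the zero coefficients beyond the degree, whose
    degree is 0 and thus within the bound.\<close>
  moreover have "coeff s i \<in> set (coeffs s) \<union> {0}" for s :: "complex poly poly" and i
    using coeff_in_coeffs[of s i] by (cases "s = 0"; cases "i \<le> degree s") (auto simp: coeff_eq_0)
  ultimately have "degree (coeff (num2 R) i) \<le> deg_z R" "degree (coeff (den2 R) i) \<le> deg_z R" for i
    by (metis UnE UnI1 UnI2 degree_0 singletonD zero_le)+
  hence z: "zdeg_le (num2 R) M" "zdeg_le (den2 R) M"
    by (auto simp: zdeg_le_def M_def intro: trans_le_add2)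
  have "degree (num2 R) \<le> M" "degree (den2 R) \<le> M" by (auto simp: M_def deg_w_def)
  from card_solutions[OF refl rcoprime_num2_den2 _ this order_refl z, of ode]
  show ?thesis using assms unfolding solution_bound_def M_def[symmetric] by (simp add: deg_w_def mult.commute)
qed

theorem theorem1:
  "\<exists>B1 B2 :: nat \<Rightarrow> nat \<Rightarrow> nat. recursive2 B1 \<and> recursive2 B2 \<and>
     (\<forall>R. deg_w R \<ge> 2 \<longrightarrow>
        finite (difference_solutions R) \<and>
        card (difference_solutions R) \<le> B1 (deg_w R) (deg_z R)) \<and>
     effectively_computable (\<lambda>R. deg_w R \<ge> 2) difference_solutions \<and>
     (\<forall>R. deg_w R \<ge> 3 \<longrightarrow>
        finite (differential_solutions R) \<and>
        card (differential_solutions R) \<le> B2 (deg_w R) (deg_z R)) \<and>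
     effectively_computable (\<lambda>R. deg_w R \<ge> 3) differential_solutions"
proof -
  have sols: "solutions False = difference_solutions" "solutions True = differential_solutions"
    by (auto simp: solutions_def step_def difference_solutions_def differential_solutions_def)
  have edeg: "edeg False < d \<longleftrightarrow> 2 \<le> d" "edeg True < d \<longleftrightarrow> 3 \<le> d" for d
    by (auto simp: edeg_def)
  show ?thesis
    using recursive2_solution_bound[of False] recursive2_solution_bound[of True]
      card_solutions_le[of False] card_solutions_le[of True]
      effectively_computable_solutions[of False] effectively_computable_solutions[of True]
    unfolding sols edeg
    by (intro exI[of _ "\<lambda>m n. solution_bound False (m + n)"] exI[of _ "\<lambda>m n. solution_bound True (m + n)"]) blast
qed

end
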